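(* Let $n\geq 1$ and let $C\subset\mathbb{P}^n$ be a nondegenerate and nonsingular curve over $\mathbb{C}$. For $p\in C$ let $T_p(C)\subset\mathbb{P}^n$ denote the tangent line to $C$ at $p$. Then the following are equivalent: (i) for every point $p\in C$ and every point $x\in T_p(C)$ with $x\neq p$, the $C$-rank of $x$ is equal to $n$; (ii) $C$ is a rational normal curve in $\mathbb{P}^n$. In other words, the rational normal curve is the only nondegenerate and nonsingular curve in $\mathbb{P}^n$ such that all the points in its tangent lines (except the point of tangency) have rank $n$.
   Context: The base field is $\mathbb{C}$, and $\mathbb{P}^n$ is projective $n$-space over $\mathbb{C}$. A curve means an irreducible projective curve $C\subset\mathbb{P}^n$ (a closed irreducible one-dimensional subvariety). It is nondegenerate if it is not contained in any hyperplane of $\mathbb{P}^n$. The tangent line $T_p(C)$ at a point $p$ of a nonsingular curve $C$ is the embedded projective tangent line in $\mathbb{P}^n$. For a nondegenerate and nonsingular curve $C\subset\mathbb{P}^n$ and a point $x\in\mathbb{P}^n$, the $C$-rank of $x$, denoted $\operatorname{rk}(x)$, is the smallest number $r$ such that $x$ lies in the linear span of $r$ points of $C$. A rational normal curve in $\mathbb{P}^n$ is a nondegenerate curve of degree $n$ in $\mathbb{P}^n$; equivalently, the image of $\mathbb{P}^1\to\mathbb{P}^n$, $[s:t]\mapsto[s^n:s^{n-1}t:\dots:t^n]$, up to a projective linear automorphism of $\mathbb{P}^n$. *)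

theory Defs
  imports "HOL-Analysis.Analysis" "HOL-Library.Poly_Mapping" "HOL-Library.Extended_Nat"
begin

section \<open>Projective space\<close>

text \<open>
  The points of the projective space with homogeneous coordinates indexed by the finite type
  \<open>'n\<close> (so of dimension \<open>CARD('n) - 1\<close>) are the one-dimensional complex subspaces
  of \<open>complex ^ 'n\<close>. The prefix \<open>vec\<close> selects the linear algebra over the field of
  scalars \<open>complex\<close>; the unprefixed \<open>span\<close>, \<open>dim\<close> are those over the reals.
\<close>

typedef ('n::finite) proj = "{L :: (complex ^ 'n) set. vec.subspace L \<and> vec.dim L = 1}"
  morphisms line_of Proj
proof
  let ?v = "1 :: complex ^ 'n"
  have "vec.dim (vec.span {?v}) = 1"
    by (simp add: vec.dim_span vec.dim_eq_card_independent)
  then show "vec.span {?v} \<in> {L. vec.subspace L \<and> vec.dim L = 1}"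
    by simp
qed

definition point_of :: "complex ^ 'n::finite \<Rightarrow> 'n proj" where
  "point_of v = Proj (vec.span {v})"

definition linear_span :: "'n::finite proj set \<Rightarrow> 'n proj set" where
  "linear_span S = {x. line_of x \<subseteq> vec.span (\<Union>p\<in>S. line_of p)}"

definition hyperplane :: "'n::finite proj set \<Rightarrow> bool" where
  "hyperplane H \<longleftrightarrow> (\<exists>a :: complex ^ 'n. a \<noteq> 0 \<and>
     H = {p. \<forall>v\<in>line_of p. (\<Sum>i\<in>UNIV. a $ i * v $ i) = 0})"

definition nondegenerate :: "'n::finite proj set \<Rightarrow> bool" where
  "nondegenerate X \<longleftrightarrow> \<not> (\<exists>H. hyperplane H \<and> X \<subseteq> H)"

definition projectivity :: "complex ^ 'n::finite ^ 'n \<Rightarrow> 'n proj \<Rightarrow> 'n proj" where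
  "projectivity A p = Proj ((*v) A ` line_of p)"


section \<open>Polynomials in the homogeneous coordinates\<close>

text \<open>
  A polynomial is a finitely supported map from monomials to coefficients, and a monomial is
  a finitely supported map from the variables to their exponents.
\<close>

type_synonym 'n mpoly = "('n \<Rightarrow>\<^sub>0 nat) \<Rightarrow>\<^sub>0 complex"

definition mpoly_eval :: "'n mpoly \<Rightarrow> complex ^ 'n \<Rightarrow> complex" where
  "mpoly_eval f v =
     (\<Sum>m\<in>Poly_Mapping.keys f.
        Poly_Mapping.lookup f m * (\<Prod>i\<in>UNIV. v $ i ^ Poly_Mapping.lookup m i))"

definition homogeneous :: "nat \<Rightarrow> 'n::finite mpoly \<Rightarrow> bool" where
  "homogeneous d f \<longleftrightarrow> (\<forall>m\<in>Poly_Mapping.keys f. (\<Sum>i\<in>UNIV. Poly_Mapping.lookup m i) = d)"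

text \<open>
  In the formal partial derivative the exponents are subtracted on \<open>nat\<close>; where that
  truncates, the coefficient is \<open>0\<close>.
\<close>

definition mpoly_deriv :: "'n \<Rightarrow> 'n mpoly \<Rightarrow> 'n mpoly" where
  "mpoly_deriv i f =
     (\<Sum>m\<in>Poly_Mapping.keys f.
        Poly_Mapping.single (m - Poly_Mapping.single i 1)
          (of_nat (Poly_Mapping.lookup m i) * Poly_Mapping.lookup f m))"


section \<open>Projective varieties\<close>

definition vanishes_at :: "'n::finite mpoly \<Rightarrow> 'n proj \<Rightarrow> bool" where
  "vanishes_at f p \<longleftrightarrow> (\<forall>v\<in>line_of p. mpoly_eval f v = 0)"

definition zariski_closed :: "'n::finite proj set \<Rightarrow> bool" where
  "zariski_closed X \<longleftrightarrow>
     (\<exists>F. (\<forall>f\<in>F. \<exists>d. homogeneous d f) \<and> X = {p. \<forall>f\<in>F. vanishes_at f p})"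

definition irreducible_closed :: "'n::finite proj set \<Rightarrow> bool" where
  "irreducible_closed X \<longleftrightarrow> zariski_closed X \<and> X \<noteq> {} \<and>
     (\<forall>A B. zariski_closed A \<longrightarrow> zariski_closed B \<longrightarrow> X = A \<union> B \<longrightarrow> X = A \<or> X = B)"

text \<open>The Krull dimension of a closed set in the Zariski topology.\<close>

definition krull_dim :: "'n::finite proj set \<Rightarrow> enat" where
  "krull_dim X = Sup {enat d | d. \<exists>Z :: nat \<Rightarrow> 'n proj set.
     (\<forall>i\<le>d. irreducible_closed (Z i) \<and> Z i \<subseteq> X) \<and> (\<forall>i<d. Z i \<subset> Z (Suc i))}"

definition curve :: "'n::finite proj set \<Rightarrow> bool" where
  "curve C \<longleftrightarrow> irreducible_closed C \<and> krull_dim C = 1"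

text \<open>The homogeneous elements of the homogeneous ideal of \<open>X\<close>.\<close>

definition vanishing_forms :: "'n::finite proj set \<Rightarrow> 'n mpoly set" where
  "vanishing_forms X = {f. (\<exists>d. homogeneous d f) \<and> (\<forall>p\<in>X. vanishes_at f p)}"

text \<open>
  The linear subspace underlying the embedded projective tangent space at \<open>p\<close>, i.e. the
  kernel of the Jacobian matrix of the homogeneous ideal of \<open>X\<close>. The partial derivatives of
  a form are themselves forms, so the choice of \<open>v \<noteq> 0\<close> on the line \<open>p\<close> is immaterial.
\<close>

definition tangent_space :: "'n::finite proj set \<Rightarrow> 'n proj \<Rightarrow> (complex ^ 'n) set" where
  "tangent_space X p = {w. \<forall>f\<in>vanishing_forms X. \<forall>v\<in>line_of p - {0}.
     (\<Sum>i\<in>UNIV. mpoly_eval (mpoly_deriv i f) v * w $ i) = 0}"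

definition embedded_tangent_space :: "'n::finite proj set \<Rightarrow> 'n proj \<Rightarrow> 'n proj set" where
  "embedded_tangent_space X p = {x. line_of x \<subseteq> tangent_space X p}"

text \<open>
  The Jacobian criterion: the projective tangent space, whose dimension is one less than that
  of the underlying linear space, has the dimension of \<open>X\<close>. Equivalently, the Jacobian matrix
  has rank equal to the codimension of \<open>X\<close>.
\<close>

definition nonsingular :: "'n::finite proj set \<Rightarrow> bool" where
  "nonsingular X \<longleftrightarrow> (\<forall>p\<in>X. enat (vec.dim (tangent_space X p)) = krull_dim X + 1)"


section \<open>Rank with respect to a curve\<close>

text \<open>
  If \<open>C\<close> is nondegenerate, its points span the whole space, so the minimum is attained.
\<close>

definition curve_rank :: "'n::finite proj set \<Rightarrow> 'n proj \<Rightarrow> nat" where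
  "curve_rank C x = (LEAST r. \<exists>S. S \<subseteq> C \<and> finite S \<and> card S = r \<and> x \<in> linear_span S)"


section \<open>Rational normal curves\<close>

text \<open>
  The coordinate type carries no order, so a numbering \<open>e\<close> of the coordinates by
  \<open>0, \<dots>, n\<close> is a parameter. Two numberings differ by a permutation of the coordinates,
  which is a projectivity.
\<close>

definition veronese_point :: "('n::finite \<Rightarrow> nat) \<Rightarrow> complex \<Rightarrow> complex \<Rightarrow> 'n proj" where
  "veronese_point e s t = point_of (\<chi> i. s ^ (CARD('n) - 1 - e i) * t ^ e i)"

definition standard_rational_normal_curve :: "('n::finite \<Rightarrow> nat) \<Rightarrow> 'n proj set" where
  "standard_rational_normal_curve e = {veronese_point e s t | s t. (s, t) \<noteq> (0, 0)}"

definition rational_normal_curve :: "'n::finite proj set \<Rightarrow> bool" where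
  "rational_normal_curve C \<longleftrightarrow>
     (\<exists>e A. bij_betw e UNIV {0..CARD('n) - 1} \<and> invertible A \<and>
        C = projectivity A ` standard_rational_normal_curve e)"

end

theory Submission
  imports Defs "HOL-Complex_Analysis.Conformal_Mappings"
begin

text \<open>
  Suppose that every point of a tangent line, except the point of tangency, has rank \<open>n\<close>. Then the span of
  the tangent line at \<open>p\<close> and of at most \<open>n - 2\<close> further points of \<open>C\<close> meets \<open>C\<close> only in the span of these points and \<open>p\<close>:
  otherwise a point of the tangent line would lie in the span of at most \<open>n - 1\<close> points of \<open>C\<close>.
  Letting points \<open>q\<close> of \<open>C\<close> converge to \<open>p\<close>, one adds points one at a time and arrives at a hyperplane \<open>h = 0\<close> that meets
  \<open>C\<close> in \<open>n - 1\<close> points only, with multiplicity \<open>2\<close> at one of them and \<open>1\<close> at the others, so \<open>C\<close> has degree \<open>n\<close>.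
  For a quadratic form \<open>q\<close>, the function \<open>q / h\<^sup>2\<close> has at most \<open>2n\<close> poles, hence by the maximum principle
  the quadrics cut out a space of dimension at most \<open>2n + 1\<close> on \<open>C\<close>. Take \<open>n + 1\<close> independent points of \<open>C\<close> as
  coordinate points. Then \<open>2n + 2\<close> suitable quadrics are linearly dependent on \<open>C\<close>, and such a relation reduces to
  \<open>a x\<^sub>0 x\<^sub>1 + b x\<^sub>1 x\<^sub>i + c x\<^sub>0 x\<^sub>i = 0\<close>. So \<open>1 / x\<^sub>i\<close> is a combination of \<open>1 / x\<^sub>0\<close> and \<open>1 / x\<^sub>1\<close> on \<open>C\<close>, and
  clearing denominators parametrizes \<open>C\<close> by binary forms of degree \<open>n\<close>.

  Conversely, on a rational normal curve the tangent direction \<open>w\<close> at a point is, in suitable parameters,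
  a combination of the points with parameters the \<open>n\<close>-th roots of unity, and a product of \<open>n\<close> linear forms
  separates \<open>w\<close> from the point of tangency together with any \<open>n - 1\<close> points.
\<close>

section \<open>Forms as functions\<close>

text \<open>Neither degree nor genus is ever defined. Multiplicities are orders of vanishing in a
  chart parameter, and degree \<open>n\<close> survives only as a count of linear conditions: order
  4 at the tangency, order 2 at each of the \<open>n - 2\<close> simple points, and one value to fix
  the constant give \<open>2 * n + 1\<close>. The obstacle is the passage from algebra to analysis.
  \<open>curve\<close> and \<open>nonsingular\<close> speak of Krull dimension and of the Jacobian
  of a whole ideal, whereas limits and the maximum principle need holomorphic arcs. Arcs are
  produced at the points collected in \<open>smooth_cone\<close>. That set is nonempty and closed
  under nonzero limits, which together with vectors of norm 1 supplies the compactness. What holds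
  on one arc passes to all of \<open>C\<close>, because an arc is Zariski dense. Projective space
  gets no topology: its points are represented by vectors of the affine cone. Limits of spans are
  replaced by identities between the values of two linear functionals, which can be divided by the
  parameter before passing to the limit.\<close>

definition monom_eval :: "('n::finite \<Rightarrow>\<^sub>0 nat) \<Rightarrow> complex ^ 'n \<Rightarrow> complex" where
  "monom_eval m v = (\<Prod>i\<in>UNIV. v $ i ^ Poly_Mapping.lookup m i)"

lemma mpoly_eval_superset:
  assumes "finite S" "Poly_Mapping.keys f \<subseteq> S"
  shows "mpoly_eval f v = (\<Sum>m\<in>S. Poly_Mapping.lookup f m * monom_eval m v)"
  unfolding mpoly_eval_def monom_eval_def
  by (rule sum.mono_neutral_left) (use assms in \<open>auto simp: in_keys_iff\<close>)

lemma mpoly_eval_zero [simp]: "mpoly_eval 0 v = 0"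
  by (simp add: mpoly_eval_def)

lemma mpoly_eval_add: "mpoly_eval (f + g) v = mpoly_eval f v + mpoly_eval g v"
proof -
  let ?S = "Poly_Mapping.keys f \<union> Poly_Mapping.keys g"
  have "mpoly_eval h v = (\<Sum>m\<in>?S. Poly_Mapping.lookup h m * monom_eval m v)"
    if "Poly_Mapping.keys h \<subseteq> ?S" for h
    using that by (intro mpoly_eval_superset) auto
  then show ?thesis
    by (simp add: keys_add lookup_add distrib_right sum.distrib)
qed

lemma mpoly_eval_sum: "mpoly_eval (\<Sum>x\<in>A. f x) v = (\<Sum>x\<in>A. mpoly_eval (f x) v)"
  by (induction A rule: infinite_finite_induct) (auto simp: mpoly_eval_add)

lemma mpoly_eval_single: "mpoly_eval (Poly_Mapping.single m c) v = c * monom_eval m v"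
  by (cases "c = 0") (auto simp: mpoly_eval_def monom_eval_def)

lemma monom_eval_add: "monom_eval (m + m') v = monom_eval m v * monom_eval m' v"
  by (simp add: monom_eval_def lookup_add power_add prod.distrib)

lemma mpoly_expand:
  "f = (\<Sum>m\<in>Poly_Mapping.keys f. Poly_Mapping.single m (Poly_Mapping.lookup f m))"
  by (rule poly_mapping_eqI)
    (auto simp: lookup_sum lookup_single when_def in_keys_iff sum.delta)

lemma mpoly_eval_mult: "mpoly_eval (f * g) v = mpoly_eval f v * mpoly_eval g v"
proof -
  have "f * g = (\<Sum>m\<in>Poly_Mapping.keys f. \<Sum>m'\<in>Poly_Mapping.keys g.
      Poly_Mapping.single (m + m') (Poly_Mapping.lookup f m * Poly_Mapping.lookup g m'))"
    by (subst (1) mpoly_expand[of f], subst (1) mpoly_expand[of g])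
      (simp add: sum_product mult_single)
  then show ?thesis
    by (simp add: mpoly_eval_sum mpoly_eval_single monom_eval_add mpoly_eval_def[of f]
        mpoly_eval_def[of g] sum_product algebra_simps flip: monom_eval_def)
qed

text \<open>Forms are handled by their values, so that sums, products and linear forms combine by
  simple rules; a polynomial is recovered only where an ideal asks for one.\<close>

definition form :: "nat \<Rightarrow> (complex ^ 'n::finite \<Rightarrow> complex) \<Rightarrow> bool" where
  "form d h \<longleftrightarrow> (\<exists>f. homogeneous d f \<and> h = mpoly_eval f)"

lemma form_add:
  assumes "form d g" "form d h" shows "form d (\<lambda>v. g v + h v)"
proof -
  obtain a b where "homogeneous d a" "homogeneous d b" "g = mpoly_eval a" "h = mpoly_eval b"
    using assms by (auto simp: form_def)
  then show ?thesis unfolding form_def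
    by (intro exI[of _ "a + b"])
      (use keys_add[of a b] in \<open>auto simp: homogeneous_def mpoly_eval_add\<close>)
qed

lemma form_zero: "form d (\<lambda>v. 0)"
  unfolding form_def by (rule exI[of _ 0]) (auto simp: homogeneous_def)

lemma form_sum: "(\<And>x. x \<in> A \<Longrightarrow> form d (h x)) \<Longrightarrow> form d (\<lambda>v. \<Sum>x\<in>A. h x v)"
  by (induction A rule: infinite_finite_induct) (auto intro: form_zero form_add)

lemma form_mult:
  assumes "form d g" "form e h" shows "form (d + e) (\<lambda>v. g v * h v)"
proof -
  obtain a b where "homogeneous d a" "homogeneous e b" "g = mpoly_eval a" "h = mpoly_eval b"
    using assms by (auto simp: form_def)
  then show ?thesis unfolding form_def
    by (intro exI[of _ "a * b"])
      (use keys_mult[of a b] in \<open>fastforce simp: homogeneous_def mpoly_eval_mult lookup_add sum.distrib\<close>)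
qed

lemma form_const: "form 0 (\<lambda>v. c)"
  unfolding form_def by (rule exI[of _ "Poly_Mapping.single 0 c"])
    (auto simp: homogeneous_def mpoly_eval_single monom_eval_def split: if_splits)

lemma form_scale: "form d h \<Longrightarrow> form d (\<lambda>v. c * h v)"
  using form_mult[OF form_const, of d h c] by simp

lemma form_coord: "form 1 (\<lambda>v. v $ i)"
  unfolding form_def
proof (intro exI conjI)
  let ?f = "Poly_Mapping.single (Poly_Mapping.single i 1) (1 :: complex)"
  show "homogeneous 1 ?f"
    by (simp add: homogeneous_def lookup_single when_def)
  have "monom_eval (Poly_Mapping.single i 1) v = v $ i" for v :: "complex ^ 'a"
    by (simp add: monom_eval_def lookup_single when_def if_distrib[of "\<lambda>e. _ ^ e"] prod.delta
        cong: if_cong)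
  then show "(\<lambda>v. v $ i) = mpoly_eval ?f"
    by (simp add: mpoly_eval_single fun_eq_iff)
qed

lemma monom_eval_scale: "monom_eval m (c *s v) = c ^ (\<Sum>i\<in>UNIV. Poly_Mapping.lookup m i) * monom_eval m v"
  by (simp add: monom_eval_def power_mult_distrib prod.distrib power_sum)

lemma mpoly_eval_homogeneous:
  assumes "homogeneous d f" shows "mpoly_eval f (c *s v) = c ^ d * mpoly_eval f v"
  using assms unfolding homogeneous_def mpoly_eval_def monom_eval_def[symmetric] monom_eval_scale
  by (auto simp: sum_distrib_left intro!: sum.cong)

lemma form_scaled_arg: "form d h \<Longrightarrow> h (c *s v) = c ^ d * h v"
  by (auto simp: form_def mpoly_eval_homogeneous)

text \<open>The bilinear pairing, without conjugation: it is complex linear in both arguments, so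
  linear forms along a holomorphic arc stay holomorphic.\<close>

definition fdot :: "complex ^ 'n::finite \<Rightarrow> complex ^ 'n \<Rightarrow> complex" where
  "fdot a v = (\<Sum>i\<in>UNIV. a $ i * v $ i)"

lemma fdot_simps [simp]:
  "fdot a (u + v) = fdot a u + fdot a v"
  "fdot a (u - v) = fdot a u - fdot a v"
  "fdot a (- v) = - fdot a v"
  "fdot a (c *s v) = c * fdot a v"
  "fdot (a + b) v = fdot a v + fdot b v"
  "fdot (a - b) v = fdot a v - fdot b v"
  "fdot (c *s a) v = c * fdot a v"
  "fdot a 0 = 0" "fdot 0 v = 0"
  by (simp_all add: fdot_def algebra_simps sum.distrib sum_subtractf sum_distrib_left sum_negf)

lemma form_fdot: "form 1 (fdot a)"
  unfolding fdot_def by (intro form_sum form_scale form_coord)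

lemma fdot_matrix: "fdot a (A *v v) = fdot (a v* A) v"
  unfolding fdot_def matrix_vector_mult_def vector_matrix_mult_def
  by (simp add: sum_distrib_left sum_distrib_right mult_ac) (rule sum.swap)

lemma subspace_fdot: "vec.subspace {v. fdot a v = 0}"
  by (auto simp: vec.subspace_def)

lemma fdot_zero_span: "(\<And>u. u \<in> S \<Longrightarrow> fdot a u = 0) \<Longrightarrow> v \<in> vec.span S \<Longrightarrow> fdot a v = 0"
  using vec.span_minimal[OF _ subspace_fdot[of a], of S] by auto

lemma separating_functional:
  assumes "vec.subspace U" "v \<notin> U"
  obtains a where "\<And>u. u \<in> U \<Longrightarrow> fdot a u = 0" "fdot a v = 1"
proof -
  obtain B where B: "B \<subseteq> U" "vec.independent B" "U = vec.span B"
    using vec.basis_exists[of U] assms(1) by (metis vec.span_subspace)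
  have ind: "vec.independent (insert v B)"
    using B assms(2) by (simp add: vec.independent_insert)
  \<comment> \<open>The extension of a linear map has values in \<open>complex ^ 'a\<close>. As all
    coordinates of \<open>w\<close> are 1, any single row of its matrix is the functional
    sought.\<close>
  define w :: "complex ^ 'a" where "w = (\<chi> i. 1)"
  obtain g where g: "Vector_Spaces.linear (*s) (*s) g" "\<forall>x\<in>insert v B. g x = (if x = v then w else 0)"
    using vec.linear_independent_extend[OF ind, of "\<lambda>x. if x = v then w else 0"] by blast
  let ?M = "matrix g"
  obtain i0 :: 'a where True by auto
  have M: "?M *v x = g x" for x
    by (rule matrix_works[OF g(1)])
  have fd: "fdot (?M $ i0) x = g x $ i0" for x
    by (simp add: fdot_def M[symmetric] matrix_vector_mult_def)
  show thesis
  proof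
    show "fdot (?M $ i0) v = 1" using g(2) by (simp add: fd w_def)
    fix u assume "u \<in> U"
    then have "u \<in> vec.span B" using B by simp
    then show "fdot (?M $ i0) u = 0"
      by (rule fdot_zero_span[rotated]) (use g(2) B assms(2) in \<open>auto simp: fd\<close>)
  qed
qed

section \<open>Calculus of forms\<close>

lemma has_derivative_vec_nth [derivative_intros]:
  assumes "(f has_derivative f') F"
  shows "((\<lambda>x. f x $ i) has_derivative (\<lambda>h. f' h $ i)) F"
  by (rule bounded_linear.has_derivative[OF bounded_linear_vec_nth assms])

definition grad :: "'n::finite mpoly \<Rightarrow> complex ^ 'n \<Rightarrow> complex ^ 'n" where
  "grad f v = (\<chi> i. mpoly_eval (mpoly_deriv i f) v)"

lemma monom_eval_deriv:
  "(monom_eval m has_derivative (\<lambda>h. \<Sum>i\<in>UNIV.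
     of_nat (Poly_Mapping.lookup m i) * monom_eval (m - Poly_Mapping.single i 1) v * h $ i)) (at v)"
proof -
  have "(monom_eval m has_derivative (\<lambda>h. \<Sum>i\<in>UNIV.
     (of_nat (Poly_Mapping.lookup m i) * (h $ i) * v $ i ^ (Poly_Mapping.lookup m i - 1)) *
     (\<Prod>j\<in>UNIV - {i}. v $ j ^ Poly_Mapping.lookup m j))) (at v)"
    unfolding monom_eval_def
    by (rule has_derivative_prod) (auto intro!: derivative_eq_intros)
  moreover have "v $ i ^ (Poly_Mapping.lookup m i - 1) *
     (\<Prod>j\<in>UNIV - {i}. v $ j ^ Poly_Mapping.lookup m j) = monom_eval (m - Poly_Mapping.single i 1) v"
    for i
    unfolding monom_eval_def
    by (subst prod.remove[of UNIV i])
      (auto simp: lookup_minus lookup_single when_def intro!: prod.cong)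
  ultimately show ?thesis
    by (simp add: mult_ac)
qed

lemma mpoly_has_derivative:
  "(mpoly_eval f has_derivative fdot (grad f v)) (at v)"
proof -
  have "(mpoly_eval f has_derivative (\<lambda>h. \<Sum>m\<in>Poly_Mapping.keys f. Poly_Mapping.lookup f m *
     (\<Sum>i\<in>UNIV. of_nat (Poly_Mapping.lookup m i) * monom_eval (m - Poly_Mapping.single i 1) v * h $ i)))
     (at v)"
    unfolding mpoly_eval_def monom_eval_def[symmetric]
    by (intro has_derivative_sum has_derivative_mult_right monom_eval_deriv)
  also have "(\<lambda>h. \<Sum>m\<in>Poly_Mapping.keys f. Poly_Mapping.lookup f m *
     (\<Sum>i\<in>UNIV. of_nat (Poly_Mapping.lookup m i) * monom_eval (m - Poly_Mapping.single i 1) v * h $ i))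
     = fdot (grad f v)"
  proof
    fix h
    show "(\<Sum>m\<in>Poly_Mapping.keys f. Poly_Mapping.lookup f m *
     (\<Sum>i\<in>UNIV. of_nat (Poly_Mapping.lookup m i) * monom_eval (m - Poly_Mapping.single i 1) v * h $ i))
     = fdot (grad f v) h"
      unfolding fdot_def grad_def mpoly_deriv_def
      by (simp add: mpoly_eval_sum mpoly_eval_single sum_distrib_left sum_distrib_right mult_ac
          sum.swap[of _ UNIV])
  qed
  finally show ?thesis .
qed

lemma continuous_mpoly_eval: "continuous_on S (mpoly_eval f)"
  unfolding mpoly_eval_def by (intro continuous_intros)

lemma continuous_grad: "continuous_on S (grad f)"
  unfolding grad_def by (intro continuous_on_vec_lambda continuous_mpoly_eval)

lemma continuous_fdot [continuous_intros]:
  "continuous_on S f \<Longrightarrow> continuous_on S (\<lambda>x. fdot a (f x))"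
  unfolding fdot_def by (intro continuous_intros)

lemma tendsto_fdot [tendsto_intros]:
  "(f \<longlongrightarrow> l) F \<Longrightarrow> ((\<lambda>x. fdot a (f x)) \<longlongrightarrow> fdot a l) F"
  unfolding fdot_def by (intro tendsto_intros)

lemma grad_homogeneous:
  assumes "homogeneous d f" "c \<noteq> 0"
  shows "fdot (grad f (c *s v)) w = c ^ d / c * fdot (grad f v) w"
proof -
  have bl: "bounded_linear (\<lambda>v :: complex ^ 'a. c *s v)"
    by (rule bounded_linear_intro[of _ "norm c"])
      (auto simp: vec_eq_iff algebra_simps norm_vec_def L2_set_def norm_mult power_mult_distrib
         sum_distrib_left[symmetric] real_sqrt_mult)
  have "((\<lambda>v. mpoly_eval f (c *s v)) has_derivative (\<lambda>h. fdot (grad f (c *s v)) (c *s h))) (at v)"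
    by (rule has_derivative_compose[OF bounded_linear_imp_has_derivative[OF bl] mpoly_has_derivative])
  moreover have "((\<lambda>v. c ^ d * mpoly_eval f v) has_derivative (\<lambda>h. c ^ d * fdot (grad f v) h)) (at v)"
    by (intro has_derivative_mult_right mpoly_has_derivative)
  ultimately have "(\<lambda>h. fdot (grad f (c *s v)) (c *s h)) = (\<lambda>h. c ^ d * fdot (grad f v) h)"
    unfolding mpoly_eval_homogeneous[OF assms(1)] by (rule has_derivative_unique)
  from fun_cong[OF this, of w] show ?thesis
    using assms(2) by (simp add: field_simps)
qed

section \<open>Cones over projective sets\<close>

text \<open>The origin is left out, so every member represents a point. The price is that a limit
  must be known to be nonzero before it is known to lie in the cone.\<close>

definition affine_cone :: "'n::finite proj set \<Rightarrow> (complex ^ 'n) set" where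
  "affine_cone C = {v. v \<noteq> 0 \<and> point_of v \<in> C}"

lemma line_of_point_of [simp]: "v \<noteq> 0 \<Longrightarrow> line_of (point_of v) = vec.span {v}"
  unfolding point_of_def by (subst Proj_inverse) (auto simp: vec.subspace_span)

lemma line_of_props: "vec.subspace (line_of p)" "vec.dim (line_of p) = 1"
  using line_of[of p] by auto

lemma in_line_of: "v \<in> line_of p \<Longrightarrow> v \<noteq> 0 \<Longrightarrow> p = point_of v"
proof -
  assume v: "v \<in> line_of p" "v \<noteq> 0"
  have "vec.span {v} = line_of p"
  proof (rule vec.subspace_dim_equal)
    show "vec.span {v} \<subseteq> line_of p"
      by (rule vec.span_minimal) (use v line_of_props in auto)
    show "vec.dim (line_of p) \<le> vec.dim (vec.span {v})"
      using v(2) line_of_props(2)[of p] by simp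
  qed (use line_of_props in auto)
  then show ?thesis
    by (metis line_of_inverse point_of_def)
qed

lemma point_cases: obtains v where "v \<noteq> 0" "p = point_of v"
proof -
  have "\<not> line_of p \<subseteq> {0}"
    using line_of_props(2)[of p] by (metis vec.dim_eq_0 zero_neq_one)
  then show thesis using in_line_of that by blast
qed

lemma span_singleton_iff: "w \<in> vec.span {v} \<longleftrightarrow> (\<exists>c. w = c *s (v :: complex ^ 'n))"
  by (auto simp: vec.span_singleton)

lemma point_of_eq_iff:
  assumes "v \<noteq> 0" "w \<noteq> 0"
  shows "point_of w = point_of v \<longleftrightarrow> w \<in> vec.span {v}"
proof
  assume "point_of w = point_of v"
  then have "vec.span {w} = vec.span {v}"
    using assms line_of_point_of[of w] line_of_point_of[of v] by simp
  then show "w \<in> vec.span {v}" using vec.span_base[of w "{w}"] by simp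
next
  assume "w \<in> vec.span {v}"
  then show "point_of w = point_of v"
    using in_line_of[of w "point_of v"] assms by simp
qed

lemma point_of_scale [simp]: "c \<noteq> 0 \<Longrightarrow> v \<noteq> 0 \<Longrightarrow> point_of (c *s v) = point_of v"
  by (subst point_of_eq_iff) (auto simp: span_singleton_iff)

lemma cone_scale: "v \<in> affine_cone C \<Longrightarrow> c \<noteq> 0 \<Longrightarrow> c *s v \<in> affine_cone C"
  by (auto simp: affine_cone_def)

lemma vanishes_at_point_of:
  assumes "homogeneous d f" "v \<noteq> 0"
  shows "vanishes_at f (point_of v) \<longleftrightarrow> mpoly_eval f v = 0"
proof -
  have "mpoly_eval f v = 0 \<Longrightarrow> mpoly_eval f (c *s v) = 0" for c
    by (simp add: mpoly_eval_homogeneous[OF assms(1)])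
  then show ?thesis
    using assms(2) by (auto simp: vanishes_at_def vec.span_singleton)
      (metis rangeI vector_smult_lid)
qed

lemma vanishing_forms_cone:
  "vanishing_forms C = {f. (\<exists>d. homogeneous d f) \<and> (\<forall>v\<in>affine_cone C. mpoly_eval f v = 0)}"
proof -
  have "(\<forall>p\<in>C. vanishes_at f p) \<longleftrightarrow> (\<forall>v\<in>affine_cone C. mpoly_eval f v = 0)" if "homogeneous d f" for f d
  proof
    assume "\<forall>p\<in>C. vanishes_at f p"
    then show "\<forall>v\<in>affine_cone C. mpoly_eval f v = 0"
      using vanishes_at_point_of[OF that] by (auto simp: affine_cone_def)
  next
    assume *: "\<forall>v\<in>affine_cone C. mpoly_eval f v = 0"
    show "\<forall>p\<in>C. vanishes_at f p"
    proof
      fix p assume "p \<in> C"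
      then obtain v where "v \<noteq> 0" "p = point_of v" "v \<in> affine_cone C"
        by (metis (mono_tags) affine_cone_def mem_Collect_eq point_cases)
      then show "vanishes_at f p"
        using * vanishes_at_point_of[OF that] by blast
    qed
  qed
  then show ?thesis unfolding vanishing_forms_def by auto
qed

lemma zariski_closedE:
  assumes "zariski_closed X"
  obtains F where "\<And>f. f \<in> F \<Longrightarrow> \<exists>d. homogeneous d f"
    "\<And>v. v \<noteq> 0 \<Longrightarrow> v \<in> affine_cone X \<longleftrightarrow> (\<forall>f\<in>F. mpoly_eval f v = 0)"
proof -
  obtain F where F: "\<forall>f\<in>F. \<exists>d. homogeneous d f" "X = {p. \<forall>f\<in>F. vanishes_at f p}"
    using assms by (auto simp: zariski_closed_def)
  show thesis
  proof
    fix v :: "complex ^ 'a" assume v: "v \<noteq> 0"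
    then show "v \<in> affine_cone X \<longleftrightarrow> (\<forall>f\<in>F. mpoly_eval f v = 0)"
      using F vanishes_at_point_of[OF _ v] unfolding affine_cone_def by blast
  qed (use F in auto)
qed

lemma cone_iff_vanishing:
  assumes "zariski_closed X" "v \<noteq> 0"
  shows "v \<in> affine_cone X \<longleftrightarrow> (\<forall>f\<in>vanishing_forms X. mpoly_eval f v = 0)"
proof -
  obtain F where F: "\<And>f. f \<in> F \<Longrightarrow> \<exists>d. homogeneous d f"
    "\<And>v. v \<noteq> 0 \<Longrightarrow> v \<in> affine_cone X \<longleftrightarrow> (\<forall>f\<in>F. mpoly_eval f v = 0)"
    using zariski_closedE[OF assms(1)] by blast
  have "F \<subseteq> vanishing_forms X"
    using F by (auto simp: vanishing_forms_cone affine_cone_def)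
  moreover have "v \<in> affine_cone X \<Longrightarrow> \<forall>f\<in>vanishing_forms X. mpoly_eval f v = 0"
    by (auto simp: vanishing_forms_cone)
  ultimately show ?thesis
    using F(2)[OF assms(2)] by blast
qed

lemma cone_closed:
  assumes "zariski_closed X" "\<And>n. u n \<in> affine_cone X" "u \<longlonglongrightarrow> v" "v \<noteq> 0"
  shows "v \<in> affine_cone X"
  unfolding cone_iff_vanishing[OF assms(1,4)]
proof
  fix f assume f: "f \<in> vanishing_forms X"
  have "(\<lambda>n. mpoly_eval f (u n)) \<longlonglongrightarrow> mpoly_eval f v"
    using continuous_on_tendsto_compose[OF continuous_mpoly_eval assms(3), of UNIV f] by simp
  moreover have "mpoly_eval f (u n) = 0" for n
    using f assms(2) by (auto simp: vanishing_forms_cone)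
  ultimately show "mpoly_eval f v = 0"
    by (simp add: LIMSEQ_const_iff)
qed

text \<open>Gradients of forms at proportional vectors are proportional, so one representative of
  the point suffices.\<close>

lemma tangent_space_eq:
  assumes "v \<noteq> 0"
  shows "tangent_space X (point_of v) = {w. \<forall>f\<in>vanishing_forms X. fdot (grad f v) w = 0}"
proof -
  have "fdot (grad f u) w = 0"
    if fuw: "fdot (grad f v) w = 0" "f \<in> vanishing_forms X" "u \<in> vec.span {v}" "u \<noteq> 0" for f u w
  proof -
    obtain c where c: "u = c *s v" using fuw(3) by (auto simp: span_singleton_iff)
    obtain d where d: "homogeneous d f" using fuw(2) by (auto simp: vanishing_forms_def)
    have "c \<noteq> 0" using c fuw(4) by auto
    then show ?thesis using grad_homogeneous[OF d, of c v w] fuw(1) c by simp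
  qed
  moreover have "v \<in> vec.span {v}" by (simp add: vec.span_base)
  ultimately show ?thesis
    using assms unfolding tangent_space_def fdot_def[of "grad _ _"] grad_def
    by (auto simp: grad_def fdot_def)
qed

lemma tangent_space_subspace: "vec.subspace (tangent_space X p)"
proof (cases p rule: point_cases)
  fix v assume "v \<noteq> 0" "p = point_of v"
  then show ?thesis by (auto simp: tangent_space_eq vec.subspace_def)
qed

text \<open>The form vanishes along the whole real line \<open>v + t *\<^sub>R v\<close>, so its
  derivative in the direction \<open>v\<close> is zero. Hence a point lies on its own tangent
  space.\<close>

lemma euler: "f \<in> vanishing_forms X \<Longrightarrow> v \<in> affine_cone X \<Longrightarrow> fdot (grad f v) v = 0"
proof -
  assume f: "f \<in> vanishing_forms X" and v: "v \<in> affine_cone X"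
  then obtain d where d: "homogeneous d f" by (auto simp: vanishing_forms_def)
  have "mpoly_eval f v = 0" using f v by (auto simp: vanishing_forms_cone)
  then have 0: "mpoly_eval f (v + t *\<^sub>R v) = 0" for t :: real
    using mpoly_eval_homogeneous[OF d, of "of_real (1 + t)" v]
    by (simp add: vector_scalar_mult_def scaleR_vec_def scaleR_conv_of_real algebra_simps
        plus_vec_def)
  have "((\<lambda>t. mpoly_eval f (v + t *\<^sub>R v)) has_derivative (\<lambda>t. fdot (grad f (v + 0 *\<^sub>R v)) (t *\<^sub>R v)))
     (at (0::real))"
    by (rule has_derivative_compose[of "\<lambda>t. v + t *\<^sub>R v" _ _ _ "mpoly_eval f"])
      (auto intro!: derivative_eq_intros mpoly_has_derivative)
  then have "((\<lambda>t::real. 0::complex) has_derivative (\<lambda>t. fdot (grad f v) (t *\<^sub>R v))) (at (0::real))"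
    by (simp add: 0)
  then have "(\<lambda>t. fdot (grad f v) (t *\<^sub>R v)) = (\<lambda>t::real. 0)"
    by (rule has_derivative_unique) simp
  from fun_cong[OF this, of 1] show ?thesis by simp
qed

text \<open>Greedy choice: each functional added to \<open>G'\<close> lowers the dimension of the
  common kernel by at least one, so their number is at most the codimension.\<close>

lemma finite_annihilator:
  fixes G :: "(complex ^ 'n::finite) set"
  obtains G' where "G' \<subseteq> G" "finite G'" "{u. \<forall>g\<in>G'. fdot g u = 0} = {u. \<forall>g\<in>G. fdot g u = 0}"
    "card G' + vec.dim {u. \<forall>g\<in>G. fdot g u = 0} \<le> CARD('n)"
proof -
  let ?A = "\<lambda>G. {u. \<forall>g\<in>G. fdot g u = 0}"
  have sub: "vec.subspace (?A H)" for H
    by (auto simp: vec.subspace_def)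
  have "\<exists>G'\<subseteq>G. finite G' \<and> ?A G' = ?A G \<and> card G' + vec.dim (?A G) \<le> CARD('n)"
    if "G0 \<subseteq> G" "finite G0" "card G0 + vec.dim (?A G0) \<le> CARD('n)" for G0
    using that
  proof (induction "vec.dim (?A G0)" arbitrary: G0 rule: less_induct)
    case less
    show ?case
    proof (cases "?A G0 = ?A G")
      case True
      then show ?thesis using less.prems by auto
    next
      case False
      then obtain g u where g: "g \<in> G" "u \<in> ?A G0" "fdot g u \<noteq> 0"
        using less.prems(1) by auto
      let ?G = "insert g G0"
      have "?A ?G \<subset> ?A G0" using g by auto
      then have lt: "vec.dim (?A ?G) < vec.dim (?A G0)"
        using vec.dim_psubset[of "?A ?G" "?A G0"]
        unfolding vec.span_eq_iff[THEN iffD2, OF sub] by blast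
      have "card ?G \<le> card G0 + 1" by (simp add: card_insert_le_m1 card_insert_if less.prems)
      then show ?thesis
        using less.hyps[OF lt] less.prems g lt by auto
    qed
  qed
  from this[of "{}"] show thesis
    using that by (auto simp: vec_dim_card card_cart_basis)
qed

lemma dim_pair:
  fixes v w :: "complex ^ 'n::finite"
  assumes "v \<noteq> 0" "w \<notin> vec.span {v}" shows "vec.dim {v, w} = 2"
  using vec.dim_insert[of w "{v}"] assms by (simp add: insert_commute)

lemma two_basis:
  fixes v :: "complex ^ 'n::finite"
  assumes "vec.subspace T" "vec.dim T = 2" "v \<in> T" "v \<noteq> 0"
  obtains w where "w \<in> T" "w \<notin> vec.span {v}" "T = vec.span {v, w}"
proof -
  have "\<not> T \<subseteq> vec.span {v}"
    using vec.dim_subset[of T "vec.span {v}"] assms by auto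
  then obtain w where w: "w \<in> T" "w \<notin> vec.span {v}" by auto
  have "vec.dim (vec.span {v, w}) = 2"
    using dim_pair[of v w] w assms by simp
  then have "vec.span {v, w} = T"
    by (intro vec.subspace_dim_equal vec.span_minimal) (use assms w in auto)
  then show thesis using that w by auto
qed

lemma dim_plane_unique:
  fixes v w :: "complex ^ 'n::finite"
  assumes "vec.subspace T" "vec.dim T = 2" "v \<in> T" "w \<in> T" "v \<noteq> 0" "w \<notin> vec.span {v}"
  shows "T = vec.span {v, w}"
proof -
  have "vec.dim (vec.span {v, w}) = 2"
    using dim_pair[of v w] assms by simp
  then have "vec.span {v, w} = T"
    by (intro vec.subspace_dim_equal vec.span_minimal) (use assms in auto)
  then show ?thesis by simp
qed

section \<open>Local parametrizations\<close>

definition hol_curve :: "(complex \<Rightarrow> complex ^ 'n::finite) \<Rightarrow> complex set \<Rightarrow> bool" where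
  "hol_curve g S \<longleftrightarrow> (\<forall>i. (\<lambda>t. g t $ i) holomorphic_on S)"

definition vderiv :: "(complex \<Rightarrow> complex ^ 'n::finite) \<Rightarrow> complex \<Rightarrow> complex ^ 'n" where
  "vderiv g t = (\<chi> i. deriv (\<lambda>t. g t $ i) t)"

text \<open>
  The functional \<open>l\<close> normalizes the homogeneous coordinates and \<open>m\<close> is the local parameter;
  the open set \<open>V\<close> says that the chart covers a neighbourhood of its points in the cone.
\<close>
definition chart :: "'n::finite proj set \<Rightarrow> (complex \<Rightarrow> complex ^ 'n) \<Rightarrow> real \<Rightarrow> bool" where
  "chart C g r \<longleftrightarrow> r > 0 \<and> hol_curve g (ball 0 r) \<and> g ` ball 0 r \<subseteq> affine_cone C \<and>
     (\<exists>l m. (\<forall>t\<in>ball 0 r. fdot l (g t) = 1 \<and> fdot m (g t) = t) \<and>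
       (\<exists>V. open V \<and> g ` ball 0 r \<subseteq> V \<and> (\<forall>v\<in>V \<inter> affine_cone C. \<exists>t\<in>ball 0 r. \<exists>c. v = c *s g t)))"

lemma fdot_holomorphic: "hol_curve g S \<Longrightarrow> (\<lambda>t. fdot a (g t)) holomorphic_on S"
  unfolding fdot_def hol_curve_def by (intro holomorphic_intros) auto

lemma fdot_deriv:
  assumes "hol_curve g S" "open S" "t \<in> S"
  shows "deriv (\<lambda>t. fdot a (g t)) t = fdot a (vderiv g t)"
    "((\<lambda>t. fdot a (g t)) has_field_derivative fdot a (vderiv g t)) (at t)"
proof -
  have "((\<lambda>t. g t $ i) has_field_derivative vderiv g t $ i) (at t)" for i
    unfolding vderiv_def using assms
    by (auto simp: hol_curve_def intro!: holomorphic_derivI)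
  then show "((\<lambda>t. fdot a (g t)) has_field_derivative fdot a (vderiv g t)) (at t)"
    unfolding fdot_def by (auto intro!: derivative_eq_intros simp: mult.commute)
  then show "deriv (\<lambda>t. fdot a (g t)) t = fdot a (vderiv g t)"
    by (rule DERIV_imp_deriv)
qed

lemma vderiv_hol_curve: "hol_curve g S \<Longrightarrow> open S \<Longrightarrow> hol_curve (vderiv g) S"
  by (auto simp: hol_curve_def vderiv_def intro!: holomorphic_deriv)

lemma mpoly_holomorphic: "hol_curve g S \<Longrightarrow> (\<lambda>t. mpoly_eval f (g t)) holomorphic_on S"
  unfolding mpoly_eval_def hol_curve_def by (intro holomorphic_intros) auto

lemma form_holomorphic: "form d h \<Longrightarrow> hol_curve g S \<Longrightarrow> (\<lambda>t. h (g t)) holomorphic_on S"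
  by (auto simp: form_def mpoly_holomorphic)

lemma has_derivative_vecI:
  fixes f :: "'a::real_normed_vector \<Rightarrow> complex ^ 'n::finite"
  assumes "\<And>i. ((\<lambda>x. f x $ i) has_derivative (\<lambda>h. f' h $ i)) (at x)"
  shows "(f has_derivative f') (at x)"
  by (intro has_derivative_componentwise_within[THEN iffD2])
    (use assms in \<open>auto simp: Basis_vec_def inner_axis intro!: has_derivative_inner_left\<close>)

lemma hol_curve_has_derivative:
  assumes "hol_curve g S" "open S" "t \<in> S"
  shows "(g has_derivative (\<lambda>h. h *s vderiv g t)) (at t)"
proof -
  have "((\<lambda>t. g t $ i) has_derivative (\<lambda>h. h * vderiv g t $ i)) (at t)" for i
    using holomorphic_derivI[of "\<lambda>t. g t $ i" S t UNIV] assms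
    by (simp add: hol_curve_def vderiv_def has_field_derivative_def mult_commute_abs)
  then show ?thesis by (intro has_derivative_vecI) simp
qed

lemma hol_curve_continuous: "hol_curve g S \<Longrightarrow> open S \<Longrightarrow> continuous_on S g"
  by (meson hol_curve_has_derivative has_derivative_continuous continuous_at_imp_continuous_on)

lemma mpoly_curve_deriv:
  assumes "hol_curve g S" "open S" "t \<in> S"
  shows "((\<lambda>t. mpoly_eval f (g t)) has_field_derivative fdot (grad f (g t)) (vderiv g t)) (at t)"
  using has_derivative_compose[OF hol_curve_has_derivative[OF assms] mpoly_has_derivative]
  by (simp add: has_field_derivative_def mult_commute_abs)

lemma span_pair: "u \<in> vec.span {v, w} \<longleftrightarrow> (\<exists>a b. u = a *s v + b *s (w :: complex ^ 'n))"
proof -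
  have "u - a *s v = b *s w \<longleftrightarrow> u = a *s v + b *s w" for a b
    by (metis add_diff_cancel_left' diff_add_cancel add.commute)
  then show ?thesis by (simp add: vec.span_insert span_singleton_iff)
qed

lemma isolated_zeros_ex:
  assumes "f holomorphic_on S" "open S" "connected S" "\<xi> \<in> S" "f \<xi> = 0" "\<beta> \<in> S" "f \<beta> \<noteq> 0"
  shows "\<exists>r>0. ball \<xi> r \<subseteq> S \<and> (\<forall>z\<in>ball \<xi> r - {\<xi>}. f z \<noteq> 0)"
proof (rule isolated_zeros[OF assms])
  fix r assume "0 < r" "ball \<xi> r \<subseteq> S" and *: "\<And>z. z \<in> ball \<xi> r - {\<xi>} \<Longrightarrow> f z \<noteq> 0"
  then show ?thesis by (intro exI[of _ r] conjI ballI) (auto intro: *)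
qed

lemma bounded_linear_fdot: "bounded_linear (fdot a)"
proof -
  have "bounded_linear (\<lambda>v. fdot a v)"
    unfolding fdot_def
    by (intro bounded_linear_sum bounded_linear_compose[OF bounded_linear_mult_right bounded_linear_vec_nth])
  then show ?thesis by simp
qed

text \<open>
  By the inverse function theorem, \<open>CARD('n) - 2\<close> forms of the ideal with independent gradients cut out
  an analytic arc that contains the curve near the point. Either all forms of the ideal vanish on the arc,
  or one of them has an isolated zero on it and the point is isolated. That the second case
  cannot occur would need commutative algebra; instead, isolated points are discarded below.
\<close>
lemma local_dichotomy:
  fixes C :: "'n::finite proj set"
  assumes zc: "zariski_closed C" and v0: "v0 \<in> affine_cone C"
    and dimT: "vec.dim (tangent_space C (point_of v0)) = 2"
  shows "(\<exists>g r. chart C g r \<and> g 0 = v0) \<or>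
    (\<exists>V. open V \<and> v0 \<in> V \<and> V \<inter> affine_cone C \<subseteq> vec.span {v0})"
proof -
  let ?I = "vanishing_forms C"
  define T where "T = tangent_space C (point_of v0)"
  have v0n: "v0 \<noteq> 0" using v0 by (auto simp: affine_cone_def)
  have T: "T = {w. \<forall>f\<in>?I. fdot (grad f v0) w = 0}"
    unfolding T_def using tangent_space_eq[OF v0n] .
  have subT: "vec.subspace T" and dimT: "vec.dim T = 2"
    using tangent_space_subspace dimT by (auto simp: T_def)
  have v0T: "v0 \<in> T" using euler[OF _ v0] by (auto simp: T)
  obtain w where w: "w \<in> T" "w \<notin> vec.span {v0}" "T = vec.span {v0, w}"
    using two_basis[OF subT dimT v0T v0n] by blast
  have v0w: "v0 \<notin> vec.span {w}"
  proof
    assume "v0 \<in> vec.span {w}"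
    then obtain c where c: "v0 = c *s w" by (auto simp: span_singleton_iff)
    with v0n have "w = (1 / c) *s v0" by (cases "c = 0") auto
    then show False using w(2) by (auto simp: span_singleton_iff)
  qed
  obtain l where l: "fdot l w = 0" "fdot l v0 = 1"
    using separating_functional[OF vec.subspace_span v0w] by (metis insertI1 vec.span_base)
  obtain m where m: "fdot m v0 = 0" "fdot m w = 1"
    using separating_functional[OF vec.subspace_span w(2)] by (metis insertI1 vec.span_base)
  let ?G = "(\<lambda>f. grad f v0) ` ?I"
  have annG: "{u. \<forall>g\<in>?G. fdot g u = 0} = T" by (auto simp: T)
  obtain G' where G': "G' \<subseteq> ?G" "finite G'" "{u. \<forall>g\<in>G'. fdot g u = 0} = T"
    "card G' + 2 \<le> CARD('n)"
    by (rule finite_annihilator[of ?G, unfolded annG dimT])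
  \<comment> \<open>Two coordinates of the target are reserved for \<open>l\<close> and
    \<open>m\<close>; the other \<open>CARD('n) - 2\<close> have room for the equations in
    \<open>G'\<close>.\<close>
  obtain S :: "'n set" where "card S = 2"
    using obtain_subset_with_card_n[of 2 "UNIV :: 'n set"] G'(4) by auto
  then obtain i0 i1 :: 'n where i01: "i0 \<noteq> i1" by (auto simp: card_2_iff)
  have "card G' \<le> card (UNIV - {i0, i1})"
    using G'(4) i01 by (simp add: card_Diff_subset)
  then obtain e where e: "e ` G' \<subseteq> UNIV - {i0, i1}" "inj_on e G'"
    using card_le_inj[OF G'(2), of "UNIV - {i0, i1}"] by auto
  have "\<forall>g\<in>G'. \<exists>f\<in>?I. grad f v0 = g" using G'(1) by auto
  then obtain ff where ff: "\<And>g. g \<in> G' \<Longrightarrow> ff g \<in> ?I \<and> grad (ff g) v0 = g" by metis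
  \<comment> \<open>Coordinates to which \<open>e\<close> assigns no equation receive the zero form,
    which belongs to the ideal as well.\<close>
  define F where "F k = (if k \<in> e ` G' then ff (inv_into G' e k) else 0)" for k
  have "0 \<in> ?I" by (auto simp: vanishing_forms_cone homogeneous_def)
  then have FI: "F k \<in> ?I" for k
    using ff by (auto simp: F_def e(2) inv_into_f_f)
  have Fker: "u \<in> T" if "\<And>k. k \<noteq> i0 \<Longrightarrow> k \<noteq> i1 \<Longrightarrow> fdot (grad (F k) v0) u = 0" for u
  proof -
    have "fdot g u = 0" if g: "g \<in> G'" for g
    proof -
      have "e g \<noteq> i0" "e g \<noteq> i1" using e(1) g by auto
      moreover have "F (e g) = ff g" using g e(2) by (simp add: F_def)
      ultimately show ?thesis using \<open>\<And>k. k \<noteq> i0 \<Longrightarrow> k \<noteq> i1 \<Longrightarrow> fdot (grad (F k) v0) u = 0\<close>[of "e g"] ff[OF g] by simp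
    qed
    then show ?thesis using G'(3) by blast
  qed
  define Phi where "Phi v = (\<chi> k. if k = i0 then fdot l v else if k = i1 then fdot m v
    else mpoly_eval (F k) v)" for v
  define J :: "complex ^ 'n \<Rightarrow> complex ^ 'n ^ 'n" where
    "J v = (\<chi> k. if k = i0 then l else if k = i1 then m else grad (F k) v)" for v
  have J: "(J v *v h) $ k = fdot (J v $ k) h" for v h k
    by (simp add: matrix_vector_mult_def fdot_def)
  have derPhi: "(Phi has_derivative (*v) (J v)) (at v)" for v
  proof (rule has_derivative_vecI)
    fix k
    have fd: "(fdot a has_derivative fdot a) (at v)" for a
      by (rule bounded_linear_imp_has_derivative[OF bounded_linear_fdot])
    show "((\<lambda>x. Phi x $ k) has_derivative (\<lambda>h. (J v *v h) $ k)) (at v)"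
      unfolding J by (auto simp: Phi_def J_def intro: fd mpoly_has_derivative)
  qed
  define f' where "f' v = Blinfun ((*v) (J v))" for v
  have f': "blinfun_apply (f' v) = (*v) (J v)" for v
    unfolding f'_def by (rule bounded_linear_Blinfun_apply) simp
  have contf': "continuous_on UNIV f'"
  proof (rule continuous_on_blinfun_componentwise)
    fix i :: "complex ^ 'n"
    have comp: "continuous_on UNIV (\<lambda>x. J x $ k $ j)" for k j
      using continuous_grad[of UNIV "F k"]
      by (cases "k = i0"; cases "k = i1") (auto simp: J_def intro!: continuous_intros)
    show "continuous_on UNIV (\<lambda>x. blinfun_apply (f' x) i)"
      unfolding f' matrix_vector_mult_def
      by (intro continuous_on_vec_lambda continuous_on_sum continuous_on_mult comp continuous_on_const)
  qed
  \<comment> \<open>The equations confine \<open>u\<close> to the tangent plane \<open>T\<close>,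
    and on \<open>T\<close> the functionals \<open>l\<close> and \<open>m\<close> are the
    coordinates with respect to the basis \<open>v0\<close>, \<open>w\<close>.\<close>
  have inj: "u = 0" if "J v0 *v u = 0" for u
  proof -
    have c: "fdot (J v0 $ k) u = 0" for k using that J[of v0 u k] by simp
    have "u \<in> T"
    proof (rule Fker)
      fix k assume "k \<noteq> i0" "k \<noteq> i1"
      then show "fdot (grad (F k) v0) u = 0" using c[of k] by (simp add: J_def)
    qed
    then obtain a b where u: "u = a *s v0 + b *s w"
      unfolding w(3) span_pair by blast
    have "fdot l u = 0" "fdot m u = 0"
      using c[of i0] c[of i1] i01 by (auto simp: J_def)
    then show "u = 0" using u l m by simp
  qed
  then obtain B where B: "B ** J v0 = mat 1"
    using matrix_left_invertible_ker by blast
  have invf: "Blinfun ((*v) B) o\<^sub>L f' v0 = id_blinfun"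
    by (rule blinfun_eqI) (simp add: f' bounded_linear_Blinfun_apply matrix_vector_mul_assoc B)
  obtain U' V g gd where g: "open U'" "v0 \<in> U'" "open V" "Phi v0 \<in> V" "homeomorphism U' V Phi g"
    "\<And>y. y \<in> V \<Longrightarrow> (g has_derivative (gd y)) (at y)"
    "\<And>y. y \<in> V \<Longrightarrow> gd y = inv (blinfun_apply (f' (g y)))"
    "\<And>y. y \<in> V \<Longrightarrow> bij (blinfun_apply (f' (g y)))"
    using inverse_function_theorem[OF open_UNIV _ contf' UNIV_I invf, of Phi] derPhi
    unfolding f' by (metis (no_types, lifting))
  \<comment> \<open>The arc will be the preimage under \<open>Phi\<close> of this affine line:
    \<open>l\<close> equal to 1, \<open>m\<close> equal to \<open>t\<close>, all chosen equations
    zero.\<close>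
  define Y where "Y t = axis i0 1 + t *s axis i1 (1::complex)" for t
  have Yk: "Y t $ k = (if k = i0 then 1 else if k = i1 then t else 0)" for t k
    using i01 by (auto simp: Y_def axis_def)
  have Y0: "Phi v0 = Y 0"
    using FI v0 l m by (auto simp: vec_eq_iff Yk Phi_def vanishing_forms_cone)
  have Yder: "(Y has_derivative (\<lambda>h. h *s axis i1 1)) (at t)" for t
  proof (rule has_derivative_vecI)
    fix i
    show "((\<lambda>t. Y t $ i) has_derivative (\<lambda>h. (h *s axis i1 1) $ i)) (at t)"
      by (cases "i = i0"; cases "i = i1") (use i01 in \<open>auto simp: Yk axis_def\<close>)
  qed
  have "continuous_on UNIV Y"
    using Yder by (meson has_derivative_continuous continuous_at_imp_continuous_on)
  then have "open (Y -` V)" using g(3) by (metis open_vimage continuous_on_open_vimage open_UNIV inf_top.right_neutral)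
  moreover have "0 \<in> Y -` V" using g(4) Y0 by simp
  ultimately obtain r1 where r1: "r1 > 0" "ball (0::complex) r1 \<subseteq> Y -` V"
    by (meson open_contains_ball)
  define \<gamma> where "\<gamma> t = g (Y t)" for t
  have YV: "Y t \<in> V" if "t \<in> ball 0 r1" for t using r1 that by auto
  have gU: "\<gamma> t \<in> U'" and gY: "Phi (\<gamma> t) = Y t" if "t \<in> ball 0 r1" for t
    using g(5) YV[OF that] by (auto simp: \<gamma>_def homeomorphism_def)
  have \<gamma>k: "fdot l (\<gamma> t) = 1" "fdot m (\<gamma> t) = t" if "t \<in> ball 0 r1" for t
  proof -
    have "Phi (\<gamma> t) $ k = Y t $ k" for k using gY[OF that] by simp
    from this[of i0] this[of i1] i01 show "fdot l (\<gamma> t) = 1" "fdot m (\<gamma> t) = t"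
      by (auto simp: Yk Phi_def)
  qed
  have \<gamma>0: "\<gamma> 0 = v0"
    using g(2,5) Y0 by (auto simp: \<gamma>_def homeomorphism_def)
  have hol: "hol_curve \<gamma> (ball 0 r1)"
    unfolding hol_curve_def
  proof
    fix i
    show "(\<lambda>t. \<gamma> t $ i) holomorphic_on ball 0 r1"
    proof (rule holomorphic_onI)
      fix t :: complex assume t: "t \<in> ball 0 r1"
      let ?D = "gd (Y t)"
      have bij: "bij ((*v) (J (\<gamma> t)))" and D: "?D = inv ((*v) (J (\<gamma> t)))"
        using g(7,8)[OF YV[OF t]] by (auto simp: f' \<gamma>_def)
      \<comment> \<open>The inverse function theorem is a real one. The derivative of the inverse is
        complex linear because it inverts the complex linear map given by
        \<open>J (\<gamma> t)\<close>, and this makes the arc holomorphic.\<close>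
      have Dlin: "?D (h *s y) = h *s ?D y" for h y
      proof -
        have "J (\<gamma> t) *v (h *s ?D y) = h *s (J (\<gamma> t) *v ?D y)"
          by (simp add: vec.scale)
        also have "\<dots> = h *s y" using bij by (simp add: D bij_is_surj surj_f_inv_f)
        finally show ?thesis using bij by (metis D bij_inv_eq_iff)
      qed
      have "(\<gamma> has_derivative (\<lambda>h. ?D (h *s axis i1 1))) (at t)"
        unfolding \<gamma>_def by (rule has_derivative_compose[OF Yder g(6)[OF YV[OF t]]])
      then have "((\<lambda>t. \<gamma> t $ i) has_derivative (\<lambda>h. ?D (h *s axis i1 1) $ i)) (at t)"
        by (rule has_derivative_vec_nth)
      then have "((\<lambda>t. \<gamma> t $ i) has_field_derivative (?D (axis i1 1) $ i)) (at t)"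
        by (simp add: Dlin has_field_derivative_def mult_commute_abs)
      then show "(\<lambda>t. \<gamma> t $ i) field_differentiable at t within ball 0 r1"
        by (meson field_differentiable_at_within field_differentiable_def)
    qed
  qed
  define N where "N v = (1 / fdot l v) *s v" for v
  \<comment> \<open>A conical neighbourhood: membership is tested on the multiple \<open>N v\<close>
    on which \<open>l\<close> is 1, so that the cone and not only the slice is covered.\<close>
  define W where "W r = {v. fdot l v \<noteq> 0 \<and> N v \<in> U' \<and> fdot m (N v) \<in> ball 0 r}" for r
  have openW: "open (W r)" for r
  proof -
    have o: "open {v. fdot l v \<noteq> 0}"
      by (intro open_Collect_neq continuous_intros)
    have cN: "continuous_on {v. fdot l v \<noteq> 0} N"
      unfolding N_def vector_scalar_mult_def by (intro continuous_intros) auto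
    have "open ({v. fdot l v \<noteq> 0} \<inter> N -` (U' \<inter> {v. fdot m v \<in> ball 0 r}))"
      by (intro continuous_open_preimage[OF cN o] open_Int g(1))
        (auto simp: intro!: open_Collect_less continuous_intros)
    also have "\<dots> = W r" by (auto simp: W_def)
    finally show ?thesis .
  qed
  have N\<gamma>: "N (\<gamma> t) = \<gamma> t" if "t \<in> ball 0 r1" for t
    using \<gamma>k(1)[OF that] by (simp add: N_def)
  have \<gamma>W: "\<gamma> t \<in> W r" if "t \<in> ball 0 r" "r \<le> r1" for t r
    using that \<gamma>k[of t] gU[of t] N\<gamma>[of t] by (auto simp: W_def)
  have W: "\<exists>t\<in>ball 0 r. \<exists>c. v = c *s \<gamma> t \<and> \<gamma> t \<in> affine_cone C"
    if "v \<in> W r" "v \<in> affine_cone C" "r \<le> r1" for v r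
  proof -
    have lv: "fdot l v \<noteq> 0" "N v \<in> U'" "fdot m (N v) \<in> ball 0 r" using that by (auto simp: W_def)
    have Nc: "N v \<in> affine_cone C" using that lv by (auto simp: N_def intro!: cone_scale)
    have "fdot l (N v) = 1" using lv by (simp add: N_def)
    then have "Phi (N v) = Y (fdot m (N v))"
      using FI Nc by (auto simp: vec_eq_iff Yk Phi_def vanishing_forms_cone)
    then have "N v = \<gamma> (fdot m (N v))"
      using g(5) lv(2) by (metis \<gamma>_def homeomorphism_apply1)
    moreover have "v = fdot l v *s N v" using lv by (simp add: N_def)
    ultimately show ?thesis using lv(3) Nc by metis
  qed
  show ?thesis
  proof (cases "\<forall>f\<in>?I. \<forall>t\<in>ball 0 r1. mpoly_eval f (\<gamma> t) = 0")
    case True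
    have "\<gamma> t \<in> affine_cone C" if "t \<in> ball 0 r1" for t
    proof -
      have "\<gamma> t \<noteq> 0" using \<gamma>k(1)[OF that] by auto
      then show ?thesis using cone_iff_vanishing[OF zc] True that by auto
    qed
    then have "chart C \<gamma> r1"
      unfolding chart_def using r1(1) hol \<gamma>k openW[of r1] \<gamma>W[of _ r1] W[of _ r1]
      by (intro conjI exI[of _ l] exI[of _ m] exI[of _ "W r1"]) (auto 4 4)
    then show ?thesis using \<gamma>0 by blast
  next
    case False
    then obtain f t1 where f: "f \<in> ?I" "t1 \<in> ball 0 r1" "mpoly_eval f (\<gamma> t1) \<noteq> 0" by blast
    have z0: "(0::complex) \<in> ball 0 r1" using r1(1) by simp
    have z1: "mpoly_eval f (\<gamma> 0) = 0"
      using f(1) v0 unfolding \<gamma>0 vanishing_forms_cone by blast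
    obtain r where r: "0 < r" "ball (0::complex) r \<subseteq> ball 0 r1"
      "\<And>z. z \<in> ball 0 r - {0} \<Longrightarrow> mpoly_eval f (\<gamma> z) \<noteq> 0"
      by (metis isolated_zeros_ex[OF mpoly_holomorphic[OF hol, of f] open_ball connected_ball z0 z1 f(2,3)])
    have rr: "r \<le> r1" using r(1,2) by (simp add: ball_subset_ball_iff)
    have "W r \<inter> affine_cone C \<subseteq> vec.span {v0}"
    proof
      fix v assume v: "v \<in> W r \<inter> affine_cone C"
      then obtain t c where t: "t \<in> ball 0 r" "v = c *s \<gamma> t" "\<gamma> t \<in> affine_cone C"
        using W[of v r] rr by blast
      then have "mpoly_eval f (\<gamma> t) = 0" using f(1) by (auto simp: vanishing_forms_cone)
      then have "t = 0" using r(3)[of t] t(1) by blast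
      then show "v \<in> vec.span {v0}" using t(2) \<gamma>0 by (auto simp: span_singleton_iff)
    qed
    moreover have "v0 \<in> W r" using \<gamma>W[of 0 r] \<gamma>0 r(1) rr by simp
    ultimately show ?thesis using openW by blast
  qed
qed

lemma holomorphic_prod_zero:
  fixes f g :: "complex \<Rightarrow> complex"
  assumes "f holomorphic_on S" "g holomorphic_on S" "open S" "connected S"
    and z: "\<And>t. t \<in> S \<Longrightarrow> f t * g t = 0"
  shows "(\<forall>t\<in>S. f t = 0) \<or> (\<forall>t\<in>S. g t = 0)"
proof (rule disjCI)
  assume "\<not> (\<forall>t\<in>S. g t = 0)"
  then obtain b where b: "b \<in> S" "g b \<noteq> 0" by blast
  let ?U = "S \<inter> g -` (- {0})"
  have "open ?U"
    using assms by (intro continuous_open_preimage holomorphic_on_imp_continuous_on) auto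
  then have U: "open ?U" .
  have "?U \<noteq> {}" using b by auto
  moreover have "f t = 0" if "t \<in> ?U" for t using z[of t] that by auto
  ultimately have "f t = 0" if "t \<in> S" for t
    using that U assms
    by (intro analytic_continuation_open[of ?U S f "\<lambda>_. 0" t]) auto
  then show "\<forall>t\<in>S. f t = 0" by simp
qed

lemma chartD:
  assumes "chart C g r"
  shows "r > 0" "hol_curve g (ball 0 r)" "\<And>t. t \<in> ball 0 r \<Longrightarrow> g t \<in> affine_cone C"
    "\<And>t. t \<in> ball 0 r \<Longrightarrow> g t \<noteq> 0"
proof -
  show *: "r > 0" "hol_curve g (ball 0 r)" "\<And>t. t \<in> ball 0 r \<Longrightarrow> g t \<in> affine_cone C"
    using assms unfolding chart_def by blast+
  show "\<And>t. t \<in> ball 0 r \<Longrightarrow> g t \<noteq> 0" using *(3) by (auto simp: affine_cone_def)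
qed

lemma chart_raw:
  assumes "chart C g r"
  obtains l m V where "\<And>t. t \<in> ball 0 r \<Longrightarrow> fdot l (g t) = 1" "\<And>t. t \<in> ball 0 r \<Longrightarrow> fdot m (g t) = t"
    "open V" "g ` ball 0 r \<subseteq> V" "\<And>v. v \<in> V \<Longrightarrow> v \<in> affine_cone C \<Longrightarrow> \<exists>t\<in>ball 0 r. \<exists>c. v = c *s g t"
proof -
  obtain l m V where "\<forall>t\<in>ball 0 r. fdot l (g t) = 1 \<and> fdot m (g t) = t"
    "open V" "g ` ball 0 r \<subseteq> V" "\<forall>v\<in>V \<inter> affine_cone C. \<exists>t\<in>ball 0 r. \<exists>c. v = c *s g t"
    using assms unfolding chart_def by blast
  then show thesis by (intro that[of l m V]) auto
qed

lemma chart_zero_in: "chart C g r \<Longrightarrow> (0::complex) \<in> ball 0 r"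
  using chartD(1) by auto

text \<open>Forms of the ideal vanish along the arc, so its velocity is tangent. Differentiating the
  normalizations gives \<open>l\<close> the value 0 and \<open>m\<close> the value 1 on the
  velocity, so it is no multiple of \<open>g t\<close>, on which \<open>l\<close> is 1.\<close>

lemma chart_tangent:
  assumes "chart C g r" "t \<in> ball 0 r"
  shows "vderiv g t \<in> tangent_space C (point_of (g t))" "g t \<in> tangent_space C (point_of (g t))"
    "vderiv g t \<notin> vec.span {g t}"
proof -
  note c = chartD[OF assms(1)]
  have gt: "g t \<noteq> 0" "g t \<in> affine_cone C" using c assms(2) by auto
  show "g t \<in> tangent_space C (point_of (g t))"
    using tangent_space_eq[OF gt(1)] euler[OF _ gt(2)] by auto
  have "fdot (grad f (g t)) (vderiv g t) = 0" if f: "f \<in> vanishing_forms C" for f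
  proof -
    have "((\<lambda>t. mpoly_eval f (g t)) has_field_derivative fdot (grad f (g t)) (vderiv g t)) (at t)"
      by (rule mpoly_curve_deriv[OF c(2) open_ball assms(2)])
    moreover have "((\<lambda>t. mpoly_eval f (g t)) has_field_derivative 0) (at t)"
    proof (rule has_field_derivative_transform_within_open[OF DERIV_const open_ball assms(2)])
      fix s :: complex assume "s \<in> ball 0 r"
      then show "0 = mpoly_eval f (g s)" using f c(3) by (auto simp: vanishing_forms_cone)
    qed
    ultimately show ?thesis by (rule DERIV_unique)
  qed
  then show "vderiv g t \<in> tangent_space C (point_of (g t))"
    using tangent_space_eq[OF gt(1)] by auto
  obtain l m where lm: "\<And>t. t \<in> ball 0 r \<Longrightarrow> fdot l (g t) = 1" "\<And>t. t \<in> ball 0 r \<Longrightarrow> fdot m (g t) = t"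
    using chart_raw[OF assms(1)] by metis
  have "((\<lambda>t. fdot l (g t)) has_field_derivative 0) (at t)"
    by (rule has_field_derivative_transform_within_open[OF DERIV_const open_ball assms(2)])
      (use lm in auto)
  then have 1: "fdot l (vderiv g t) = 0"
    using DERIV_unique fdot_deriv(2)[OF c(2) open_ball assms(2)] by blast
  have "((\<lambda>t. fdot m (g t)) has_field_derivative 1) (at t)"
    by (rule has_field_derivative_transform_within_open[OF DERIV_ident open_ball assms(2)])
      (use lm in auto)
  then have 2: "fdot m (vderiv g t) = 1"
    using DERIV_unique fdot_deriv(2)[OF c(2) open_ball assms(2)] by blast
  show "vderiv g t \<notin> vec.span {g t}"
    using 1 2 lm[OF assms(2)] by (auto simp: span_singleton_iff)
qed

lemma chart_inj:
  assumes "chart C g r" "s \<in> ball 0 r" "t \<in> ball 0 r" "g s = c *s g t"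
  shows "s = t"
proof -
  obtain l m where lm: "\<And>t. t \<in> ball 0 r \<Longrightarrow> fdot l (g t) = 1" "\<And>t. t \<in> ball 0 r \<Longrightarrow> fdot m (g t) = t"
    using chart_raw[OF assms(1)] by metis
  have "fdot l (g s) = c * fdot l (g t)" "fdot m (g s) = c * fdot m (g t)"
    using assms(4) by simp_all
  then show ?thesis using lm assms(2,3) by simp
qed

lemma chart_scale:
  assumes "chart C g r" "c \<noteq> 0" shows "chart C (\<lambda>t. c *s g t) r"
proof (rule chart_raw[OF assms(1)])
  fix l m V assume lm: "\<And>t. t \<in> ball 0 r \<Longrightarrow> fdot l (g t) = 1" "\<And>t. t \<in> ball 0 r \<Longrightarrow> fdot m (g t) = t"
    and V: "open V" "g ` ball 0 r \<subseteq> V" "\<And>v. v \<in> V \<Longrightarrow> v \<in> affine_cone C \<Longrightarrow> \<exists>t\<in>ball 0 r. \<exists>c. v = c *s g t"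
  let ?V = "(\<lambda>v. (1 / c) *s v) -` V"
  have "continuous_on UNIV (\<lambda>v :: complex ^ 'a. (1 / c) *s v)"
    unfolding vector_scalar_mult_def by (intro continuous_intros)
  then have "open ?V" using V(1) open_vimage by blast
  moreover have "(\<lambda>t. c *s g t) ` ball 0 r \<subseteq> ?V" using V(2) assms(2) by auto
  moreover have "\<exists>t\<in>ball 0 r. \<exists>d. v = d *s (c *s g t)" if v: "v \<in> ?V" "v \<in> affine_cone C" for v
  proof -
    have "(1 / c) *s v \<in> affine_cone C" using v assms(2) by (intro cone_scale) auto
    then obtain t d where td: "t \<in> ball 0 r" "(1 / c) *s v = d *s g t" using V(3) v by blast
    have "v = c *s ((1 / c) *s v)" using assms(2) by simp
    also have "\<dots> = d *s (c *s g t)" unfolding td(2) by (simp add: mult.commute)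
    finally show ?thesis using td(1) by blast
  qed
  moreover have "hol_curve (\<lambda>t. c *s g t) (ball 0 r)"
    using chartD(2)[OF assms(1)] by (auto simp: hol_curve_def intro!: holomorphic_intros)
  ultimately show ?thesis
    unfolding chart_def using chartD[OF assms(1)] lm assms(2)
    by (intro conjI exI[of _ "(1 / c) *s l"] exI[of _ "(1 / c) *s m"] exI[of _ ?V])
      (auto intro!: cone_scale)
qed

text \<open>The normalizations force the parameter to be the quotient of \<open>m\<close> and
  \<open>l\<close>. Being explicit, it depends continuously on \<open>v\<close>, which later gives
  convergence of parameters.\<close>

lemma chart_cover:
  assumes "chart C g r"
  obtains l m V where "\<And>t. t \<in> ball 0 r \<Longrightarrow> fdot l (g t) = 1" "\<And>t. t \<in> ball 0 r \<Longrightarrow> fdot m (g t) = t"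
    "open V" "g ` ball 0 r \<subseteq> V"
    "\<And>v. v \<in> V \<Longrightarrow> v \<in> affine_cone C \<Longrightarrow>
       fdot m v / fdot l v \<in> ball 0 r \<and> v = fdot l v *s g (fdot m v / fdot l v)"
proof (rule chart_raw[OF assms(1)])
  fix l m V assume lm: "\<And>t. t \<in> ball 0 r \<Longrightarrow> fdot l (g t) = 1" "\<And>t. t \<in> ball 0 r \<Longrightarrow> fdot m (g t) = t"
    and V: "open V" "g ` ball 0 r \<subseteq> V" "\<And>v. v \<in> V \<Longrightarrow> v \<in> affine_cone C \<Longrightarrow> \<exists>t\<in>ball 0 r. \<exists>c. v = c *s g t"
  show thesis
  proof (rule that[OF lm V(1,2)])
    fix v assume v: "v \<in> V" "v \<in> affine_cone C"
    obtain t c where tc: "t \<in> ball 0 r" "v = c *s g t" using V(3) v by blast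
    have "c \<noteq> 0" using v(2) tc(2) by (auto simp: affine_cone_def)
    then show "fdot m v / fdot l v \<in> ball 0 r \<and> v = fdot l v *s g (fdot m v / fdot l v)"
      using tc lm[OF tc(1)] by simp
  qed
qed

lemma chart_shift:
  assumes "chart C g r" "t0 \<in> ball 0 r"
  shows "\<exists>s. chart C (\<lambda>t. g (t0 + t)) s \<and> (\<forall>t\<in>ball 0 s. t0 + t \<in> ball 0 r)"
proof -
  note c = chartD[OF assms(1)]
  obtain l m V where lm: "\<And>t. t \<in> ball 0 r \<Longrightarrow> fdot l (g t) = 1" "\<And>t. t \<in> ball 0 r \<Longrightarrow> fdot m (g t) = t"
    and V: "open V" "g ` ball 0 r \<subseteq> V"
    "\<And>v. v \<in> V \<Longrightarrow> v \<in> affine_cone C \<Longrightarrow>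
       fdot m v / fdot l v \<in> ball 0 r \<and> v = fdot l v *s g (fdot m v / fdot l v)"
    using chart_cover[OF assms(1)] by blast
  define s where "s = r - norm t0"
  have s: "s > 0" using assms(2) by (simp add: s_def)
  have st: "t0 + t \<in> ball 0 r" if "t \<in> ball 0 s" for t
    using norm_triangle_ineq[of t0 t] that by (auto simp: s_def)
  let ?O = "V \<inter> {v. fdot l v \<noteq> 0}"
  let ?V = "?O \<inter> (\<lambda>v. fdot m v / fdot l v - t0) -` ball 0 s"
  have "open ?O" by (intro open_Int V open_Collect_neq continuous_intros)
  then have "open ?V"
    by (intro continuous_open_preimage continuous_intros) auto
  moreover have "g (t0 + t) \<in> ?V" if "t \<in> ball 0 s" for t
    using V(2) st[OF that] lm[OF st[OF that]] that by auto
  moreover have "\<exists>t\<in>ball 0 s. \<exists>c. v = c *s g (t0 + t)" if v: "v \<in> ?V" "v \<in> affine_cone C" for v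
    using V(3)[of v] v by (intro bexI[of _ "fdot m v / fdot l v - t0"]) auto
  moreover have "hol_curve (\<lambda>t. g (t0 + t)) (ball 0 s)"
    unfolding hol_curve_def
  proof
    fix i
    have "((\<lambda>t. g t $ i) \<circ> (\<lambda>t. t0 + t)) holomorphic_on ball 0 s"
      by (rule holomorphic_on_compose_gen[where t = "ball 0 r"])
        (use c(2) in \<open>auto simp: hol_curve_def simp del: mem_ball image_add_ball intro!: holomorphic_intros st\<close>)
    then show "(\<lambda>t. g (t0 + t) $ i) holomorphic_on ball 0 s" by (simp add: o_def)
  qed
  \<comment> \<open>Since \<open>l\<close> is 1 on the arc, \<open>m - t0 *s l\<close> takes the
    value \<open>t\<close> at \<open>g (t0 + t)\<close>, as a chart centred at \<open>t0\<close>
    requires.\<close>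
  ultimately have "chart C (\<lambda>t. g (t0 + t)) s"
    unfolding chart_def using s lm st c(3)
    by (intro conjI exI[of _ l] exI[of _ "m - t0 *s l"] exI[of _ ?V]) (auto simp: algebra_simps)
  then show ?thesis using st by blast
qed

section \<open>Irreducible closed sets\<close>

lemma zariski_closedI:
  "\<forall>f\<in>F. \<exists>d. homogeneous d f \<Longrightarrow> X = {p. \<forall>f\<in>F. vanishes_at f p} \<Longrightarrow> zariski_closed X"
  unfolding zariski_closed_def by (intro exI[of _ F] conjI)

lemma zariski_closed_Un:
  fixes A B :: "'n::finite proj set"
  assumes "zariski_closed A" "zariski_closed B" shows "zariski_closed (A \<union> B)"
proof -
  obtain F where F: "\<And>f. f \<in> F \<Longrightarrow> \<exists>d. homogeneous d f"
    "\<And>v. v \<noteq> 0 \<Longrightarrow> v \<in> affine_cone A \<longleftrightarrow> (\<forall>f\<in>F. mpoly_eval f v = 0)"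
    using zariski_closedE[OF assms(1)] by blast
  obtain G where G: "\<And>f. f \<in> G \<Longrightarrow> \<exists>d. homogeneous d f"
    "\<And>v. v \<noteq> 0 \<Longrightarrow> v \<in> affine_cone B \<longleftrightarrow> (\<forall>f\<in>G. mpoly_eval f v = 0)"
    using zariski_closedE[OF assms(2)] by blast
  let ?H = "{h. (\<exists>d. homogeneous d h) \<and> (\<exists>f\<in>F. \<exists>g\<in>G. mpoly_eval h = (\<lambda>v. mpoly_eval f v * mpoly_eval g v))}"
  have ex: "\<exists>h\<in>?H. mpoly_eval h = (\<lambda>v. mpoly_eval f v * mpoly_eval g v)" if fg: "f \<in> F" "g \<in> G" for f g
  proof -
    obtain d e where "homogeneous d f" "homogeneous e g" using F G fg by blast
    then have "form d (mpoly_eval f)" "form e (mpoly_eval g)" by (auto simp: form_def)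
    from form_mult[OF this] obtain h where "homogeneous (d + e) h"
      "mpoly_eval h = (\<lambda>v. mpoly_eval f v * mpoly_eval g v)" unfolding form_def by metis
    then show ?thesis using fg by blast
  qed
  have "A \<union> B = {p. \<forall>f\<in>?H. vanishes_at f p}"
  proof (rule set_eqI)
    fix p :: "'n proj"
    obtain v where v: "v \<noteq> 0" "p = point_of v" using point_cases by blast
    have "p \<in> A \<union> B \<longleftrightarrow> v \<in> affine_cone A \<or> v \<in> affine_cone B" using v by (auto simp: affine_cone_def)
    also have "\<dots> \<longleftrightarrow> (\<forall>f\<in>F. \<forall>g\<in>G. mpoly_eval f v * mpoly_eval g v = 0)"
      using F(2)[OF v(1)] G(2)[OF v(1)] by auto
    also have "\<dots> \<longleftrightarrow> (\<forall>h\<in>?H. mpoly_eval h v = 0)"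
      using ex by (auto simp: fun_eq_iff) (metis mult_eq_0_iff)
    also have "\<dots> \<longleftrightarrow> p \<in> {p. \<forall>f\<in>?H. vanishes_at f p}"
      using vanishes_at_point_of[OF _ v(1)] unfolding v(2) by blast
    finally show "p \<in> A \<union> B \<longleftrightarrow> p \<in> {p. \<forall>f\<in>?H. vanishes_at f p}" .
  qed
  moreover have "\<forall>f\<in>?H. \<exists>d. homogeneous d f" by simp
  ultimately show ?thesis by (intro zariski_closedI)
qed

lemma zariski_closed_empty: "zariski_closed ({} :: 'n::finite proj set)"
proof -
  obtain f :: "'n mpoly" where f: "homogeneous 0 f" "(\<lambda>v. 1) = mpoly_eval f"
    using form_const[of 1] by (auto simp: form_def)
  have "\<not> vanishes_at f p" for p :: "'n proj"
    using f by (cases p rule: point_cases) (auto simp: vanishes_at_point_of fun_eq_iff)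
  then have "{} = {p. \<forall>f\<in>{f}. vanishes_at f p}" by auto
  then show ?thesis using f(1) by (intro zariski_closedI[of "{f}"]) auto
qed

lemma zariski_closed_singleton: "zariski_closed {p}"
proof (cases p rule: point_cases)
  fix v assume v: "v \<noteq> 0" "p = point_of v"
  let ?F = "{f. homogeneous 1 f \<and> mpoly_eval f v = 0}"
  have "q = p" if q: "\<forall>f\<in>?F. vanishes_at f q" for q
  proof (cases q rule: point_cases)
    fix w assume w: "w \<noteq> 0" "q = point_of w"
    have "w \<in> vec.span {v}"
    proof (rule ccontr)
      assume "w \<notin> vec.span {v}"
      then obtain a where a: "fdot a v = 0" "fdot a w = 1"
        using separating_functional[OF vec.subspace_span] by (metis insertI1 vec.span_base)
      obtain f where f: "homogeneous 1 f" "fdot a = mpoly_eval f"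
        using form_fdot[of a] by (auto simp: form_def)
      then have "vanishes_at f q" using q a by auto
      then show False using vanishes_at_point_of[OF f(1) w(1)] w(2) a(2) f(2) by simp
    qed
    then show "q = p" using v w point_of_eq_iff by blast
  qed
  moreover have "\<forall>f\<in>?F. vanishes_at f p" using v vanishes_at_point_of by blast
  ultimately have "{p} = {p. \<forall>f\<in>?F. vanishes_at f p}" by blast
  then show ?thesis by (intro zariski_closedI[of ?F]) auto
qed

lemma zariski_closed_finite: "finite A \<Longrightarrow> zariski_closed A"
proof (induction A rule: finite_induct)
  case empty then show ?case by (rule zariski_closed_empty)
next
  case (insert x F)
  then show ?case using zariski_closed_Un[OF zariski_closed_singleton, of F x] by simp
qed

lemma irreducible_closed_singleton: "irreducible_closed {p}"
  unfolding irreducible_closed_def using zariski_closed_singleton by blast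

lemma krull_dim_geI:
  assumes "\<And>i. i \<le> d \<Longrightarrow> irreducible_closed (Z i) \<and> Z i \<subseteq> X" "\<And>i. i < d \<Longrightarrow> Z i \<subset> Z (Suc i)"
  shows "enat d \<le> krull_dim X"
  unfolding krull_dim_def by (rule Sup_upper) (use assms in blast)

text \<open>Splitting off one point shows that such a set is a singleton. Consequently a curve is
  infinite, which yields the accumulation point from which the first arc is built.\<close>

lemma krull_dim_finite_irreducible:
  assumes "irreducible_closed X" "finite X" shows "krull_dim X = 0"
proof -
  obtain p where p: "p \<in> X" using assms(1) by (auto simp: irreducible_closed_def)
  have "X = {p} \<union> (X - {p})" using p by blast
  then have "X = {p}"
    using assms zariski_closed_singleton[of p] zariski_closed_finite[of "X - {p}"] p
    unfolding irreducible_closed_def by (metis DiffD2 finite_Diff insertI1)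
  have "krull_dim X \<le> 0"
    unfolding krull_dim_def
  proof (rule Sup_least)
    fix x assume "x \<in> {enat d |d. \<exists>Z. (\<forall>i\<le>d. irreducible_closed (Z i) \<and> Z i \<subseteq> X) \<and> (\<forall>i<d. Z i \<subset> Z (Suc i))}"
    then obtain d Z where Z: "x = enat d" "\<forall>i\<le>d. irreducible_closed (Z i) \<and> Z i \<subseteq> X" "\<forall>i<d. Z i \<subset> Z (Suc i)"
      by blast
    have "d = 0"
    proof (rule ccontr)
      assume "d \<noteq> 0"
      then have "Z 0 \<subset> Z 1" "Z 1 \<subseteq> {p}" "Z 0 \<noteq> {}"
        using Z \<open>X = {p}\<close> by (auto simp: irreducible_closed_def)
      then show False by blast
    qed
    then show "x \<le> 0" using Z(1) by (simp add: zero_enat_def)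
  qed
  then show ?thesis by simp
qed

lemma affine_cone_subsetD:
  assumes "affine_cone X \<subseteq> affine_cone Y" shows "X \<subseteq> Y"
proof
  fix p assume p: "p \<in> X"
  obtain v where "v \<noteq> 0" "p = point_of v" using point_cases by blast
  then show "p \<in> Y" using p assms by (auto simp: affine_cone_def)
qed

text \<open>
  The Zariski closure of an arc is irreducible, because the product of two nonzero holomorphic functions
  is nonzero. Having more than one point, it is the whole curve.
\<close>
lemma chart_dense:
  assumes C: "zariski_closed C" "krull_dim C \<le> 1" and g: "chart C g r" and irr: "irreducible_closed C"
    and h: "form d h" "\<And>t. t \<in> ball 0 r \<Longrightarrow> h (g t) = 0" and v: "v \<in> affine_cone C"
  shows "h v = 0"
proof -
  note c = chartD[OF g]
  \<comment> \<open>\<open>P\<close> collects the forms that vanish on the arc, and its zero set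
    \<open>Z\<close> is the Zariski closure of the arc.\<close>
  define P where "P = {f. (\<exists>d. homogeneous d f) \<and> (\<forall>t\<in>ball 0 r. mpoly_eval f (g t) = 0)}"
  define Z where "Z = {p. \<forall>f\<in>P. vanishes_at f p}"
  have Z: "v \<in> affine_cone Z \<longleftrightarrow> (\<forall>f\<in>P. mpoly_eval f v = 0)" if "v \<noteq> 0" for v
    using that vanishes_at_point_of[OF _ that] by (auto simp: affine_cone_def Z_def P_def)
  have zZ: "zariski_closed Z" unfolding Z_def by (rule zariski_closedI[of P]) (auto simp: P_def)
  have gZ: "g t \<in> affine_cone Z" if "t \<in> ball 0 r" for t
    using Z[of "g t"] c(4) that by (auto simp: P_def)
  have "vanishing_forms C \<subseteq> P"
    using c(3) by (auto simp: vanishing_forms_cone P_def)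
  moreover have "v \<noteq> 0" if "v \<in> affine_cone Z" for v using that by (simp add: affine_cone_def)
  ultimately have "affine_cone Z \<subseteq> affine_cone C"
    using Z cone_iff_vanishing[OF C(1)] by (meson subset_iff)
  then have ZC: "Z \<subseteq> C" by (rule affine_cone_subsetD)
  have ZA: "Z \<subseteq> A" if A: "zariski_closed A" "\<And>f. f \<in> vanishing_forms A \<Longrightarrow> f \<in> P" for A
  proof
    fix p assume p: "p \<in> Z"
    obtain v where v: "v \<noteq> 0" "p = point_of v" using point_cases by blast
    then have "v \<in> affine_cone Z" using p by (simp add: affine_cone_def)
    then have "v \<in> affine_cone A" using Z[OF v(1)] cone_iff_vanishing[OF A(1) v(1)] A(2) by blast
    then show "p \<in> A" using v by (simp add: affine_cone_def)
  qed
  have irrZ: "irreducible_closed Z"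
    unfolding irreducible_closed_def
  proof (intro conjI allI impI)
    show "zariski_closed Z" by (rule zZ)
    show "Z \<noteq> {}" using gZ[OF chart_zero_in[OF g]] by (auto simp: affine_cone_def)
    fix A B assume A: "zariski_closed A" and B: "zariski_closed B" and ZAB: "Z = A \<union> B"
    show "Z = A \<or> Z = B"
    proof (rule ccontr)
      assume "\<not> (Z = A \<or> Z = B)"
      then have "\<not> Z \<subseteq> A" "\<not> Z \<subseteq> B" using ZAB by auto
      then obtain f1 f2 where f: "f1 \<in> vanishing_forms A" "f1 \<notin> P" "f2 \<in> vanishing_forms B" "f2 \<notin> P"
        using ZA A B by meson
      have "mpoly_eval f1 (g t) * mpoly_eval f2 (g t) = 0" if "t \<in> ball 0 r" for t
        using gZ[OF that] f(1,3) by (auto simp: ZAB affine_cone_def vanishing_forms_cone)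
      then have "(\<forall>t\<in>ball 0 r. mpoly_eval f1 (g t) = 0) \<or> (\<forall>t\<in>ball 0 r. mpoly_eval f2 (g t) = 0)"
        by (intro holomorphic_prod_zero mpoly_holomorphic c(2)) auto
      then show False using f by (auto simp: P_def vanishing_forms_def)
    qed
  qed
  have "Z = C"
  proof (rule ccontr)
    assume "Z \<noteq> C"
    let ?p = "point_of (g 0)" and ?t = "complex_of_real (r / 2)"
    have t: "?t \<in> ball 0 r" "?t \<noteq> 0" using c(1) by auto
    have "?p \<in> Z" "point_of (g ?t) \<in> Z" using gZ[OF t(1)] gZ[OF chart_zero_in[OF g]] by (auto simp: affine_cone_def)
    moreover have "point_of (g ?t) \<noteq> ?p"
    proof
      assume "point_of (g ?t) = ?p"
      then obtain k where "g ?t = k *s g 0"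
        using point_of_eq_iff[of "g 0" "g ?t"] c(4) t(1) chart_zero_in[OF g] by (auto simp: span_singleton_iff)
      then show False using chart_inj[OF g t(1) chart_zero_in[OF g]] t(2) by blast
    qed
    ultimately have "{?p} \<subset> Z" by blast
    \<comment> \<open>If \<open>Z\<close> were smaller than \<open>C\<close>, then a point,
      \<open>Z\<close> and \<open>C\<close> would form a chain of irreducible closed sets of length
      2.\<close>
    then have "enat 2 \<le> krull_dim C"
      by (intro krull_dim_geI[of 2 "\<lambda>i. if i = 0 then {?p} else if i = 1 then Z else C"])
        (use irrZ irr ZC \<open>Z \<noteq> C\<close> irreducible_closed_singleton in \<open>auto simp: numeral_2_eq_2 less_Suc_eq\<close>)
    then have "enat 2 \<le> enat 1" using C(2) order_trans[of "enat 2" "krull_dim C" 1] by (simp add: one_enat_def)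
    then show False by simp
  qed
  obtain f where f: "homogeneous d f" "h = mpoly_eval f" using h(1) by (auto simp: form_def)
  then have "f \<in> P" using h(2) by (auto simp: P_def)
  then show ?thesis using v Z[of v] unfolding \<open>Z = C\<close> f by (auto simp: affine_cone_def)
qed

section \<open>Smooth nondegenerate curves\<close>

text \<open>What remains after the isolated points are set aside. Analytic arguments run over these
  vectors only, and \<open>dense\<close> carries their conclusions to the whole cone.\<close>

definition smooth_cone :: "'n::finite proj set \<Rightarrow> (complex ^ 'n) set" where
  "smooth_cone C = {v. \<exists>g r. chart C g r \<and> g 0 = v}"

lemma smooth_cone_scale: "v \<in> smooth_cone C \<Longrightarrow> c \<noteq> 0 \<Longrightarrow> c *s v \<in> smooth_cone C"
  unfolding smooth_cone_def using chart_scale by blast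

lemma smooth_cone_subset: "smooth_cone C \<subseteq> affine_cone C"
  unfolding smooth_cone_def using chartD(3) chart_zero_in by blast

lemma smooth_cone_chart: "chart C g r \<Longrightarrow> t \<in> ball 0 r \<Longrightarrow> g t \<in> smooth_cone C"
  unfolding smooth_cone_def using chart_shift[of C g r t] by force

locale smooth_curve =
  fixes C :: "'n::finite proj set"
  assumes curve: "curve C" and nondeg: "nondegenerate C" and smooth: "nonsingular C"
begin

lemma irr: "irreducible_closed C" and closed: "zariski_closed C" and krull: "krull_dim C = 1"
  using curve by (auto simp: curve_def irreducible_closed_def)

lemma dim_tangent: "v \<in> affine_cone C \<Longrightarrow> vec.dim (tangent_space C (point_of v)) = 2"
  using smooth krull by (auto simp: nonsingular_def affine_cone_def one_enat_def)

lemma linear_vanish: assumes "\<And>v. v \<in> affine_cone C \<Longrightarrow> fdot a v = 0" shows "a = 0"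
proof (rule ccontr)
  assume a: "a \<noteq> 0"
  let ?H = "{p. \<forall>v\<in>line_of p. (\<Sum>i\<in>UNIV. a $ i * v $ i) = 0}"
  have "C \<subseteq> ?H"
  proof
    fix p assume "p \<in> C"
    then have "fdot a v = 0" if "v \<in> line_of p" for v
      using in_line_of[OF that] assms[of v] by (cases "v = 0") (auto simp: affine_cone_def)
    then show "p \<in> ?H" by (simp add: fdot_def)
  qed
  then show False using nondeg a unfolding nondegenerate_def hyperplane_def by blast
qed

lemma dense:
  assumes "chart C g r" "form d h" "\<And>t. t \<in> ball 0 r \<Longrightarrow> h (g t) = 0" "v \<in> affine_cone C"
  shows "h v = 0"
  using chart_dense[OF closed _ assms(1) irr assms(2,3,4)] krull by simp

lemma linear_vanish_chart:
  assumes "chart C g r" "\<And>t. t \<in> ball 0 r \<Longrightarrow> fdot a (g t) = 0" shows "a = 0"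
  by (rule linear_vanish) (rule dense[OF assms(1) form_fdot assms(2)])

text \<open>The limit has a chart unless it is isolated. In the isolated case some
  \<open>u n\<close> is a multiple of the limit, and its chart can be rescaled.\<close>

lemma smooth_cone_closed:
  assumes "\<And>n. u n \<in> smooth_cone C" "u \<longlonglongrightarrow> v" "v \<noteq> 0"
  shows "v \<in> smooth_cone C"
proof -
  have v: "v \<in> affine_cone C"
    by (rule cone_closed[OF closed _ assms(2,3)]) (use assms(1) smooth_cone_subset in auto)
  consider g r where "chart C g r" "g 0 = v" | V where "open V" "v \<in> V" "V \<inter> affine_cone C \<subseteq> vec.span {v}"
    using local_dichotomy[OF closed v dim_tangent[OF v]] by blast
  then show ?thesis
  proof cases
    case 2
    then obtain n where "u n \<in> V"
      using topological_tendstoD[OF assms(2) 2(1,2)] by (auto simp: eventually_sequentially)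
    moreover have un: "u n \<in> affine_cone C" using assms(1) smooth_cone_subset by auto
    ultimately have "u n \<in> vec.span {v}" using 2(3) by blast
    then obtain c where c: "u n = c *s v" by (auto simp: span_singleton_iff)
    then have "c \<noteq> 0" using un by (auto simp: affine_cone_def)
    then show ?thesis using smooth_cone_scale[OF assms(1)[of n], of "1 / c"] c by simp
  qed (auto simp: smooth_cone_def)
qed

lemma unit_scale: fixes v :: "complex ^ 'n" assumes "v \<noteq> 0"
  shows "norm (complex_of_real (1 / norm v) *s v) = 1"
proof -
  have "complex_of_real (1 / norm v) *s v = (1 / norm v) *\<^sub>R v"
    unfolding vec_eq_iff vector_smult_component vector_scaleR_component scaleR_conv_of_real[where 'a = complex]
    by simp
  then show ?thesis using assms by simp
qed

lemma infinite_curve: "infinite C"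
  using krull_dim_finite_irreducible[OF irr] krull by auto

text \<open>One unit vector is chosen for each of the infinitely many points of \<open>C\<close>.
  These accumulate at some \<open>x\<close>, which cannot be isolated: every neighbourhood of
  \<open>x\<close> contains representatives of two different points.\<close>

lemma smooth_cone_nonempty: "smooth_cone C \<noteq> {}"
proof -
  have "\<exists>v. v \<in> affine_cone C \<and> norm v = 1 \<and> point_of v = p" if "p \<in> C" for p
  proof (cases p rule: point_cases)
    fix v assume v: "v \<noteq> 0" "p = point_of v"
    then show ?thesis using that unit_scale[OF v(1)]
      by (intro exI[of _ "complex_of_real (1 / norm v) *s v"]) (auto simp: affine_cone_def)
  qed
  then obtain u where u: "\<And>p. p \<in> C \<Longrightarrow> u p \<in> affine_cone C \<and> norm (u p) = 1 \<and> point_of (u p) = p"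
    by metis
  have "inj_on u C" using u by (metis inj_onI)
  then have "infinite (u ` C)" using infinite_curve finite_imageD by blast
  moreover have "u ` C \<subseteq> sphere 0 1" using u by auto
  ultimately obtain x where x: "x \<in> sphere 0 1" "x islimpt (u ` C)"
    using Heine_Borel_imp_Bolzano_Weierstrass[OF compact_sphere] by blast
  then obtain w where w: "\<And>n. w n \<in> u ` C - {x}" "w \<longlonglongrightarrow> x"
    unfolding islimpt_sequential by blast
  have xn: "x \<noteq> 0" using x(1) by auto
  have xC: "x \<in> affine_cone C"
  proof (rule cone_closed[OF closed _ w(2) xn])
    fix n show "w n \<in> affine_cone C" using w(1)[of n] u by auto
  qed
  consider g r where "chart C g r" "g 0 = x" | V where "open V" "x \<in> V" "V \<inter> affine_cone C \<subseteq> vec.span {x}"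
    using local_dichotomy[OF closed xC dim_tangent[OF xC]] by blast
  then show ?thesis
  proof cases
    case 1 then show ?thesis by (auto simp: smooth_cone_def)
  next
    case 2
    have same: "p = point_of x" if "p \<in> C" "u p \<in> V" for p
      using u[OF that(1)] that(2) 2(3) point_of_eq_iff[OF xn, of "u p"] by (auto simp: affine_cone_def)
    obtain y where y: "y \<in> u ` C" "y \<in> V" "y \<noteq> x"
      using x(2) 2(1,2) unfolding islimpt_def by blast
    obtain z where z: "z \<in> u ` C" "z \<in> V \<inter> - {y}" "z \<noteq> x"
      using x(2) 2(1,2) y(3) unfolding islimpt_def by (metis ComplI IntI open_Compl closed_singleton open_Int singletonD)
    show ?thesis using same y z by auto
  qed
qed

end

section \<open>Wronskians\<close>

text \<open>The source of all general choices below: a condition that fails only at the zeros of a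
  nonzero holomorphic function holds near 0, and finitely many such conditions hold
  together.\<close>

lemma eventually_nonzero:
  assumes "f holomorphic_on ball 0 r" "b \<in> ball 0 r" "f b \<noteq> (0::complex)"
  shows "\<forall>\<^sub>F t in at 0. f t \<noteq> 0"
proof -
  have r: "(0::complex) \<in> ball 0 r" using assms(2) by (metis centre_in_ball ball_empty empty_iff not_le)
  show ?thesis
  proof (cases "f 0 = 0")
    case True
    then obtain e where e: "e > 0" "\<forall>z\<in>ball 0 e - {0}. f z \<noteq> 0"
      using isolated_zeros_ex[OF assms(1) open_ball connected_ball r _ assms(2,3)] by blast
    then show ?thesis unfolding eventually_at by (intro exI[of _ e]) (auto simp: dist_commute)
  next
    case False
    have "isCont f 0"
      using assms(1) r by (meson continuous_on_eq_continuous_at holomorphic_on_imp_continuous_on open_ball)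
    then have "(f \<longlongrightarrow> f 0) (at 0)" by (simp add: isCont_def)
    then show ?thesis using False by (rule tendsto_imp_eventually_ne)
  qed
qed

text \<open>Where \<open>a\<close> has no zeros, the quotient \<open>b / a\<close> has derivative
  zero. The identity theorem extends the resulting proportionality.\<close>

lemma wronskian2:
  fixes a b :: "complex \<Rightarrow> complex"
  assumes "a holomorphic_on ball z r" "b holomorphic_on ball z r" "\<exists>t\<in>ball z r. a t \<noteq> 0"
    and W: "\<And>t. t \<in> ball z r \<Longrightarrow> a t * deriv b t = deriv a t * b t"
  shows "\<exists>k. \<forall>t\<in>ball z r. b t = k * a t"
proof -
  obtain t0 where t0: "t0 \<in> ball z r" "a t0 \<noteq> 0" using assms(3) by blast
  have "open (ball z r \<inter> a -` (- {0}))"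
    by (intro continuous_open_preimage holomorphic_on_imp_continuous_on assms(1)) auto
  then obtain e where e: "e > 0" "ball t0 e \<subseteq> ball z r \<inter> a -` (- {0})"
    using t0 by (metis (no_types, lifting) ComplI IntI open_contains_ball singletonD vimageI)
  have an: "a t \<noteq> 0" "t \<in> ball z r" if "t \<in> ball t0 e" for t using e(2) that by auto
  have "((\<lambda>t. b t / a t) has_field_derivative 0) (at t within ball t0 e)" if t: "t \<in> ball t0 e" for t
  proof -
    have "(a has_field_derivative deriv a t) (at t)" "(b has_field_derivative deriv b t) (at t)"
      using holomorphic_derivI assms(1,2) an(2)[OF t] open_ball by blast+
    then have "((\<lambda>t. b t / a t) has_field_derivative (deriv b t * a t - b t * deriv a t) / (a t * a t)) (at t)"
      using an(1)[OF t] by (intro DERIV_divide)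
    moreover have "deriv b t * a t - b t * deriv a t = 0" using W[OF an(2)[OF t]] by (simp add: mult.commute)
    ultimately show ?thesis by (simp add: has_field_derivative_at_within)
  qed
  then obtain k where k: "\<And>t. t \<in> ball t0 e \<Longrightarrow> b t / a t = k"
    using has_field_derivative_zero_constant[OF convex_ball, of t0 e "\<lambda>t. b t / a t"] by blast
  have "b t = k * a t" if "t \<in> ball z r" for t
  proof (rule analytic_continuation_open[of "ball t0 e" "ball z r" b "\<lambda>t. k * a t" t])
    show "\<And>t. t \<in> ball t0 e \<Longrightarrow> b t = k * a t" using k an by (metis nonzero_divide_eq_eq)
    show "ball t0 e \<subseteq> ball z r" using e(2) by blast
  qed (use e(1) that assms in \<open>auto intro!: holomorphic_intros\<close>)
  then show ?thesis by blast
qed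

text \<open>Reduction to two functions. With \<open>p f\<close> the Wronskian of \<open>a\<close>
  and \<open>f\<close>, the Wronskian of \<open>p b\<close> and \<open>p c\<close> is
  \<open>a\<close> times the threefold one. So \<open>p c = k * p b\<close>, and then
  \<open>c - k * b\<close> has zero Wronskian with \<open>a\<close>.\<close>

lemma wronskian3:
  fixes a b c :: "complex \<Rightarrow> complex"
  assumes h: "a holomorphic_on ball z r" "b holomorphic_on ball z r" "c holomorphic_on ball z r"
    and a: "\<exists>t\<in>ball z r. a t \<noteq> 0" and b: "\<not> (\<exists>k. \<forall>t\<in>ball z r. b t = k * a t)"
    and W: "\<And>t. t \<in> ball z r \<Longrightarrow>
      a t * (deriv b t * deriv (deriv c) t - deriv (deriv b) t * deriv c t)
      - b t * (deriv a t * deriv (deriv c) t - deriv (deriv a) t * deriv c t)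
      + c t * (deriv a t * deriv (deriv b) t - deriv (deriv a) t * deriv b t) = 0"
  shows "\<exists>k l. \<forall>t\<in>ball z r. c t = k * b t + l * a t"
proof -
  define p where "p f t = a t * deriv f t - deriv a t * f t" for f t
  note D = holomorphic_derivI[OF _ open_ball]
  have h': "deriv a holomorphic_on ball z r" "deriv b holomorphic_on ball z r" "deriv c holomorphic_on ball z r"
    using h by (auto intro: holomorphic_deriv)
  have ph: "p b holomorphic_on ball z r" "p c holomorphic_on ball z r"
    unfolding p_def using h h' by (auto intro!: holomorphic_intros)
  have pd: "deriv (p f) t = a t * deriv (deriv f) t - deriv (deriv a) t * f t"
    if "f holomorphic_on ball z r" "t \<in> ball z r" for f t
  proof (rule DERIV_imp_deriv)
    have "deriv f holomorphic_on ball z r" using that by (auto intro: holomorphic_deriv)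
    then show "(p f has_field_derivative a t * deriv (deriv f) t - deriv (deriv a) t * f t) (at t)"
      unfolding p_def
      using D[OF h(1) that(2), of UNIV] D[OF that, of UNIV] D[OF h'(1) that(2), of UNIV] D[of "deriv f" z r t UNIV] that(2)
      by (auto intro!: derivative_eq_intros simp: algebra_simps)
  qed
  have "\<exists>k. \<forall>t\<in>ball z r. p c t = k * p b t"
  proof (rule wronskian2[OF ph])
    show "\<exists>t\<in>ball z r. p b t \<noteq> 0"
    proof (rule ccontr)
      assume "\<not> (\<exists>t\<in>ball z r. p b t \<noteq> 0)"
      then have "\<exists>k. \<forall>t\<in>ball z r. b t = k * a t"
        by (intro wronskian2[OF h(1,2) a]) (auto simp: p_def)
      then show False using b by blast
    qed
    fix t assume t: "t \<in> ball z r"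
    have "p b t * deriv (p c) t - deriv (p b) t * p c t = a t *
     (a t * (deriv b t * deriv (deriv c) t - deriv (deriv b) t * deriv c t)
      - b t * (deriv a t * deriv (deriv c) t - deriv (deriv a) t * deriv c t)
      + c t * (deriv a t * deriv (deriv b) t - deriv (deriv a) t * deriv b t))"
      unfolding pd[OF h(2) t] pd[OF h(3) t] p_def by algebra
    then show "p b t * deriv (p c) t = deriv (p b) t * p c t"
      unfolding W[OF t] by simp
  qed
  then obtain k where k: "\<And>t. t \<in> ball z r \<Longrightarrow> p c t = k * p b t" by blast
  let ?e = "\<lambda>t. c t - k * b t"
  have "\<exists>l. \<forall>t\<in>ball z r. ?e t = l * a t"
  proof (rule wronskian2[OF h(1) _ a])
    show "?e holomorphic_on ball z r" using h by (auto intro!: holomorphic_intros)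
    fix t assume t: "t \<in> ball z r"
    have "(?e has_field_derivative (deriv c t - k * deriv b t)) (at t)"
      using D[OF h(2) t, of UNIV] D[OF h(3) t, of UNIV] by (auto intro!: derivative_eq_intros)
    then have de: "deriv ?e t = deriv c t - k * deriv b t" by (rule DERIV_imp_deriv)
    show "a t * deriv ?e t = deriv a t * ?e t"
      unfolding de using k[OF t] by (simp add: p_def algebra_simps)
  qed
  then obtain l where "\<And>t. t \<in> ball z r \<Longrightarrow> c t - k * b t = l * a t" by blast
  then have "\<And>t. t \<in> ball z r \<Longrightarrow> c t = k * b t + l * a t" by (simp add: diff_eq_eq add.commute)
  then show ?thesis by blast
qed

section \<open>General points of an arc relative to a fixed subspace\<close>

lemma subspace_ne_UNIV:
  fixes U :: "(complex ^ 'n::finite) set"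
  assumes "vec.dim U < CARD('n)" shows "vec.span U \<noteq> UNIV"
proof
  assume "vec.span U = UNIV"
  then have "vec.dim (vec.span U) = CARD('n)" using vec_dim_card by metis
  then show False using assms by simp
qed

lemma fdot_vderiv:
  assumes "hol_curve g (ball 0 r)" "t \<in> ball 0 r"
  shows "deriv (\<lambda>t. fdot a (g t)) t = fdot a (vderiv g t)"
    "deriv (deriv (\<lambda>t. fdot a (g t))) t = fdot a (vderiv (vderiv g) t)"
proof -
  show "deriv (\<lambda>t. fdot a (g t)) t = fdot a (vderiv g t)"
    by (rule fdot_deriv(1)[OF assms(1) open_ball assms(2)])
  have "deriv (deriv (\<lambda>t. fdot a (g t))) t = deriv (\<lambda>t. fdot a (vderiv g t)) t"
  proof (rule deriv_cong_ev[OF _ refl])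
    show "\<forall>\<^sub>F x in nhds t. deriv (\<lambda>t. fdot a (g t)) x = fdot a (vderiv g x)"
      using eventually_nhds_in_open[OF open_ball assms(2)] fdot_deriv(1)[OF assms(1) open_ball]
      by (auto elim: eventually_mono)
  qed
  also have "\<dots> = fdot a (vderiv (vderiv g) t)"
    by (rule fdot_deriv(1)[OF vderiv_hol_curve[OF assms(1) open_ball] open_ball assms(2)])
  finally show "deriv (deriv (\<lambda>t. fdot a (g t))) t = fdot a (vderiv (vderiv g) t)" .
qed

text \<open>The tangent line at \<open>t\<close>, and for \<open>jet3_free\<close> the osculating
  plane, keeps its full dimension modulo the span of \<open>U\<close>.\<close>

definition jet2_free :: "(complex \<Rightarrow> complex ^ 'n::finite) \<Rightarrow> complex \<Rightarrow> (complex ^ 'n) set \<Rightarrow> bool" where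
  "jet2_free g t U \<longleftrightarrow> (\<forall>x y. x *s g t + y *s vderiv g t \<in> vec.span U \<longrightarrow> x = 0 \<and> y = 0)"

definition jet3_free :: "(complex \<Rightarrow> complex ^ 'n::finite) \<Rightarrow> complex \<Rightarrow> (complex ^ 'n) set \<Rightarrow> bool" where
  "jet3_free g t U \<longleftrightarrow> (\<forall>x y z. x *s g t + y *s vderiv g t + z *s vderiv (vderiv g) t \<in> vec.span U
    \<longrightarrow> x = 0 \<and> y = 0 \<and> z = 0)"

lemma eventually_in_ball: "r > 0 \<Longrightarrow> \<forall>\<^sub>F t in at (0::complex). t \<in> ball 0 r"
  by (rule eventually_at_in_open'[OF open_ball]) simp

context smooth_curve
begin

lemma chart_leaves_subspace:
  assumes "chart C g r" "vec.subspace U" "U \<noteq> UNIV"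
  obtains t where "t \<in> ball 0 r" "g t \<notin> U"
proof -
  obtain v where "v \<notin> U" using assms(3) by blast
  then obtain a where a: "\<And>u. u \<in> U \<Longrightarrow> fdot a u = 0" "fdot a v = 1"
    using separating_functional[OF assms(2)] by blast
  then have "a \<noteq> 0" by auto
  then show thesis using linear_vanish_chart[OF assms(1), of a] a(1) that by blast
qed

text \<open>The arc leaves every proper subspace, so points \<open>g t1\<close>, \<open>g t2\<close>
  and functionals \<open>a\<close>, \<open>b\<close> that vanish on \<open>U\<close> can be picked
  with triangular values. Along the arc \<open>a\<close> and \<open>b\<close> are then linearly
  independent, so their Wronskian is not identically zero. \<open>generic3\<close> does the same
  with three functionals.\<close>

lemma generic2:
  assumes g: "chart C g r" and U: "vec.dim U + 2 \<le> CARD('n)"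
  shows "\<forall>\<^sub>F t in at 0. jet2_free g t U"
proof -
  note h = chartD(2)[OF g]
  obtain t1 where t1: "t1 \<in> ball 0 r" "g t1 \<notin> vec.span U"
    using chart_leaves_subspace[OF g vec.subspace_span[of U]] subspace_ne_UNIV[of U] U by auto
  let ?U1 = "insert (g t1) U"
  have "vec.dim ?U1 < CARD('n)" using U vec.dim_insert[of "g t1" U] by (auto split: if_splits)
  then obtain t2 where t2: "t2 \<in> ball 0 r" "g t2 \<notin> vec.span ?U1"
    using chart_leaves_subspace[OF g vec.subspace_span[of ?U1]] subspace_ne_UNIV[of ?U1] by auto
  obtain a where a: "\<And>u. u \<in> vec.span U \<Longrightarrow> fdot a u = 0" "fdot a (g t1) = 1"
    using separating_functional[OF vec.subspace_span t1(2)] by blast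
  obtain b where b: "\<And>u. u \<in> vec.span ?U1 \<Longrightarrow> fdot b u = 0" "fdot b (g t2) = 1"
    using separating_functional[OF vec.subspace_span t2(2)] by blast
  have bU: "fdot b u = 0" if "u \<in> vec.span U" for u
    using b(1) that vec.span_mono[of U ?U1] by auto
  have bt1: "fdot b (g t1) = 0" using b(1) vec.span_base[of "g t1" ?U1] by simp
  define W where "W t = fdot a (g t) * fdot b (vderiv g t) - fdot a (vderiv g t) * fdot b (g t)" for t
  have "\<exists>t\<in>ball 0 r. W t \<noteq> 0"
  proof (rule ccontr)
    assume "\<not> (\<exists>t\<in>ball 0 r. W t \<noteq> 0)"
    then have "\<exists>k. \<forall>t\<in>ball 0 r. fdot b (g t) = k * fdot a (g t)"
      by (intro wronskian2 fdot_holomorphic[OF h])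
        (use t1 a in \<open>auto simp: fdot_vderiv[OF h] W_def intro: bexI[of _ t1]\<close>)
    then obtain k where "\<forall>t\<in>ball 0 r. fdot b (g t) = k * fdot a (g t)" by blast
    then show False using t1(1) t2(1) bt1 a(2) b(2) by (metis mult_cancel_left2 mult_zero_left zero_neq_one mult.right_neutral)
  qed
  then obtain t3 where t3: "t3 \<in> ball 0 r" "W t3 \<noteq> 0" by blast
  have "W holomorphic_on ball 0 r"
    unfolding W_def using fdot_holomorphic[OF h] fdot_holomorphic[OF vderiv_hol_curve[OF h open_ball]]
    by (auto intro!: holomorphic_intros)
  from eventually_nonzero[OF this t3] show ?thesis
  proof (rule eventually_mono, unfold jet2_free_def, intro allI impI)
    fix t x y assume W: "W t \<noteq> 0" and xy: "x *s g t + y *s vderiv g t \<in> vec.span U"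
    have 1: "x * fdot a (g t) + y * fdot a (vderiv g t) = 0" using a(1)[OF xy] by simp
    have 2: "x * fdot b (g t) + y * fdot b (vderiv g t) = 0" using bU[OF xy] by simp
    \<comment> \<open>Cramer's rule: \<open>W t\<close> is the determinant of the two equations for
      \<open>x\<close> and \<open>y\<close>.\<close>
    have "x * W t = 0" "y * W t = 0" using 1 2 unfolding W_def by algebra+
    then show "x = 0 \<and> y = 0" using W by simp
  qed
qed

lemma generic3:
  assumes g: "chart C g r" and U: "vec.dim U + 3 \<le> CARD('n)"
  shows "\<forall>\<^sub>F t in at 0. jet3_free g t U"
proof -
  note h = chartD(2)[OF g]
  obtain t1 where t1: "t1 \<in> ball 0 r" "g t1 \<notin> vec.span U"
    using chart_leaves_subspace[OF g vec.subspace_span[of U]] subspace_ne_UNIV[of U] U by auto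
  let ?U1 = "insert (g t1) U"
  have d1: "vec.dim ?U1 + 2 \<le> CARD('n)" using U vec.dim_insert[of "g t1" U] by (auto split: if_splits)
  then obtain t2 where t2: "t2 \<in> ball 0 r" "g t2 \<notin> vec.span ?U1"
    using chart_leaves_subspace[OF g vec.subspace_span[of ?U1]] subspace_ne_UNIV[of ?U1] by auto
  let ?U2 = "insert (g t2) ?U1"
  have d2: "vec.dim ?U2 < CARD('n)" using d1 vec.dim_insert[of "g t2" ?U1] by (auto split: if_splits)
  then obtain t3 where t3: "t3 \<in> ball 0 r" "g t3 \<notin> vec.span ?U2"
    using chart_leaves_subspace[OF g vec.subspace_span[of ?U2]] subspace_ne_UNIV[of ?U2] by auto
  obtain a where a: "\<And>u. u \<in> vec.span U \<Longrightarrow> fdot a u = 0" "fdot a (g t1) = 1"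
    using separating_functional[OF vec.subspace_span t1(2)] by blast
  obtain b where b: "\<And>u. u \<in> vec.span ?U1 \<Longrightarrow> fdot b u = 0" "fdot b (g t2) = 1"
    using separating_functional[OF vec.subspace_span t2(2)] by blast
  obtain c where c: "\<And>u. u \<in> vec.span ?U2 \<Longrightarrow> fdot c u = 0" "fdot c (g t3) = 1"
    using separating_functional[OF vec.subspace_span t3(2)] by blast
  have bU: "fdot b u = 0" if "u \<in> vec.span U" for u
    using b(1) that vec.span_mono[of U ?U1] by auto
  have cU: "fdot c u = 0" if "u \<in> vec.span U" for u
    using c(1) that vec.span_mono[of U ?U2] by auto
  have z: "fdot b (g t1) = 0" "fdot c (g t1) = 0" "fdot c (g t2) = 0"
    using b(1) c(1) vec.span_base[of _ ?U1] vec.span_base[of _ ?U2] by auto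
  define W where "W t =
      fdot a (g t) * (fdot b (vderiv g t) * fdot c (vderiv (vderiv g) t) - fdot b (vderiv (vderiv g) t) * fdot c (vderiv g t))
      - fdot b (g t) * (fdot a (vderiv g t) * fdot c (vderiv (vderiv g) t) - fdot a (vderiv (vderiv g) t) * fdot c (vderiv g t))
      + fdot c (g t) * (fdot a (vderiv g t) * fdot b (vderiv (vderiv g) t) - fdot a (vderiv (vderiv g) t) * fdot b (vderiv g t))" for t
  have "\<exists>t\<in>ball 0 r. W t \<noteq> 0"
  proof (rule ccontr)
    assume W0: "\<not> (\<exists>t\<in>ball 0 r. W t \<noteq> 0)"
    have "\<exists>k l. \<forall>t\<in>ball 0 r. fdot c (g t) = k * fdot b (g t) + l * fdot a (g t)"
    proof (rule wronskian3[OF fdot_holomorphic[OF h] fdot_holomorphic[OF h] fdot_holomorphic[OF h]])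
      show "\<exists>t\<in>ball 0 r. fdot a (g t) \<noteq> 0" using t1(1) a(2) by (intro bexI[of _ t1]) auto
      show "\<not> (\<exists>k. \<forall>t\<in>ball 0 r. fdot b (g t) = k * fdot a (g t))"
      proof
        assume "\<exists>k. \<forall>t\<in>ball 0 r. fdot b (g t) = k * fdot a (g t)"
        then obtain k where k: "\<forall>t\<in>ball 0 r. fdot b (g t) = k * fdot a (g t)" by blast
        from k t1(1) z(1) a(2) have "k = 0" by (metis mult.right_neutral)
        then show False using k t2(1) b(2) by (metis mult_zero_left zero_neq_one)
      qed
    qed (use W0 in \<open>simp add: fdot_vderiv[OF h] W_def\<close>)
    then obtain k l where kl: "\<And>t. t \<in> ball 0 r \<Longrightarrow> fdot c (g t) = k * fdot b (g t) + l * fdot a (g t)"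
      by blast
    have "l = 0" using kl[OF t1(1)] z a(2) by simp
    moreover have "k = 0" using kl[OF t2(1)] z b(2) \<open>l = 0\<close> by simp
    ultimately show False using kl[OF t3(1)] c(2) by simp
  qed
  then obtain t4 where t4: "t4 \<in> ball 0 r" "W t4 \<noteq> 0" by blast
  note h' = vderiv_hol_curve[OF h open_ball]
  have "W holomorphic_on ball 0 r"
    unfolding W_def using fdot_holomorphic[OF h] fdot_holomorphic[OF h']
      fdot_holomorphic[OF vderiv_hol_curve[OF h' open_ball]]
    by (auto intro!: holomorphic_intros)
  from eventually_nonzero[OF this t4] show ?thesis
  proof (rule eventually_mono, unfold jet3_free_def, intro allI impI)
    fix t x y z
    assume W: "W t \<noteq> 0" and xy: "x *s g t + y *s vderiv g t + z *s vderiv (vderiv g) t \<in> vec.span U"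
    have 1: "x * fdot a (g t) + y * fdot a (vderiv g t) + z * fdot a (vderiv (vderiv g) t) = 0" using a(1)[OF xy] by simp
    have 2: "x * fdot b (g t) + y * fdot b (vderiv g t) + z * fdot b (vderiv (vderiv g) t) = 0" using bU[OF xy] by simp
    have 3: "x * fdot c (g t) + y * fdot c (vderiv g t) + z * fdot c (vderiv (vderiv g) t) = 0" using cU[OF xy] by simp
    have "x * W t = 0" "y * W t = 0" "z * W t = 0" using 1 2 3 unfolding W_def by algebra+
    then show "x = 0 \<and> y = 0 \<and> z = 0" using W by simp
  qed
qed

end

section \<open>Spans of points near a general point\<close>

lemma eventually_at_zeroD: "eventually P (at (0::complex)) \<Longrightarrow> \<exists>t. P t"
  using eventually_happens[of P "at 0"] by auto

lemma dim_insert_le: "vec.dim (insert x S) \<le> vec.dim S + 1" for S :: "(complex ^ 'k::finite) set"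
  by (simp add: vec.dim_insert)

lemma dim_le_card_finite: "finite S \<Longrightarrow> vec.dim S \<le> card S" for S :: "(complex ^ 'k::finite) set"
  using vec.dim_le_card[of S S] vec.span_superset by blast

lemma limit_quotient:
  assumes "(f has_field_derivative d) (at 0)" "f (0::complex) = 0" "filterlim s (at 0) F"
  shows "((\<lambda>n. f (s n) / s n) \<longlongrightarrow> d) F"
proof -
  have "((\<lambda>z. f z / z) \<longlongrightarrow> d) (at 0)"
    using assms(1,2) by (simp add: has_field_derivative_iff)
  then show ?thesis using assms(3) by (rule filterlim_compose)
qed

text \<open>Modulo the span of \<open>S\<close>, the vector \<open>v\<close> is a multiple of
  \<open>p\<close>. Eliminating the multiplier leaves an identity that survives a limit in which the
  multiplier may be unbounded.\<close>

lemma cross_multiplication: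
  assumes "v \<in> vec.span (insert p S)" "\<And>u. u \<in> S \<Longrightarrow> fdot a u = 0" "\<And>u. u \<in> S \<Longrightarrow> fdot b u = 0"
  shows "fdot a v * fdot b p = fdot b v * fdot a p"
proof -
  obtain x where x: "v - x *s p \<in> vec.span S" using assms(1) by (auto simp: vec.span_insert)
  have "fdot a (v - x *s p) = 0" "fdot b (v - x *s p) = 0"
    using fdot_zero_span[OF assms(2) x] fdot_zero_span[OF assms(3) x] by auto
  then have "fdot a v = x * fdot a p" "fdot b v = x * fdot b p" by auto
  then show ?thesis by simp
qed

lemma chart_sequence:
  assumes g: "chart C g r" and v: "\<And>n. v n \<in> affine_cone C" "v \<longlonglongrightarrow> c *s g 0" "c \<noteq> 0"
  obtains s k where "\<forall>\<^sub>F n in sequentially. s n \<in> ball 0 r \<and> v n = k n *s g (s n) \<and> k n \<noteq> 0"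
    "s \<longlonglongrightarrow> 0"
proof -
  obtain l m V where lm: "\<And>t. t \<in> ball 0 r \<Longrightarrow> fdot l (g t) = 1" "\<And>t. t \<in> ball 0 r \<Longrightarrow> fdot m (g t) = t"
    and V: "open V" "g ` ball 0 r \<subseteq> V"
    "\<And>v. v \<in> V \<Longrightarrow> v \<in> affine_cone C \<Longrightarrow>
       fdot m v / fdot l v \<in> ball 0 r \<and> v = fdot l v *s g (fdot m v / fdot l v)"
    using chart_cover[OF g] by blast
  have r0: "(0::complex) \<in> ball 0 r" by (rule chart_zero_in[OF g])
  define s where "s n = fdot m (v n) / fdot l (v n)" for n
  have "(\<lambda>n. (1 / c) *s v n) \<longlonglongrightarrow> (1 / c) *s (c *s g 0)"
    unfolding vector_scalar_mult_def by (intro tendsto_intros v(2)[unfolded vector_scalar_mult_def])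
  then have "(\<lambda>n. (1 / c) *s v n) \<longlonglongrightarrow> g 0" using v(3) by simp
  then have ev: "\<forall>\<^sub>F n in sequentially. (1 / c) *s v n \<in> V"
    using V(1,2) r0 by (intro topological_tendstoD) auto
  have "\<forall>\<^sub>F n in sequentially. s n \<in> ball 0 r \<and> v n = fdot l (v n) *s g (s n) \<and> fdot l (v n) \<noteq> 0"
  proof (rule eventually_mono[OF ev])
    fix n assume n: "(1 / c) *s v n \<in> V"
    have "(1 / c) *s v n \<in> affine_cone C" using v by (intro cone_scale) auto
    from V(3)[OF n this] have *: "s n \<in> ball 0 r" "(1 / c) *s v n = (fdot l (v n) / c) *s g (s n)"
      using v(3) by (simp_all add: s_def)
    have "v n = c *s ((1 / c) *s v n)" using v(3) by simp
    also have "\<dots> = fdot l (v n) *s g (s n)" unfolding *(2) using v(3) by simp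
    finally have "v n = fdot l (v n) *s g (s n)" .
    moreover have "v n \<noteq> 0" using v(1)[of n] by (auto simp: affine_cone_def)
    ultimately show "s n \<in> ball 0 r \<and> v n = fdot l (v n) *s g (s n) \<and> fdot l (v n) \<noteq> 0"
      using *(1) by (metis vector_smult_lzero)
  qed
  moreover have "s \<longlonglongrightarrow> fdot m (c *s g 0) / fdot l (c *s g 0)"
    unfolding s_def by (intro tendsto_intros v(2)) (use lm r0 v(3) in auto)
  then have "s \<longlonglongrightarrow> 0" using lm(1)[OF r0] lm(2)[OF r0] by simp
  ultimately show thesis by (rule that[of s "\<lambda>n. fdot l (v n)"])
qed

section \<open>Shifted arcs and orders of vanishing\<close>

lemma deriv_shift_arg: "deriv (\<lambda>s. f (t + s)) z = deriv f (t + (z::complex))"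
  unfolding deriv_def by (simp add: DERIV_shift[of f _ z t, symmetric] add.commute)

lemma vderiv_shift: "vderiv (\<lambda>s. g (t + s)) = (\<lambda>s. vderiv g (t + s))"
  unfolding vderiv_def by (auto simp: deriv_shift_arg[of "\<lambda>t. g t $ _"] fun_eq_iff vec_eq_iff)

text \<open>The divided difference at 0 with its removable singularity filled in. For
  \<open>f\<close> holomorphic near 0, \<open>(divz ^^ k) f 0\<close> is the \<open>k\<close>-th
  Taylor coefficient, so orders of vanishing become linear conditions.\<close>

definition divz :: "(complex \<Rightarrow> complex) \<Rightarrow> complex \<Rightarrow> complex" where
  "divz f z = (if z = 0 then deriv f 0 else (f z - f 0) / z)"

lemma divz_holomorphic: "f holomorphic_on ball 0 r \<Longrightarrow> divz f holomorphic_on ball 0 r"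
  using pole_lemma_open[OF _ open_ball, of f 0 r 0] unfolding divz_def[abs_def] diff_0_right .

lemma divz_eq: "f z = f 0 + z * divz f z"
  by (simp add: divz_def)

lemma divz_0 [simp]: "divz f 0 = deriv f 0"
  by (simp add: divz_def)

lemma deriv_deriv_0:
  assumes f: "f holomorphic_on ball 0 r" and r: "r > 0"
  shows "deriv (deriv f) 0 = 2 * deriv (divz f) 0"
proof -
  let ?P = "divz f"
  have P: "?P holomorphic_on ball 0 r" by (rule divz_holomorphic[OF f])
  have r0: "(0::complex) \<in> ball 0 r" using r by simp
  have PD: "(?P has_field_derivative deriv ?P z) (at z)" if "z \<in> ball 0 r" for z
    by (rule holomorphic_derivI[OF P open_ball that])
  have "deriv f z = ?P z + z * deriv ?P z" if z: "z \<in> ball 0 r" for z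
  proof (rule DERIV_imp_deriv)
    have "((\<lambda>z. f 0 + z * ?P z) has_field_derivative ?P z + z * deriv ?P z) (at z)"
      using PD[OF z] by (auto intro!: derivative_eq_intros)
    then show "(f has_field_derivative ?P z + z * deriv ?P z) (at z)" by (simp add: divz_eq[symmetric])
  qed
  then have "deriv (deriv f) 0 = deriv (\<lambda>z. ?P z + z * deriv ?P z) 0"
    by (intro deriv_cong_ev refl) (use eventually_nhds_in_open[OF open_ball r0] in \<open>auto elim: eventually_mono\<close>)
  also have "\<dots> = 2 * deriv ?P 0"
  proof (rule DERIV_imp_deriv)
    have "deriv ?P holomorphic_on ball 0 r" by (rule holomorphic_deriv[OF P open_ball])
    then have "(deriv ?P has_field_derivative deriv (deriv ?P) 0) (at 0)"
      by (rule holomorphic_derivI[OF _ open_ball r0])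
    then show "((\<lambda>z. ?P z + z * deriv ?P z) has_field_derivative 2 * deriv ?P 0) (at 0)"
      using PD[OF r0] by (auto intro!: derivative_eq_intros)
  qed
  finally show ?thesis .
qed

text \<open>If \<open>f\<close> has a double and \<open>h\<close> a simple zero at \<open>0\<close>, then \<open>f / h\<close> has a simple zero.\<close>
lemma quotient_locally_injective:
  fixes f h :: "complex \<Rightarrow> complex"
  assumes f: "f holomorphic_on ball 0 r" "f 0 = 0" "deriv f 0 = 0" "deriv (deriv f) 0 \<noteq> 0"
    and h: "h holomorphic_on ball 0 r" "h 0 = 0" "deriv h 0 \<noteq> 0" and r: "r > 0"
  obtains e where "e > 0"
    "\<And>s t. s \<in> ball 0 e - {0} \<Longrightarrow> t \<in> ball 0 e - {0} \<Longrightarrow> f s * h t = h s * f t \<Longrightarrow> s = t"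
proof -
  define P Q where PQ: "P = divz f" "Q = divz h"
  have P: "P holomorphic_on ball 0 r" "\<And>z. f z = z * P z"
    using divz_holomorphic[OF f(1)] divz_eq[of f] f(2) by (simp_all add: PQ)
  have Q: "Q holomorphic_on ball 0 r" "\<And>z. h z = z * Q z"
    using divz_holomorphic[OF h(1)] divz_eq[of h] h(2) by (simp_all add: PQ)
  have r0: "(0::complex) \<in> ball 0 r" using r by simp
  have P0: "deriv P 0 \<noteq> 0" using f(4) deriv_deriv_0[OF f(1) r] by (simp add: PQ)
  have Q0: "Q 0 \<noteq> 0" using h(3) by (simp add: PQ)
  define S where "S = ball 0 r \<inter> Q -` (- {0})"
  have S: "open S" "0 \<in> S"
    unfolding S_def using Q0 r0 by (auto intro!: continuous_open_preimage holomorphic_on_imp_continuous_on Q(1))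
  have hol: "(\<lambda>z. P z / Q z) holomorphic_on S"
    using P(1) Q(1) by (auto simp: S_def intro!: holomorphic_intros intro: holomorphic_on_subset)
  have "((\<lambda>z. P z / Q z) has_field_derivative (deriv P 0 * Q 0 - P 0 * deriv Q 0) / (Q 0 * Q 0)) (at 0)"
    using Q0 holomorphic_derivI[OF P(1) open_ball r0] holomorphic_derivI[OF Q(1) open_ball r0]
    by (intro DERIV_divide)
  then have "deriv (\<lambda>z. P z / Q z) 0 = (deriv P 0 * Q 0 - P 0 * deriv Q 0) / (Q 0 * Q 0)"
    by (rule DERIV_imp_deriv)
  moreover have "P 0 = 0" using f(3) by (simp add: PQ)
  ultimately have d: "deriv (\<lambda>z. P z / Q z) 0 \<noteq> 0" using P0 Q0 by simp
  obtain e where e: "e > 0" "ball 0 e \<subseteq> S" "inj_on (\<lambda>z. P z / Q z) (ball 0 e)"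
    using has_complex_derivative_locally_injective[OF hol S(2,1) d] by metis
  show thesis
  proof (rule that[OF e(1)])
    fix s t assume st: "s \<in> ball 0 e - {0}" "t \<in> ball 0 e - {0}" and eq: "f s * h t = h s * f t"
    have "Q s \<noteq> 0" "Q t \<noteq> 0" using st e(2) by (auto simp: S_def)
    moreover have "P s * Q t = Q s * P t" using eq st by (simp add: P(2)[of s] P(2)[of t] Q(2)[of s] Q(2)[of t])
    ultimately have "P s / Q s = P t / Q t" by (simp add: field_simps)
    then show "s = t" using e(3) st by (auto dest: inj_onD)
  qed
qed

section \<open>Hyperplanes with one simple tangency\<close>

context smooth_curve
begin

text \<open>
  The hyperplanes wanted are spanned by the tangent line at one point \<open>g 0\<close> and by further points \<open>B\<close>, such that
  the curve meets them only there, with multiplicity \<open>2\<close> at \<open>g 0\<close> (fourth line) and \<open>1\<close> on \<open>B\<close> (last line).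
\<close>
definition tangent_config :: "(complex \<Rightarrow> complex ^ 'n) \<Rightarrow> real \<Rightarrow> (complex ^ 'n) set \<Rightarrow> bool" where
  "tangent_config g r B \<longleftrightarrow> chart C g r \<and> finite B \<and> B \<subseteq> smooth_cone C \<and> vec.independent B \<and> g 0 \<notin> vec.span B
    \<and> (\<forall>v\<in>smooth_cone C. v \<in> vec.span (insert (g 0) B) \<longrightarrow> v \<in> vec.span {g 0} \<or> (\<exists>b\<in>B. v \<in> vec.span {b}))
    \<and> vderiv g 0 \<notin> vec.span (insert (g 0) B)
    \<and> vderiv (vderiv g) 0 \<notin> vec.span (insert (vderiv g 0) (insert (g 0) B))
    \<and> (\<forall>b\<in>B. \<not> tangent_space C (point_of b) \<subseteq> vec.span (insert (vderiv g 0) (insert (g 0) B)))"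

lemma chart_tangent_span:
  assumes "chart C g r" shows "tangent_space C (point_of (g 0)) = vec.span {g 0, vderiv g 0}"
  using dim_plane_unique[OF tangent_space_subspace dim_tangent] chart_tangent[OF assms chart_zero_in[OF assms]]
    chartD(3,4)[OF assms chart_zero_in[OF assms]] by blast

end

text \<open>The rank hypothesis in terms of vectors. With \<open>CARD('n) = n + 1\<close> the bound
  on \<open>S\<close> says at most \<open>n - 1\<close> points, whose span can contain no tangent
  point other than the point of tangency.\<close>

locale tangent_rank_curve = smooth_curve C for C :: "'n::finite proj set" +
  assumes tangent_rank: "\<lbrakk>v \<in> affine_cone C; w \<in> tangent_space C (point_of v); finite S; S \<subseteq> affine_cone C;
    card S + 2 \<le> CARD('n); w \<in> vec.span S\<rbrakk> \<Longrightarrow> w \<in> vec.span {v}"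
begin

text \<open>
  If \<open>v = w + u\<close> with \<open>w\<close> tangent at \<open>g 0\<close> and \<open>u\<close> in the span of \<open>B\<close>, then \<open>w = v - u\<close> has small rank.
\<close>
lemma tangent_span_meets_curve:
  assumes g: "chart C g r" and B: "finite B" "B \<subseteq> smooth_cone C" "card B + 3 \<le> CARD('n)"
    and v: "v \<in> affine_cone C" "v \<in> vec.span (insert (vderiv g 0) (insert (g 0) B))"
  shows "v \<in> vec.span (insert (g 0) B)"
proof -
  obtain x y where xy: "v - x *s vderiv g 0 - y *s g 0 \<in> vec.span B"
    using v(2) by (auto simp: vec.span_insert)
  define w where "w = x *s vderiv g 0 + y *s g 0"
  note g0 = chart_zero_in[OF g]
  have wT: "w \<in> tangent_space C (point_of (g 0))"
    unfolding w_def using chart_tangent[OF g g0] tangent_space_subspace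
    by (intro vec.subspace_add vec.subspace_scale)
  have wB: "v - w \<in> vec.span B" using xy by (simp add: w_def diff_diff_eq)
  have "v - (v - w) \<in> vec.span (insert v B)"
    by (rule vec.span_diff) (use wB vec.span_mono[of B "insert v B"] in \<open>auto intro: vec.span_base\<close>)
  then have "w \<in> vec.span (insert v B)" by simp
  \<comment> \<open>The set \<open>insert v B\<close> has at most \<open>card B + 1\<close>
    elements, which is exactly what \<open>tangent_rank\<close> admits under the bound on
    \<open>B\<close>.\<close>
  then have "w \<in> vec.span {g 0}"
    using B v(1) smooth_cone_subset chartD(3)[OF g g0] wT
    by (intro tangent_rank[of "g 0" w "insert v B"]) (auto simp: card_insert_if)
  then have "w \<in> vec.span (insert (g 0) B)" using vec.span_mono[of "{g 0}" "insert (g 0) B"] by auto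
  moreover have "v - w \<in> vec.span (insert (g 0) B)" using wB vec.span_mono[of B "insert (g 0) B"] by auto
  ultimately have "(v - w) + w \<in> vec.span (insert (g 0) B)" by (rule vec.span_add[rotated])
  then show ?thesis by simp
qed

text \<open>
  As \<open>t\<close> tends to \<open>0\<close>, the span of \<open>g t\<close>, \<open>g 0\<close> and \<open>B\<close> tends to the span of the tangent line and \<open>B\<close>, which
  meets the curve only in the known points. So a further intersection point would have to
  converge to one of these, which the independence conditions exclude.
\<close>
lemma nearby_span_meets_curve:
  assumes T: "tangent_config g r B" and card: "card B + 3 \<le> CARD('n)"
  shows "\<forall>\<^sub>F t in at 0. \<forall>v\<in>smooth_cone C. v \<in> vec.span (insert (g t) (insert (g 0) B)) \<longrightarrow>
    v \<in> vec.span {g t} \<or> v \<in> vec.span {g 0} \<or> (\<exists>b\<in>B. v \<in> vec.span {b})"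
    (is "eventually ?P _")
proof (rule sequentially_imp_eventually_at, intro allI impI, elim conjE)
  fix t0 :: "nat \<Rightarrow> complex" assume t0: "\<forall>n. t0 n \<noteq> 0" "t0 \<longlonglongrightarrow> 0"
  let ?W = "insert (g 0) B" and ?U = "insert (vderiv g 0) (insert (g 0) B)"
  have g: "chart C g r" and B: "finite B" "B \<subseteq> smooth_cone C"
    and meet: "\<And>v. v \<in> smooth_cone C \<Longrightarrow> v \<in> vec.span ?W \<Longrightarrow> v \<in> vec.span {g 0} \<or> (\<exists>b\<in>B. v \<in> vec.span {b})"
    and d1: "vderiv g 0 \<notin> vec.span ?W" and d2: "vderiv (vderiv g) 0 \<notin> vec.span ?U"
    and dB: "\<And>b. b \<in> B \<Longrightarrow> \<not> tangent_space C (point_of b) \<subseteq> vec.span ?U"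
    using T unfolding tangent_config_def by blast+
  note hol = chartD(2)[OF g] and r0 = chart_zero_in[OF g]
  show "\<forall>\<^sub>F n in sequentially. ?P (t0 n)"
  proof (rule ccontr)
    assume "\<not> (\<forall>\<^sub>F n in sequentially. ?P (t0 n))"
    from not_eventually_sequentiallyD[OF this]
    obtain \<sigma> :: "nat \<Rightarrow> nat" where \<sigma>: "strict_mono \<sigma>" "\<forall>n. \<not> ?P (t0 (\<sigma> n))" by blast
    \<comment> \<open>A further intersection vector on the secant span. All clauses are invariant
      under scaling, so it can be taken of norm 1 and a subsequence converges.\<close>
    define bad where "bad t v \<longleftrightarrow> v \<in> smooth_cone C \<and> v \<in> vec.span (insert (g t) ?W) \<and>
      v \<notin> vec.span {g t} \<and> v \<notin> vec.span {g 0} \<and> (\<forall>b\<in>B. v \<notin> vec.span {b})" for t v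
    have "\<exists>v. bad (t0 (\<sigma> n)) v \<and> norm v = 1" for n
    proof -
      obtain v where v: "bad (t0 (\<sigma> n)) v" using spec[OF \<sigma>(2), of n] unfolding bad_def by blast
      then have "v \<noteq> 0" using smooth_cone_subset by (auto simp: bad_def affine_cone_def)
      let ?c = "complex_of_real (1 / norm v)"
      have c: "?c \<noteq> 0" using \<open>v \<noteq> 0\<close> by simp
      have "?c *s v \<in> vec.span X \<longleftrightarrow> v \<in> vec.span X" for X
        using c vec.span_scale[of v X ?c] vec.span_scale[of "?c *s v" X "1 / ?c"] by auto
      then have "bad (t0 (\<sigma> n)) (?c *s v)"
        using v c smooth_cone_scale[of v C ?c] unfolding bad_def by simp
      then show ?thesis using unit_scale[OF \<open>v \<noteq> 0\<close>] by blast
    qed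
    then obtain w where w: "\<And>n. bad (t0 (\<sigma> n)) (w n)" "\<And>n. norm (w n) = 1" by metis
    have "\<forall>n. w n \<in> sphere 0 1" using w(2) by simp
    then obtain v and \<tau> :: "nat \<Rightarrow> nat" where v: "v \<in> sphere 0 1" "strict_mono \<tau>" "(w \<circ> \<tau>) \<longlonglongrightarrow> v"
      using compact_sphere[of 0 1, unfolded compact_def] by blast
    define t where "t n = t0 (\<sigma> (\<tau> n))" for n
    define u where "u n = w (\<tau> n)" for n
    have u: "u \<longlonglongrightarrow> v" using v(3) by (simp add: u_def[abs_def] o_def)
    have bad: "bad (t n) (u n)" for n using w(1) by (simp add: t_def u_def)
    have "t \<longlonglongrightarrow> 0" unfolding t_def[abs_def]
      using LIMSEQ_subseq_LIMSEQ[OF LIMSEQ_subseq_LIMSEQ[OF t0(2) \<sigma>(1)] v(2)] by (simp add: o_def)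
    moreover have "t n \<noteq> 0" for n using t0(1) by (simp add: t_def)
    ultimately have t: "filterlim t (at 0) sequentially" by (simp add: filterlim_at)
    have vC: "v \<in> smooth_cone C"
      by (rule smooth_cone_closed[OF _ u]) (use bad v(1) in \<open>auto simp: bad_def\<close>)
    have uC: "u n \<in> affine_cone C" for n using bad[of n] smooth_cone_subset by (auto simp: bad_def)
    \<comment> \<open>The secant condition is used only in this form, for functionals that vanish on
      \<open>g 0\<close> and on \<open>B\<close>.\<close>
    have cross: "fdot a (u n) * fdot b (g (t n)) = fdot b (u n) * fdot a (g (t n))"
      if "\<And>x. x \<in> ?W \<Longrightarrow> fdot a x = 0" "\<And>x. x \<in> ?W \<Longrightarrow> fdot b x = 0" for a b n
      by (rule cross_multiplication[OF _ that]) (use bad[of n] in \<open>auto simp: bad_def\<close>)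
    obtain b where b: "\<And>x. x \<in> vec.span ?W \<Longrightarrow> fdot b x = 0" "fdot b (vderiv g 0) = 1"
      using separating_functional[OF vec.subspace_span d1] by blast
    have bW: "fdot b x = 0" if "x \<in> ?W" for x by (rule b(1)[OF vec.span_base[OF that]])
    have quot: "(\<lambda>n. fdot a (g (t n)) / t n) \<longlonglongrightarrow> fdot a (vderiv g 0)" if "fdot a (g 0) = 0" for a
      by (rule limit_quotient[OF fdot_deriv(2)[OF hol open_ball r0] that t])
    have vU: "v \<in> vec.span ?U"
    proof (rule ccontr)
      assume "v \<notin> vec.span ?U"
      then obtain a where a: "\<And>x. x \<in> vec.span ?U \<Longrightarrow> fdot a x = 0" "fdot a v = 1"
        using separating_functional[OF vec.subspace_span] by blast
      have aU: "fdot a x = 0" if "x \<in> ?U" for x by (rule a(1)[OF vec.span_base[OF that]])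
      \<comment> \<open>Dividing \<open>cross\<close> by \<open>t n\<close> replaces
        \<open>g (t n)\<close> in the limit by the velocity at 0, where \<open>a\<close> is 0 and
        \<open>b\<close> is 1. This would force \<open>fdot a v = 0\<close>.\<close>
      have l1: "(\<lambda>n. fdot a (u n) * (fdot b (g (t n)) / t n)) \<longlonglongrightarrow> fdot a v * fdot b (vderiv g 0)"
        by (intro tendsto_mult tendsto_fdot u quot) (use bW in auto)
      have l2: "(\<lambda>n. fdot b (u n) * (fdot a (g (t n)) / t n)) \<longlonglongrightarrow> fdot b v * fdot a (vderiv g 0)"
        by (intro tendsto_mult tendsto_fdot u quot) (use aU in auto)
      have "(\<lambda>n. fdot a (u n) * (fdot b (g (t n)) / t n)) = (\<lambda>n. fdot b (u n) * (fdot a (g (t n)) / t n))"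
        using cross[of a b] aU bW by auto
      from LIMSEQ_unique[OF l1[unfolded this] l2]
      have "fdot a v * fdot b (vderiv g 0) = fdot b v * fdot a (vderiv g 0)" .
      then show False using a b aU by simp
    qed
    have "v \<in> vec.span ?W"
      by (rule tangent_span_meets_curve[OF g B card _ vU]) (use vC smooth_cone_subset in auto)
    from meet[OF vC this] show False
    proof (elim disjE bexE)
      assume "v \<in> vec.span {g 0}"
      then obtain c where c: "v = c *s g 0" by (auto simp: span_singleton_iff)
      have "c \<noteq> 0" using c v(1) by auto
      obtain s k where s: "\<forall>\<^sub>F n in sequentially. s n \<in> ball 0 r \<and> u n = k n *s g (s n) \<and> k n \<noteq> 0" "s \<longlonglongrightarrow> 0"
        by (rule chart_sequence[OF g uC u[unfolded c] \<open>c \<noteq> 0\<close>])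
      \<comment> \<open>Along the arc, \<open>a\<close> has a double and \<open>b\<close> a simple
        zero at 0, so \<open>a / b\<close> is injective near 0. By \<open>cross\<close> it agrees at
        \<open>s n\<close> and \<open>t n\<close>; but \<open>s n = t n\<close> would make
        \<open>u n\<close> a multiple of \<open>g (t n)\<close>.\<close>
      obtain a where a: "\<And>x. x \<in> vec.span ?U \<Longrightarrow> fdot a x = 0" "fdot a (vderiv (vderiv g) 0) = 1"
        using separating_functional[OF vec.subspace_span d2] by blast
      have aU: "fdot a x = 0" if "x \<in> ?U" for x by (rule a(1)[OF vec.span_base[OF that]])
      obtain e where e: "e > 0" "\<And>x y. x \<in> ball 0 e - {0} \<Longrightarrow> y \<in> ball 0 e - {0} \<Longrightarrow>
          fdot a (g x) * fdot b (g y) = fdot b (g x) * fdot a (g y) \<Longrightarrow> x = y"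
      proof (rule quotient_locally_injective[of "\<lambda>t. fdot a (g t)" r "\<lambda>t. fdot b (g t)"])
        show "r > 0" by (rule chartD(1)[OF g])
      qed (use aU bW a(2) b(2) in \<open>auto simp: fdot_vderiv[OF hol r0] intro: fdot_holomorphic[OF hol]\<close>)
      have "\<forall>\<^sub>F n in sequentially. s n \<in> ball 0 e" "\<forall>\<^sub>F n in sequentially. t n \<in> ball 0 e"
        using topological_tendstoD[OF s(2) open_ball, of 0 e] topological_tendstoD[OF \<open>t \<longlonglongrightarrow> 0\<close> open_ball, of 0 e] e(1)
        by auto
      with s(1) have "\<forall>\<^sub>F n in sequentially. (s n \<in> ball 0 r \<and> u n = k n *s g (s n) \<and> k n \<noteq> 0) \<and> s n \<in> ball 0 e \<and> t n \<in> ball 0 e"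
        by (simp only: eventually_conj_iff)
      then obtain n where n: "s n \<in> ball 0 r" "u n = k n *s g (s n)" "k n \<noteq> 0" "s n \<in> ball 0 e" "t n \<in> ball 0 e"
        unfolding eventually_sequentially by blast
      have "s n \<noteq> 0" using bad[of n] n(2) by (auto simp: bad_def span_singleton_iff)
      moreover have "fdot a (g (s n)) * fdot b (g (t n)) = fdot b (g (s n)) * fdot a (g (t n))"
        using cross[of a b n] aU bW n(2,3) by simp
      ultimately have "s n = t n" using e(2)[of "s n" "t n"] n \<open>t n \<noteq> 0\<close> by auto
      then show False using bad[of n] n(2) by (auto simp: bad_def span_singleton_iff)
    next
      fix b' assume b': "b' \<in> B" "v \<in> vec.span {b'}"
      then obtain c where c: "v = c *s b'" by (auto simp: span_singleton_iff)
      have "c \<noteq> 0" using c v(1) by auto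
      obtain \<beta> q where \<beta>: "chart C \<beta> q" "\<beta> 0 = b'"
        using b' B(2) by (auto simp: smooth_cone_def)
      obtain s k where s: "\<forall>\<^sub>F n in sequentially. s n \<in> ball 0 q \<and> u n = k n *s \<beta> (s n) \<and> k n \<noteq> 0" "s \<longlonglongrightarrow> 0"
        by (rule chart_sequence[OF \<beta>(1) uC u[unfolded c \<beta>(2)[symmetric]] \<open>c \<noteq> 0\<close>])
      note q0 = chart_zero_in[OF \<beta>(1)]
      \<comment> \<open>The tangent line at \<open>b'\<close> leaves the limiting span, so some
        \<open>a\<close> vanishes on \<open>?U\<close> but not on this velocity. Dividing
        \<open>cross\<close> by \<open>s n * t n\<close>, the limits of the two sides are 1 and
        0.\<close>
      have "vderiv \<beta> 0 \<notin> vec.span ?U"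
      proof
        assume "vderiv \<beta> 0 \<in> vec.span ?U"
        moreover have "\<beta> 0 \<in> vec.span ?U" using b'(1) \<beta>(2) by (auto intro: vec.span_base)
        ultimately have "vec.span {\<beta> 0, vderiv \<beta> 0} \<subseteq> vec.span ?U" by (intro vec.span_minimal) auto
        then show False using dB[OF b'(1)] chart_tangent_span[OF \<beta>(1)] \<beta>(2) by simp
      qed
      then obtain a where a: "\<And>x. x \<in> vec.span ?U \<Longrightarrow> fdot a x = 0" "fdot a (vderiv \<beta> 0) = 1"
        using separating_functional[OF vec.subspace_span] by blast
      have aU: "fdot a x = 0" if "x \<in> ?U" for x by (rule a(1)[OF vec.span_base[OF that]])
      have sn: "\<forall>\<^sub>F n in sequentially. s n \<noteq> 0 \<and> fdot a (\<beta> (s n)) * fdot b (g (t n)) = fdot b (\<beta> (s n)) * fdot a (g (t n))"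
      proof (rule eventually_mono[OF s(1)])
        fix n assume n: "s n \<in> ball 0 q \<and> u n = k n *s \<beta> (s n) \<and> k n \<noteq> 0"
        have "s n \<noteq> 0" using bad[of n] n b'(1) \<beta>(2) by (auto simp: bad_def span_singleton_iff)
        then show "s n \<noteq> 0 \<and> fdot a (\<beta> (s n)) * fdot b (g (t n)) = fdot b (\<beta> (s n)) * fdot a (g (t n))"
          using cross[of a b n] aU bW n by auto
      qed
      then have s': "filterlim s (at 0) sequentially"
        using s(2) by (simp add: filterlim_at eventually_conj_iff)
      have quot': "(\<lambda>n. fdot x (\<beta> (s n)) / s n) \<longlonglongrightarrow> fdot x (vderiv \<beta> 0)" if "fdot x (\<beta> 0) = 0" for x
        by (rule limit_quotient[OF fdot_deriv(2)[OF chartD(2)[OF \<beta>(1)] open_ball q0] that s'])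
      have l1: "(\<lambda>n. fdot a (\<beta> (s n)) / s n * (fdot b (g (t n)) / t n)) \<longlonglongrightarrow> fdot a (vderiv \<beta> 0) * fdot b (vderiv g 0)"
        by (intro tendsto_mult quot quot') (use aU bW b'(1) \<beta>(2) in auto)
      have l2: "(\<lambda>n. fdot b (\<beta> (s n)) / s n * (fdot a (g (t n)) / t n)) \<longlonglongrightarrow> fdot b (vderiv \<beta> 0) * fdot a (vderiv g 0)"
        by (intro tendsto_mult quot quot') (use aU bW b'(1) \<beta>(2) in auto)
      have "\<forall>\<^sub>F n in sequentially. fdot a (\<beta> (s n)) / s n * (fdot b (g (t n)) / t n) = fdot b (\<beta> (s n)) / s n * (fdot a (g (t n)) / t n)"
        by (rule eventually_mono[OF sn]) simp
      from LIMSEQ_unique[OF l1[unfolded tendsto_cong[OF this]] l2]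
      have "fdot a (vderiv \<beta> 0) * fdot b (vderiv g 0) = fdot b (vderiv \<beta> 0) * fdot a (vderiv g 0)" .
      then show False using a b aU by simp
    qed
  qed
qed

text \<open>The tangency moves from \<open>g 0\<close> to a nearby general \<open>g t\<close>, and
  \<open>g 0\<close> joins the simple points. The bound \<open>card B + 4\<close> pays for a free
  3-jet modulo \<open>?W\<close>, and for a free 2-jet modulo \<open>?W\<close> with one extra
  vector.\<close>

lemma tangent_config_step:
  assumes T: "tangent_config g r B" and card: "card B + 4 \<le> CARD('n)"
  shows "\<exists>g' r' B'. tangent_config g' r' B' \<and> card B' = card B + 1"
proof -
  let ?W = "insert (g 0) B" and ?U = "insert (vderiv g 0) (insert (g 0) B)"
  have g: "chart C g r" and B: "finite B" "B \<subseteq> smooth_cone C" and indB: "vec.independent B" "g 0 \<notin> vec.span B"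
    and d1: "vderiv g 0 \<notin> vec.span ?W"
    and dB: "\<And>b. b \<in> B \<Longrightarrow> \<not> tangent_space C (point_of b) \<subseteq> vec.span ?U"
    using T unfolding tangent_config_def by blast+
  note r0 = chart_zero_in[OF g]
  have dimW: "vec.dim ?W \<le> card B + 1"
    using dim_le_card_finite[of ?W] B(1) by (simp add: card_insert_if split: if_splits)
  \<comment> \<open>For each future simple point, a tangent vector outside \<open>?W\<close>.
    Keeping it outside the new span keeps the intersection there transversal.\<close>
  have "\<exists>w. w \<in> tangent_space C (point_of b) \<and> w \<notin> vec.span ?W" if b: "b \<in> ?W" for b
  proof (cases "b = g 0")
    case True
    then show ?thesis using d1 chart_tangent(1)[OF g r0] by blast
  next
    case False
    then obtain w where "w \<in> tangent_space C (point_of b)" "w \<notin> vec.span ?U" using dB b by blast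
    then show ?thesis using vec.span_mono[of ?W ?U] by blast
  qed
  then obtain w where w: "\<And>b. b \<in> ?W \<Longrightarrow> w b \<in> tangent_space C (point_of b) \<and> w b \<notin> vec.span ?W"
    by metis
  have "\<forall>\<^sub>F t in at 0. \<forall>b\<in>?W. jet2_free g t (insert (w b) ?W)"
  proof (subst eventually_ball_finite_distrib)
    show "finite ?W" using B(1) by simp
    show "\<forall>b\<in>?W. \<forall>\<^sub>F t in at 0. jet2_free g t (insert (w b) ?W)"
    proof
      fix b assume "b \<in> ?W"
      have "vec.dim (insert (w b) ?W) + 2 \<le> CARD('n)" using dim_insert_le[of "w b" ?W] dimW card by linarith
      then show "\<forall>\<^sub>F t in at 0. jet2_free g t (insert (w b) ?W)"
        by (rule generic2[OF g])
    qed
  qed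
  moreover have "\<forall>\<^sub>F t in at 0. jet3_free g t ?W"
    by (rule generic3[OF g]) (use dimW card in simp)
  moreover have "\<forall>\<^sub>F t in at 0. \<forall>v\<in>smooth_cone C. v \<in> vec.span (insert (g t) ?W) \<longrightarrow>
    v \<in> vec.span {g t} \<or> v \<in> vec.span {g 0} \<or> (\<exists>b\<in>B. v \<in> vec.span {b})"
    by (rule nearby_span_meets_curve[OF T]) (use card in simp)
  moreover have "\<forall>\<^sub>F t in at (0::complex). t \<in> ball 0 r" by (rule eventually_in_ball[OF chartD(1)[OF g]])
  ultimately have "\<forall>\<^sub>F t in at 0. t \<in> ball 0 r \<and>
     (\<forall>v\<in>smooth_cone C. v \<in> vec.span (insert (g t) ?W) \<longrightarrow>
        v \<in> vec.span {g t} \<or> v \<in> vec.span {g 0} \<or> (\<exists>b\<in>B. v \<in> vec.span {b})) \<and>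
     (jet3_free g t ?W) \<and>
     (\<forall>b\<in>?W. jet2_free g t (insert (w b) ?W))"
    by (simp only: eventually_conj_iff)
  from eventually_at_zeroD[OF this]
  obtain t where t: "t \<in> ball 0 r"
    and meet: "\<And>v. v \<in> smooth_cone C \<Longrightarrow> v \<in> vec.span (insert (g t) ?W) \<Longrightarrow>
        v \<in> vec.span {g t} \<or> v \<in> vec.span {g 0} \<or> (\<exists>b\<in>B. v \<in> vec.span {b})"
    and i3: "\<And>x y z. x *s g t + y *s vderiv g t + z *s vderiv (vderiv g) t \<in> vec.span ?W \<Longrightarrow> x = 0 \<and> y = 0 \<and> z = 0"
    and i2: "\<And>b x y. b \<in> ?W \<Longrightarrow> x *s g t + y *s vderiv g t \<in> vec.span (insert (w b) ?W) \<Longrightarrow> x = 0 \<and> y = 0"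
    unfolding jet2_free_def jet3_free_def by blast
  obtain s where s: "chart C (\<lambda>z. g (t + z)) s" using chart_shift[OF g t] by blast
  have n0: "g t \<notin> vec.span ?W" using i3[of 1 0 0] by auto
  have n1: "vderiv g t \<notin> vec.span (insert (g t) ?W)"
  proof
    assume "vderiv g t \<in> vec.span (insert (g t) ?W)"
    then obtain x where "vderiv g t - x *s g t \<in> vec.span ?W" by (auto simp: vec.span_insert)
    then show False using i3[of "- x" 1 0] by (simp add: add.commute)
  qed
  have n2: "vderiv (vderiv g) t \<notin> vec.span (insert (vderiv g t) (insert (g t) ?W))"
  proof
    assume "vderiv (vderiv g) t \<in> vec.span (insert (vderiv g t) (insert (g t) ?W))"
    then obtain y x where "vderiv (vderiv g) t - y *s vderiv g t - x *s g t \<in> vec.span ?W"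
      by (auto simp: vec.span_insert)
    moreover have "vderiv (vderiv g) t - y *s vderiv g t - x *s g t = (- x) *s g t + (- y) *s vderiv g t + 1 *s vderiv (vderiv g) t"
      by simp
    ultimately show False using i3[of "- x" "- y" 1] by simp
  qed
  have n3: "\<not> tangent_space C (point_of b) \<subseteq> vec.span (insert (vderiv g t) (insert (g t) ?W))" if b: "b \<in> ?W" for b
  proof
    assume "tangent_space C (point_of b) \<subseteq> vec.span (insert (vderiv g t) (insert (g t) ?W))"
    then have "w b \<in> vec.span (insert (vderiv g t) (insert (g t) ?W))" using w[OF b] by blast
    then obtain y x where xy: "w b - y *s vderiv g t - x *s g t \<in> vec.span ?W"
      by (auto simp: vec.span_insert)
    let ?d = "w b - y *s vderiv g t - x *s g t"
    have "?d \<in> vec.span (insert (w b) ?W)"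
      using xy vec.span_mono[of ?W "insert (w b) ?W"] by blast
    from vec.span_diff[OF vec.span_base[OF insertI1] this]
    have "w b - ?d \<in> vec.span (insert (w b) ?W)" .
    \<comment> \<open>Freeness of the 2-jet modulo \<open>w b\<close> and \<open>?W\<close> makes
      \<open>x\<close> and \<open>y\<close> vanish, which would put \<open>w b\<close> into the span
      of \<open>?W\<close>.\<close>
    then have "x *s g t + y *s vderiv g t \<in> vec.span (insert (w b) ?W)" by (simp add: algebra_simps)
    then have "x = 0" "y = 0" using i2[OF b] by blast+
    then show False using xy w[OF b] by simp
  qed
  have "g 0 \<notin> B" using indB(2) vec.span_base by blast
  moreover have "tangent_config (\<lambda>z. g (t + z)) s ?W"
    unfolding tangent_config_def vderiv_shift using s B indB n0 n1 n2 n3 meet smooth_cone_chart[OF g r0]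
    by (auto simp: vec.independent_insert)
  ultimately show ?thesis using B(1) by (intro exI conjI) auto
qed

text \<open>Without further points, the condition on meeting the curve is immediate, and it remains
  to choose a point that is not an inflection point.\<close>

lemma tangent_config_base:
  assumes "CARD('n) \<ge> 3" shows "\<exists>g r. tangent_config g r {}"
proof -
  obtain g r where g: "chart C g r" using smooth_cone_nonempty by (auto simp: smooth_cone_def)
  have "\<forall>\<^sub>F t in at 0. jet3_free g t {}"
    by (rule generic3[OF g]) (use assms in simp)
  with eventually_in_ball[OF chartD(1)[OF g]]
  have "\<forall>\<^sub>F t in at 0. t \<in> ball 0 r \<and> (jet3_free g t {})" by (simp only: eventually_conj_iff)
  from eventually_at_zeroD[OF this]
  obtain t where t: "t \<in> ball 0 r"
    and i3: "\<And>x y z. x *s g t + y *s vderiv g t + z *s vderiv (vderiv g) t = 0 \<Longrightarrow> x = 0 \<and> y = 0 \<and> z = 0"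
    by (auto simp: jet3_free_def)
  obtain s where s: "chart C (\<lambda>z. g (t + z)) s" using chart_shift[OF g t] by blast
  have n1: "vderiv g t \<notin> vec.span {g t}"
    using chart_tangent(3)[OF g t] .
  have n2: "vderiv (vderiv g) t \<notin> vec.span {vderiv g t, g t}"
  proof
    assume "vderiv (vderiv g) t \<in> vec.span {vderiv g t, g t}"
    then obtain y x where "vderiv (vderiv g) t = y *s vderiv g t + x *s g t" unfolding span_pair by blast
    then show False using i3[of "- x" "- y" 1] by simp
  qed
  have "tangent_config (\<lambda>z. g (t + z)) s {}"
    unfolding tangent_config_def vderiv_shift using s n1 n2 chartD(4)[OF g t] by (auto simp: vec.independent_empty)
  then show ?thesis by blast
qed

lemma tangent_config_exists:
  assumes "k + 3 \<le> CARD('n)" shows "\<exists>g r B. tangent_config g r B \<and> card B = k"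
  using assms
proof (induction k)
  case 0
  then show ?case using tangent_config_base by fastforce
next
  case (Suc k)
  then obtain g r B where "tangent_config g r B" "card B = k" by auto
  then show ?case using tangent_config_step[of g r B] Suc.prems by auto
qed

end

section \<open>Quadrics through the curve\<close>

text \<open>Gaussian elimination over arbitrary index types, because the conditions on the quadrics
  will be indexed by points and orders of vanishing.\<close>

lemma nontrivial_solution:
  fixes a :: "'i \<Rightarrow> 'j \<Rightarrow> complex"
  assumes "finite I" "finite J" "card I < card J"
  shows "\<exists>c. (\<exists>j\<in>J. c j \<noteq> 0) \<and> (\<forall>i\<in>I. (\<Sum>j\<in>J. a i j * c j) = 0)"
  using assms
proof (induction I arbitrary: J a rule: finite_induct)
  case empty
  then show ?case by (intro exI[of _ "\<lambda>_. 1"]) (auto simp: card_gt_0_iff)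
next
  case (insert i0 I)
  show ?case
  proof (cases "\<forall>j\<in>J. a i0 j = 0")
    case True
    obtain c where "\<exists>j\<in>J. c j \<noteq> 0" "\<forall>i\<in>I. (\<Sum>j\<in>J. a i j * c j) = 0"
      using insert.IH[of J a] insert.prems insert.hyps by auto
    then show ?thesis using True by (intro exI[of _ c]) auto
  next
    case False
    then obtain j0 where j0: "j0 \<in> J" "a i0 j0 \<noteq> 0" by blast
    let ?J = "J - {j0}"
    \<comment> \<open>The equation \<open>i0\<close> is solved for the unknown \<open>j0\<close> and
      substituted into the others.\<close>
    define a' where "a' i j = a i j - a i j0 * a i0 j / a i0 j0" for i j
    have fin: "finite ?J" using insert.prems by simp
    have cj: "card I < card ?J" using insert.prems insert.hyps j0(1) by simp
    obtain c where c: "\<exists>j\<in>?J. c j \<noteq> 0" "\<forall>i\<in>I. (\<Sum>j\<in>?J. a' i j * c j) = 0"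
      using insert.IH[OF fin cj, of a'] by blast
    define s where "s = (\<Sum>j\<in>?J. a i0 j * c j)"
    define c' where "c' = c(j0 := - s / a i0 j0)"
    have sum: "(\<Sum>j\<in>J. a i j * c' j) = - a i j0 * s / a i0 j0 + (\<Sum>j\<in>?J. a i j * c j)" for i
    proof -
      have "(\<Sum>j\<in>J. a i j * c' j) = a i j0 * c' j0 + (\<Sum>j\<in>?J. a i j * c' j)"
        using insert.prems j0(1) by (intro sum.remove) auto
      also have "(\<Sum>j\<in>?J. a i j * c' j) = (\<Sum>j\<in>?J. a i j * c j)"
        by (rule sum.cong) (auto simp: c'_def)
      finally show ?thesis by (simp add: c'_def)
    qed
    have "(\<Sum>j\<in>J. a i j * c' j) = 0" if i: "i \<in> insert i0 I" for i
    proof (cases "i = i0")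
      case True
      then show ?thesis using j0(2) by (simp add: sum s_def[symmetric])
    next
      case False
      then have "0 = (\<Sum>j\<in>?J. a' i j * c j)" using c(2) i by auto
      also have "\<dots> = (\<Sum>j\<in>?J. a i j * c j - a i j0 / a i0 j0 * (a i0 j * c j))"
        by (rule sum.cong) (auto simp: a'_def algebra_simps)
      also have "\<dots> = (\<Sum>j\<in>?J. a i j * c j) - a i j0 / a i0 j0 * s"
        by (simp only: s_def sum_subtractf sum_distrib_left)
      finally show ?thesis by (simp add: sum)
    qed
    moreover have "\<exists>j\<in>J. c' j \<noteq> 0" using c(1) by (auto simp: c'_def)
    ultimately show ?thesis by blast
  qed
qed

lemma divz_sum:
  assumes "\<And>j. j \<in> J \<Longrightarrow> f j holomorphic_on ball 0 r" "r > 0"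
  shows "divz (\<lambda>z. \<Sum>j\<in>J. c j * f j z) = (\<lambda>z. \<Sum>j\<in>J. c j * divz (f j) z)"
proof
  fix z
  have "((\<lambda>z. \<Sum>j\<in>J. c j * f j z) has_field_derivative (\<Sum>j\<in>J. c j * deriv (f j) 0)) (at 0)"
    by (intro DERIV_sum DERIV_cmult holomorphic_derivI[OF assms(1) open_ball]) (use assms(2) in auto)
  then have "deriv (\<lambda>z. \<Sum>j\<in>J. c j * f j z) 0 = (\<Sum>j\<in>J. c j * deriv (f j) 0)"
    by (rule DERIV_imp_deriv)
  then show "divz (\<lambda>z. \<Sum>j\<in>J. c j * f j z) z = (\<Sum>j\<in>J. c j * divz (f j) z)"
    by (auto simp: divz_def sum_subtractf[symmetric] sum_divide_distrib algebra_simps intro!: sum.cong)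
qed

lemma divz_pow_holomorphic: "f holomorphic_on ball 0 r \<Longrightarrow> (divz ^^ k) f holomorphic_on ball 0 r"
  by (induction k) (auto intro: divz_holomorphic)

lemma divz_pow_sum:
  assumes "\<And>j. j \<in> J \<Longrightarrow> f j holomorphic_on ball 0 r" "r > 0"
  shows "(divz ^^ k) (\<lambda>z. \<Sum>j\<in>J. c j * f j z) = (\<lambda>z. \<Sum>j\<in>J. c j * (divz ^^ k) (f j) z)"
proof (induction k)
  case (Suc k)
  show ?case
    using divz_sum[of J "\<lambda>j. (divz ^^ k) (f j)" r c] divz_pow_holomorphic assms by (simp add: Suc)
qed simp

lemma divz_pow_eq: "(\<And>k. k < N \<Longrightarrow> (divz ^^ k) f 0 = 0) \<Longrightarrow> f z = z ^ N * (divz ^^ N) f z"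
proof (induction N)
  case (Suc N)
  then have "f z = z ^ N * (divz ^^ N) f z" by simp
  also have "(divz ^^ N) f z = z * (divz ^^ Suc N) f z"
    using divz_eq[of "(divz ^^ N) f" z] Suc.prems[of N] by simp
  finally show ?case by simp
qed simp

context smooth_curve
begin

text \<open>
  The rational function \<open>q / h\<^sup>2\<close> is regular at every smooth point, so it attains the maximum of its modulus.
\<close>
lemma regular_quotient_constant:
  assumes q: "form 2 q" and h: "h \<noteq> 0"
    and loc: "\<And>v. v \<in> smooth_cone C \<Longrightarrow> \<exists>\<delta> s m A D. chart C \<delta> s \<and> \<delta> 0 = v \<and>
      A holomorphic_on ball 0 s \<and> D holomorphic_on ball 0 s \<and> A 0 \<noteq> 0 \<and>
      (\<forall>t\<in>ball 0 s. fdot h (\<delta> t) = t ^ m * A t \<and> q (\<delta> t) = t ^ (2 * m) * D t)"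
  shows "\<exists>\<kappa>. \<forall>v\<in>affine_cone C. q v = \<kappa> * fdot h v ^ 2"
proof -
  define f where "f v = q v / fdot h v ^ 2" for v
  \<comment> \<open>\<open>K\<close> need not be compact, as \<open>h\<close> may vanish at a limit
    of its vectors. The form of \<open>q\<close> and \<open>h\<close> in a chart there takes
    over.\<close>
  define K where "K = {v \<in> smooth_cone C. norm v = 1 \<and> fdot h v \<noteq> 0}"
  have fscale: "f (c *s v) = f v" if "c \<noteq> 0" for c v
    using that form_scaled_arg[OF q, of c v] by (simp add: f_def power_mult_distrib)
  have normalize: "\<exists>w\<in>K. f w = f v" if v: "v \<in> smooth_cone C" "fdot h v \<noteq> 0" for v
  proof -
    have "v \<noteq> 0" using v(2) by auto
    let ?c = "complex_of_real (1 / norm v)"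
    have c: "?c \<noteq> 0" using \<open>v \<noteq> 0\<close> by simp
    have "?c *s v \<in> K" using smooth_cone_scale[OF v(1) c] unit_scale[OF \<open>v \<noteq> 0\<close>] v(2) c by (simp add: K_def)
    then show ?thesis using fscale[OF c] by blast
  qed
  \<comment> \<open>Used twice: with values tending to infinity it shows boundedness, and with
    values tending to the supremum it shows that the supremum is attained by a holomorphic
    extension.\<close>
  have local_limit: "\<exists>\<delta> s e F \<tau>. chart C \<delta> s \<and> 0 < e \<and> e \<le> s \<and> F holomorphic_on ball 0 e \<and>
      (\<forall>t\<in>ball 0 e - {0}. fdot h (\<delta> t) \<noteq> 0 \<and> F t = f (\<delta> t)) \<and>
      strict_mono (\<tau> :: nat \<Rightarrow> nat) \<and> (\<lambda>n. f (w (\<tau> n))) \<longlonglongrightarrow> F 0"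
    if w: "\<And>n. w n \<in> K" for w
  proof -
    have "\<forall>n. w n \<in> sphere 0 1" using w by (simp add: K_def)
    then obtain v and \<tau> :: "nat \<Rightarrow> nat" where v: "v \<in> sphere 0 1" "strict_mono \<tau>" "(w \<circ> \<tau>) \<longlonglongrightarrow> v"
      using compact_sphere[of 0 1, unfolded compact_def] by blast
    have vC: "v \<in> smooth_cone C"
      by (rule smooth_cone_closed[OF _ v(3)]) (use w v(1) in \<open>auto simp: K_def\<close>)
    obtain \<delta> s m A D where d: "chart C \<delta> s" "\<delta> 0 = v" "A holomorphic_on ball 0 s" "D holomorphic_on ball 0 s"
      "A 0 \<noteq> 0" "\<And>t. t \<in> ball 0 s \<Longrightarrow> fdot h (\<delta> t) = t ^ m * A t"
      "\<And>t. t \<in> ball 0 s \<Longrightarrow> q (\<delta> t) = t ^ (2 * m) * D t"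
      using loc[OF vC] by blast
    note s0 = chart_zero_in[OF d(1)]
    have "open (ball 0 s \<inter> A -` (- {0}))"
      by (intro continuous_open_preimage holomorphic_on_imp_continuous_on d(3)) auto
    then obtain e1 where e1: "e1 > 0" "ball 0 e1 \<subseteq> ball 0 s \<inter> A -` (- {0})"
      using s0 d(5) by (metis (no_types, lifting) ComplI IntI open_contains_ball singletonD vimageI)
    define e where "e = min e1 s"
    have e: "0 < e" "e \<le> s" using e1(1) chartD(1)[OF d(1)] by (auto simp: e_def)
    have A: "A t \<noteq> 0" "t \<in> ball 0 s" if "t \<in> ball 0 e" for t
      using e1(2) that by (auto simp: e_def subset_iff)
    \<comment> \<open>The factors \<open>t ^ (2 * m)\<close> of \<open>q\<close> and of the square
      of \<open>h\<close> cancel, so this extends the quotient across the zero of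
      \<open>h\<close>.\<close>
    define F where "F t = D t / A t ^ 2" for t
    have F: "F holomorphic_on ball 0 e"
      unfolding F_def using A e(2)
      by (intro holomorphic_intros holomorphic_on_subset[OF d(3)] holomorphic_on_subset[OF d(4)]) auto
    have Fe: "F t = f (\<delta> t)" if "t \<in> ball 0 e" "fdot h (\<delta> t) \<noteq> 0" for t
    proof -
      have p: "t ^ m \<noteq> 0" using that A(2) d(6) by auto
      have "q (\<delta> t) = (t ^ m) ^ 2 * D t"
        using d(7)[OF A(2)[OF that(1)]] by (simp add: power_mult[symmetric] mult.commute)
      moreover have "fdot h (\<delta> t) ^ 2 = (t ^ m) ^ 2 * A t ^ 2"
        using d(6)[OF A(2)[OF that(1)]] by (simp only: power_mult_distrib)
      moreover have "(t ^ m) ^ 2 \<noteq> 0" by (rule power_not_zero[OF p])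
      ultimately show ?thesis unfolding F_def f_def by (simp only: mult_divide_mult_cancel_left not_False_eq_True)
    qed
    have Ff: "fdot h (\<delta> t) \<noteq> 0 \<and> F t = f (\<delta> t)" if "t \<in> ball 0 e - {0}" for t
    proof -
      have "fdot h (\<delta> t) \<noteq> 0" using A[of t] d(6)[of t] that by auto
      then show ?thesis using Fe that by blast
    qed
    have wC: "(w \<circ> \<tau>) n \<in> affine_cone C" for n using w[of "\<tau> n"] smooth_cone_subset by (auto simp: K_def)
    have v1: "(w \<circ> \<tau>) \<longlonglongrightarrow> 1 *s \<delta> 0" using v(3) d(2) by simp
    obtain \<sigma> k where sg: "\<forall>\<^sub>F n in sequentially. \<sigma> n \<in> ball 0 s \<and> (w \<circ> \<tau>) n = k n *s \<delta> (\<sigma> n) \<and> k n \<noteq> 0" "\<sigma> \<longlonglongrightarrow> 0"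
      by (rule chart_sequence[OF d(1) wC v1]) auto
    have "\<forall>\<^sub>F n in sequentially. \<sigma> n \<in> ball 0 e"
      using topological_tendstoD[OF sg(2) open_ball, of 0 e] e(1) by auto
    with sg(1) have ev: "\<forall>\<^sub>F n in sequentially. F (\<sigma> n) = f (w (\<tau> n))"
    proof (rule eventually_elim2)
      fix n assume n: "\<sigma> n \<in> ball 0 s \<and> (w \<circ> \<tau>) n = k n *s \<delta> (\<sigma> n) \<and> k n \<noteq> 0" "\<sigma> n \<in> ball 0 e"
      then have "fdot h (\<delta> (\<sigma> n)) \<noteq> 0" using w[of "\<tau> n"] by (auto simp: K_def)
      moreover have "f (w (\<tau> n)) = f (\<delta> (\<sigma> n))" using n fscale by simp
      ultimately show "F (\<sigma> n) = f (w (\<tau> n))" using Fe[OF n(2)] by simp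
    qed
    have "isCont F 0"
      using F e(1) by (meson centre_in_ball continuous_on_eq_continuous_at holomorphic_on_imp_continuous_on open_ball)
    then have "(\<lambda>n. F (\<sigma> n)) \<longlonglongrightarrow> F 0" using sg(2) by (rule isCont_tendsto_compose)
    then have "(\<lambda>n. f (w (\<tau> n))) \<longlonglongrightarrow> F 0" unfolding tendsto_cong[OF ev] .
    then show ?thesis
      using d(1) e F Ff v(2)
      by (intro exI[of _ \<delta>] exI[of _ s] exI[of _ e] exI[of _ F] exI[of _ \<tau>] conjI ballI) auto
  qed
  obtain g r where g: "chart C g r" using smooth_cone_nonempty by (auto simp: smooth_cone_def)
  obtain t0 where "t0 \<in> ball 0 r" "fdot h (g t0) \<noteq> 0" using linear_vanish_chart[OF g, of h] h by blast
  then obtain w0 where w0: "w0 \<in> K" using normalize smooth_cone_chart[OF g] by blast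
  let ?A = "(\<lambda>w. norm (f w)) ` K"
  have bdd: "bdd_above ?A"
  proof (rule ccontr)
    assume nb: "\<not> bdd_above ?A"
    have "\<exists>w\<in>K. norm (f w) > real n" for n
    proof (rule ccontr)
      assume "\<not> (\<exists>w\<in>K. norm (f w) > real n)"
      then have "bdd_above ?A" by (intro bdd_aboveI[of _ "real n"]) (auto simp: not_less)
      then show False using nb by blast
    qed
    then obtain w where w: "\<And>n. w n \<in> K" "\<And>n. norm (f (w n)) > real n" by metis
    obtain F :: "complex \<Rightarrow> complex" and \<tau> :: "nat \<Rightarrow> nat"
      where F: "strict_mono \<tau>" "(\<lambda>n. f (w (\<tau> n))) \<longlonglongrightarrow> F 0"
      using local_limit[of w, OF w(1)] by blast
    then have "Bseq (\<lambda>n. f (w (\<tau> n)))" using convergentI convergent_imp_Bseq by blast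
    then obtain M where M: "\<And>n. norm (f (w (\<tau> n))) \<le> M" by (auto simp: Bseq_def)
    obtain n where "real n > M" using reals_Archimedean2 by blast
    moreover have "real n \<le> real (\<tau> n)" using F(1) seq_suble by simp
    ultimately show False using w(2)[of "\<tau> n"] M[of n] by linarith
  qed
  define S where "S = Sup ?A"
  have S: "norm (f w) \<le> S" if "w \<in> K" for w
    unfolding S_def using bdd that by (intro cSup_upper) auto
  have "\<exists>w\<in>K. norm (f w) > S - 1 / real (Suc n)" for n
    using less_cSup_iff[OF _ bdd, of "S - 1 / real (Suc n)"] w0 by (auto simp: S_def)
  then obtain w where w: "\<And>n. w n \<in> K" "\<And>n. norm (f (w n)) > S - 1 / real (Suc n)" by metis
  obtain \<delta> s e F and \<tau> :: "nat \<Rightarrow> nat" where F: "chart C \<delta> s" "0 < e" "e \<le> s" "F holomorphic_on ball 0 e"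
      "\<forall>t\<in>ball 0 e - {0}. fdot h (\<delta> t) \<noteq> 0 \<and> F t = f (\<delta> t)"
      "strict_mono \<tau>" "(\<lambda>n. f (w (\<tau> n))) \<longlonglongrightarrow> F 0"
    using local_limit[of w, OF w(1)] by blast
  have "(\<lambda>n. S - inverse (real (Suc n))) \<longlonglongrightarrow> S - 0"
    by (intro tendsto_intros LIMSEQ_inverse_real_of_nat)
  from LIMSEQ_subseq_LIMSEQ[OF this F(6)]
  have lS: "(\<lambda>n. S - inverse (real (Suc (\<tau> n)))) \<longlonglongrightarrow> S" by (simp add: o_def)
  have SF: "S \<le> norm (F 0)"
    by (rule LIMSEQ_le[OF lS tendsto_norm[OF F(7)]])
      (use w(2) in \<open>auto simp: inverse_eq_divide less_imp_le\<close>)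
  \<comment> \<open>For \<open>t\<close> other than 0 the value \<open>F t\<close> is taken by
    \<open>f\<close> on \<open>K\<close>, so its norm is at most \<open>S\<close>, hence at most
    that of \<open>F 0\<close>: an interior maximum.\<close>
  have "F constant_on ball 0 e"
  proof (rule maximum_modulus_principle[OF F(4) open_ball connected_ball open_ball subset_refl])
    show "(0::complex) \<in> ball 0 e" using F(2) by simp
    fix t :: complex assume t: "t \<in> ball 0 e"
    show "norm (F t) \<le> norm (F 0)"
    proof (cases "t = 0")
      case False
      then have ft: "fdot h (\<delta> t) \<noteq> 0" "F t = f (\<delta> t)" using F(5) t by auto
      have "t \<in> ball 0 s" using t F(3) by auto
      then obtain u where "u \<in> K" "f u = f (\<delta> t)" using normalize[OF smooth_cone_chart[OF F(1)] ft(1)] by blast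
      then show ?thesis using S[of u] SF ft(2) by simp
    qed simp
  qed
  then obtain \<kappa> where k: "\<And>t. t \<in> ball 0 e \<Longrightarrow> F t = \<kappa>" by (auto simp: constant_on_def)
  \<comment> \<open>Clearing the denominator turns constancy of the quotient into vanishing of a
    quadratic form on the arc, which density extends to the cone.\<close>
  let ?q = "\<lambda>v. q v + (- \<kappa>) * (fdot h v * fdot h v)"
  have q': "form 2 ?q"
    using form_mult[OF form_fdot[of h] form_fdot[of h]]
    by (intro form_add q form_scale) (simp add: numeral_2_eq_2)
  have z: "?q (\<delta> t) = 0" if t: "t \<in> ball 0 e - {0}" for t
    using F(5) k t by (auto simp: f_def power2_eq_square field_simps)
  have "?q (\<delta> t) = 0" if "t \<in> ball 0 s" for t
  proof (rule analytic_continuation_open[of "ball 0 e - {0}" "ball 0 s" "\<lambda>t. ?q (\<delta> t)" "\<lambda>_. 0"])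
    have "complex_of_real (e / 2) \<in> ball 0 e - {0}" using F(2) by auto
    then show "ball (0::complex) e - {0} \<noteq> {}" by blast
    show "(\<lambda>t. ?q (\<delta> t)) holomorphic_on ball 0 s" by (rule form_holomorphic[OF q' chartD(2)[OF F(1)]])
  qed (use F(3) z that in \<open>auto intro: open_delete\<close>)
  then have "?q v = 0" if "v \<in> affine_cone C" for v
    by (rule dense[OF F(1) q' _ that])
  then show ?thesis by (intro exI[of _ \<kappa>]) (auto simp: power2_eq_square)
qed

end

section \<open>Counting conditions on quadrics\<close>

context tangent_rank_curve
begin

text \<open>
  Let \<open>h\<close> cut out the hyperplane spanned by the tangent line at \<open>g 0\<close> and by the points of \<open>B\<close>.
  For a quadratic form \<open>q\<close>, regularity of \<open>q / h\<^sup>2\<close> on the curve amounts to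
  \<open>4 + 2 * card B\<close> linear conditions on \<open>q\<close>, and one more condition makes that constant quotient zero.
\<close>
lemma quadric_relation:
  fixes Q :: "'j \<Rightarrow> complex ^ 'n \<Rightarrow> complex"
  assumes n: "CARD('n) \<ge> 3" and J: "finite J" "2 * CARD('n) \<le> card J" and Q: "\<And>j. j \<in> J \<Longrightarrow> form 2 (Q j)"
  obtains c where "\<exists>j\<in>J. c j \<noteq> 0" "\<And>v. v \<in> affine_cone C \<Longrightarrow> (\<Sum>j\<in>J. c j * Q j v) = 0"
proof -
  obtain g r B where T: "tangent_config g r B" and cB: "card B + 3 = CARD('n)"
    using tangent_config_exists[of "CARD('n) - 3"] n by auto
  let ?W = "insert (g 0) B" and ?U = "insert (vderiv g 0) (insert (g 0) B)"
  have g: "chart C g r" and B: "finite B" "B \<subseteq> smooth_cone C" and indB: "vec.independent B" "g 0 \<notin> vec.span B"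
    and meet: "\<And>v. v \<in> smooth_cone C \<Longrightarrow> v \<in> vec.span ?W \<Longrightarrow> v \<in> vec.span {g 0} \<or> (\<exists>b\<in>B. v \<in> vec.span {b})"
    and d1: "vderiv g 0 \<notin> vec.span ?W" and d2: "vderiv (vderiv g) 0 \<notin> vec.span ?U"
    and dB: "\<And>b. b \<in> B \<Longrightarrow> \<not> tangent_space C (point_of b) \<subseteq> vec.span ?U"
    using T unfolding tangent_config_def by blast+
  note hol = chartD(2)[OF g] and r0 = chart_zero_in[OF g] and rpos = chartD(1)[OF g]
  obtain h where h: "\<And>x. x \<in> vec.span ?U \<Longrightarrow> fdot h x = 0" "fdot h (vderiv (vderiv g) 0) = 1"
    using separating_functional[OF vec.subspace_span d2] by blast
  have hU: "fdot h x = 0" if "x \<in> ?U" for x by (rule h(1)[OF vec.span_base[OF that]])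
  have notin: "g 0 \<notin> B" "vderiv g 0 \<notin> ?W" "vderiv (vderiv g) 0 \<notin> ?U"
    using indB(2) d1 d2 vec.span_base[of "g 0" B] vec.span_base[of "vderiv g 0" ?W]
      vec.span_base[of "vderiv (vderiv g) 0" ?U] by metis+
  let ?E = "insert (vderiv (vderiv g) 0) ?U"
  have indE: "vec.independent ?E"
    using indB d1 d2 notin by (simp add: vec.independent_insert)
  have "card ?E = CARD('n)" using notin B(1) cB by simp
  then have "vec.dim (UNIV :: (complex ^ 'n) set) \<le> card ?E" by (simp only: vec_dim_card)
  then have span_E: "vec.span ?E = UNIV"
    using vec.card_ge_dim_independent[OF subset_UNIV indE] by blast
  \<comment> \<open>\<open>?U\<close> together with the second derivative is a basis, so the kernel
    of \<open>h\<close> is the span of \<open>?U\<close>, and zeros of \<open>h\<close> on the curve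
    are governed by \<open>tangent_span_meets_curve\<close>.\<close>
  have ker: "v \<in> vec.span ?U" if "fdot h v = 0" for v
  proof -
    have "v \<in> vec.span ?E" using span_E by simp
    then obtain x where x: "v - x *s vderiv (vderiv g) 0 \<in> vec.span ?U" unfolding vec.span_insert[of _ ?U] by blast
    have "fdot h (v - x *s vderiv (vderiv g) 0) = 0" by (rule h(1)[OF x])
    then have "x = 0" using that h(2) by simp
    then show ?thesis using x by simp
  qed
  have zeros: "v \<in> vec.span {g 0} \<or> (\<exists>b\<in>B. v \<in> vec.span {b})" if v: "v \<in> smooth_cone C" "fdot h v = 0" for v
    using meet[OF v(1)] tangent_span_meets_curve[OF g B _ _ ker[OF v(2)]] cB v(1) smooth_cone_subset by auto
  have "\<exists>\<beta> s. chart C \<beta> s \<and> \<beta> 0 = b" if "b \<in> B" for b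
    using that B(2) by (auto simp: smooth_cone_def)
  then obtain \<beta> s where \<beta>: "\<And>b. b \<in> B \<Longrightarrow> chart C (\<beta> b) (s b) \<and> \<beta> b 0 = b" by metis
  have h_b: "fdot h (vderiv (\<beta> b) 0) \<noteq> 0" if b: "b \<in> B" for b
  proof
    assume "fdot h (vderiv (\<beta> b) 0) = 0"
    then have "vderiv (\<beta> b) 0 \<in> vec.span ?U" by (rule ker)
    moreover have "b \<in> vec.span ?U" using b by (auto intro: vec.span_base)
    ultimately have "vec.span {b, vderiv (\<beta> b) 0} \<subseteq> vec.span ?U" by (intro vec.span_minimal) auto
    then show False using dB[OF b] chart_tangent_span[of "\<beta> b" "s b"] \<beta>[OF b] by simp
  qed
  obtain t1 where t1: "t1 \<in> ball 0 r" "fdot h (g t1) \<noteq> 0"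
    using linear_vanish_chart[OF g, of h] h(2) by fastforce
  define \<Gamma> where "\<Gamma> p = (if p = g 0 then g else \<beta> p)" for p
  define \<rho> where "\<rho> p = (if p = g 0 then r else s p)" for p
  \<comment> \<open>Rows of the linear system: \<open>Some (p, k)\<close> is the \<open>k\<close>-th
    Taylor coefficient in the chart at \<open>p\<close>, and \<open>None\<close> is the value at
    \<open>g t1\<close>, where \<open>h\<close> is nonzero.\<close>
  define a where "a i j = (case i of None \<Rightarrow> Q j (g t1) | Some (p, k) \<Rightarrow> (divz ^^ k) (\<lambda>t. Q j (\<Gamma> p t)) 0)" for i j
  \<comment> \<open>The square of \<open>h\<close> vanishes to order 4 at \<open>g 0\<close> and to
    order 2 on \<open>B\<close>. With \<open>card B = CARD('n) - 3\<close> there are at most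
    \<open>2 * CARD('n) - 1\<close> rows, one less than the guaranteed number of unknowns.\<close>
  define I where "I = insert None (Some ` ({g 0} \<times> {..<4::nat} \<union> B \<times> {..<2}))"
  have fin: "finite ({g 0} \<times> {..<4::nat} \<union> B \<times> {..<2})" using B(1) by simp
  have "card I \<le> 1 + card ({g 0} \<times> {..<4::nat} \<union> B \<times> {..<2})"
    unfolding I_def using fin card_image_le[OF fin, of Some] card_insert_le_m1
    by (simp add: card_insert_if)
  also have "\<dots> \<le> 1 + (4 + card B * 2)"
    using card_Un_le[of "{g 0} \<times> {..<4::nat}" "B \<times> {..<2}"] by (simp add: card_cartesian_product)
  also have "\<dots> < card J" using J(2) cB by linarith
  finally have "card I < card J" .
  moreover have "finite I" unfolding I_def using fin by simp
  ultimately obtain c where c: "\<exists>j\<in>J. c j \<noteq> 0" "\<forall>i\<in>I. (\<Sum>j\<in>J. a i j * c j) = 0"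
    using nontrivial_solution[of I J a] J(1) by blast
  define q where "q v = (\<Sum>j\<in>J. c j * Q j v)" for v
  have q: "form 2 q" unfolding q_def by (intro form_sum form_scale Q)
  have G: "chart C (\<Gamma> p) (\<rho> p)" "\<Gamma> p 0 = p" if "p \<in> ?W" for p
    using that g \<beta> by (auto simp: \<Gamma>_def \<rho>_def)
  have pow: "(divz ^^ k) (\<lambda>t. q (\<Gamma> p t)) 0 = 0" if "p \<in> ?W" "Some (p, k) \<in> I" for p k
  proof -
    have "(divz ^^ k) (\<lambda>t. q (\<Gamma> p t)) = (\<lambda>t. \<Sum>j\<in>J. c j * (divz ^^ k) (\<lambda>t. Q j (\<Gamma> p t)) t)"
      unfolding q_def
      by (rule divz_pow_sum[OF _ chartD(1)[OF G(1)[OF that(1)]]])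
        (rule form_holomorphic[OF Q chartD(2)[OF G(1)[OF that(1)]]])
    then show ?thesis using c(2) that(2) by (force simp: a_def mult.commute)
  qed
  have qt1: "q (g t1) = 0"
    using c(2) by (auto simp: I_def a_def q_def mult.commute)
  have q4: "q (g t) = t ^ 4 * (divz ^^ 4) (\<lambda>t. q (g t)) t" for t
    by (rule divz_pow_eq) (use pow[of "g 0"] in \<open>auto simp: I_def \<Gamma>_def\<close>)
  have q2: "q (\<beta> b t) = t ^ 2 * (divz ^^ 2) (\<lambda>t. q (\<beta> b t)) t" if b: "b \<in> B" for b t
  proof (rule divz_pow_eq)
    fix k :: nat assume "k < 2"
    moreover have "b \<noteq> g 0" using b notin by blast
    ultimately show "(divz ^^ k) (\<lambda>t. q (\<beta> b t)) 0 = 0"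
      using pow[of b k] b by (auto simp: I_def \<Gamma>_def)
  qed
  have hg: "fdot h (g t) = t ^ 2 * divz (divz (\<lambda>t. fdot h (g t))) t" for t
    using divz_eq[of "\<lambda>t. fdot h (g t)" t] divz_eq[of "divz (\<lambda>t. fdot h (g t))" t] hU fdot_vderiv[OF hol r0]
    by (simp add: power2_eq_square)
  have hg0: "divz (divz (\<lambda>t. fdot h (g t))) 0 \<noteq> 0"
    using deriv_deriv_0[OF fdot_holomorphic[OF hol, of h] rpos] fdot_vderiv(2)[OF hol r0, of h] h(2) by auto
  have hb: "fdot h (\<beta> b t) = t * divz (\<lambda>t. fdot h (\<beta> b t)) t" if b: "b \<in> B" for b t
    using divz_eq[of "\<lambda>t. fdot h (\<beta> b t)" t] hU[of b] \<beta>[OF b] b by simp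
  have hb0: "divz (\<lambda>t. fdot h (\<beta> b t)) 0 \<noteq> 0" if b: "b \<in> B" for b
  proof -
    have ch: "chart C (\<beta> b) (s b)" using \<beta>[OF b] by blast
    show ?thesis using h_b[OF b] fdot_vderiv(1)[OF chartD(2)[OF ch] chart_zero_in[OF ch]] by simp
  qed
  have "\<exists>\<kappa>. \<forall>v\<in>affine_cone C. q v = \<kappa> * fdot h v ^ 2"
  proof (rule regular_quotient_constant[OF q])
    show "h \<noteq> 0" using h(2) by auto
    fix v assume v: "v \<in> smooth_cone C"
    consider "fdot h v \<noteq> 0" | c where "v = c *s g 0" | b c where "b \<in> B" "v = c *s b"
      using zeros[OF v] by (auto simp: span_singleton_iff)
    then show "\<exists>\<delta> s m A D. chart C \<delta> s \<and> \<delta> 0 = v \<and> A holomorphic_on ball 0 s \<and> D holomorphic_on ball 0 s \<and> A 0 \<noteq> 0 \<and>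
      (\<forall>t\<in>ball 0 s. fdot h (\<delta> t) = t ^ m * A t \<and> q (\<delta> t) = t ^ (2 * m) * D t)"
    proof cases
      case 1
      obtain \<delta> s where d: "chart C \<delta> s" "\<delta> 0 = v" using v by (auto simp: smooth_cone_def)
      show ?thesis
        by (rule exI[of _ \<delta>], rule exI[of _ s], rule exI[of _ 0], rule exI[of _ "\<lambda>t. fdot h (\<delta> t)"],
            rule exI[of _ "\<lambda>t. q (\<delta> t)"])
          (use d 1 fdot_holomorphic[OF chartD(2)[OF d(1)]] form_holomorphic[OF q chartD(2)[OF d(1)]] in auto)
    next
      case (2 c)
      have c: "c \<noteq> 0" using 2 v smooth_cone_subset[of C] by (auto simp: affine_cone_def)
      show ?thesis
        by (rule exI[of _ "\<lambda>t. c *s g t"], rule exI[of _ r], rule exI[of _ 2],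
            rule exI[of _ "\<lambda>t. c * divz (divz (\<lambda>t. fdot h (g t))) t"],
            rule exI[of _ "\<lambda>t. c ^ 2 * (divz ^^ 4) (\<lambda>t. q (g t)) t"])
          (use chart_scale[OF g c] 2 c hg0 in \<open>auto simp: form_scaled_arg[OF q] intro!: holomorphic_intros
            divz_holomorphic divz_pow_holomorphic fdot_holomorphic[OF hol] form_holomorphic[OF q hol] hg q4\<close>)
    next
      case (3 b c)
      have c: "c \<noteq> 0" using 3 v smooth_cone_subset[of C] by (auto simp: affine_cone_def)
      have ch: "chart C (\<beta> b) (s b)" "\<beta> b 0 = b" using \<beta>[OF 3(1)] by auto
      note holb = chartD(2)[OF ch(1)]
      show ?thesis
        by (rule exI[of _ "\<lambda>t. c *s \<beta> b t"], rule exI[of _ "s b"], rule exI[of _ 1],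
            rule exI[of _ "\<lambda>t. c * divz (\<lambda>t. fdot h (\<beta> b t)) t"],
            rule exI[of _ "\<lambda>t. c ^ 2 * (divz ^^ 2) (\<lambda>t. q (\<beta> b t)) t"])
          (use chart_scale[OF ch(1) c] ch 3 c hb0[OF 3(1)] in \<open>auto simp: form_scaled_arg[OF q] intro!: holomorphic_intros
            divz_holomorphic divz_pow_holomorphic fdot_holomorphic[OF holb] form_holomorphic[OF q holb] hb q2\<close>)
    qed
  qed
  then obtain \<kappa> where k: "\<And>v. v \<in> affine_cone C \<Longrightarrow> q v = \<kappa> * fdot h v ^ 2" by blast
  have "\<kappa> = 0" using k[OF chartD(3)[OF g t1(1)]] qt1 t1(2) by simp
  then show thesis using that[OF c(1)] k by (simp add: q_def)
qed

end

section \<open>The Veronese parametrization\<close>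

definition ver :: "('n::finite \<Rightarrow> nat) \<Rightarrow> complex \<Rightarrow> complex \<Rightarrow> complex ^ 'n" where
  "ver e s t = (\<chi> i. s ^ (CARD('n) - 1 - e i) * t ^ e i)"

lemma veronese_point_ver: "veronese_point e s t = point_of (ver e s t)"
  by (simp add: veronese_point_def ver_def)

definition numbering :: "('n::finite \<Rightarrow> nat) \<Rightarrow> bool" where
  "numbering e \<longleftrightarrow> bij_betw e UNIV {0..CARD('n) - 1}"

lemma numberingE:
  fixes e :: "'n::finite \<Rightarrow> nat"
  assumes "numbering e"
  obtains d where "\<And>i. d (e i) = i" "\<And>k. k < CARD('n) \<Longrightarrow> e (d k) = k" "\<And>i. e i < CARD('n)" "inj e"
proof -
  have b: "bij_betw e UNIV {..<CARD('n)}"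
    using assms by (simp add: numbering_def lessThan_Suc_atMost[symmetric] atLeast0AtMost)
  show thesis
    by (rule that[of "inv_into UNIV e"])
      (use b in \<open>auto simp: bij_betw_def inv_into_f_f f_inv_into_f\<close>)
qed

lemma numbering_exists: "\<exists>e :: 'n::finite \<Rightarrow> nat. numbering e"
proof -
  have "card {0..CARD('n) - 1} = CARD('n)" using zero_less_card_finite[where 'a = 'n] by simp
  then show ?thesis unfolding numbering_def
    using finite_same_card_bij[of "UNIV :: 'n set" "{0..CARD('n) - 1}"] by auto
qed

lemma ver_scale: "numbering e \<Longrightarrow> ver e (c * s) (c * t) = c ^ (CARD('n) - 1) *s ver (e :: 'n::finite \<Rightarrow> nat) s t"
proof -
  assume "numbering e"
  then have "e i \<le> CARD('n) - 1" for i by (auto simp: numbering_def bij_betw_def)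
  then have "c ^ (CARD('n) - 1) = c ^ (CARD('n) - 1 - e i) * c ^ e i" for i
    by (metis le_add_diff_inverse2 power_add)
  then show ?thesis by (simp add: ver_def vec_eq_iff power_mult_distrib)
qed

lemma ver_nonzero:
  fixes e :: "'n::finite \<Rightarrow> nat"
  assumes "numbering e" "(s, t) \<noteq> (0, 0)" shows "ver e s t \<noteq> 0"
proof -
  obtain d where d: "\<And>k. k < CARD('n) \<Longrightarrow> e (d k) = k" using numberingE[OF assms(1)] by metis
  have "ver e s t $ d 0 = s ^ (CARD('n) - 1)" "ver e s t $ d (CARD('n) - 1) = t ^ (CARD('n) - 1)"
    using d[of 0] d[of "CARD('n) - 1"] by (simp_all add: ver_def)
  then show ?thesis using assms(2) by (metis Pair_inject power_not_zero zero_index prod.inject)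
qed

lemma binary_form_coeffs:
  fixes a b :: "'j \<Rightarrow> complex"
  assumes "finite J"
  shows "\<exists>c. \<forall>s t. (\<Prod>j\<in>J. a j * s + b j * t) = (\<Sum>k\<le>card J. c k * (s ^ (card J - k) * t ^ k))"
  using assms
proof (induction J rule: finite_induct)
  case empty
  then show ?case by (intro exI[of _ "\<lambda>_. 1"]) simp
next
  case (insert x J)
  then obtain c where c: "\<And>s t. (\<Prod>j\<in>J. a j * s + b j * t) = (\<Sum>k\<le>card J. c k * (s ^ (card J - k) * t ^ k))"
    by blast
  let ?m = "card J"
  define c' where "c' k = (if k \<le> ?m then a x * c k else 0) + (if k = 0 then 0 else b x * c (k - 1))" for k
  have "(\<Prod>j\<in>insert x J. a j * s + b j * t) = (\<Sum>k\<le>Suc ?m. c' k * (s ^ (Suc ?m - k) * t ^ k))" for s t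
  proof -
    have 1: "a x * s * (\<Sum>k\<le>?m. c k * (s ^ (?m - k) * t ^ k))
      = (\<Sum>k\<le>Suc ?m. (if k \<le> ?m then a x * c k else 0) * (s ^ (Suc ?m - k) * t ^ k))"
      by (simp add: sum_distrib_left Suc_diff_le mult_ac)
    have 2: "b x * t * (\<Sum>k\<le>?m. c k * (s ^ (?m - k) * t ^ k))
      = (\<Sum>k\<le>Suc ?m. (if k = 0 then 0 else b x * c (k - 1)) * (s ^ (Suc ?m - k) * t ^ k))"
      by (subst sum.atMost_Suc_shift) (simp add: sum_distrib_left mult_ac)
    have "(\<Prod>j\<in>insert x J. a j * s + b j * t) = (a x * s + b x * t) * (\<Sum>k\<le>?m. c k * (s ^ (?m - k) * t ^ k))"
      using insert.hyps c by simp
    also have "\<dots> = (\<Sum>k\<le>Suc ?m. (if k \<le> ?m then a x * c k else 0) * (s ^ (Suc ?m - k) * t ^ k))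
       + (\<Sum>k\<le>Suc ?m. (if k = 0 then 0 else b x * c (k - 1)) * (s ^ (Suc ?m - k) * t ^ k))"
      unfolding distrib_right 1 2 ..
    also have "\<dots> = (\<Sum>k\<le>Suc ?m. c' k * (s ^ (Suc ?m - k) * t ^ k))"
      unfolding c'_def distrib_right sum.distrib ..
    finally show ?thesis .
  qed
  then show ?case using insert.hyps by auto
qed

text \<open>The coordinates of \<open>ver\<close> are all monomials of degree
  \<open>CARD('n) - 1\<close> in \<open>s\<close> and \<open>t\<close>, so each binary form of that
  degree is a linear functional of \<open>ver\<close>.\<close>

lemma ver_product_functional:
  fixes e :: "'n::finite \<Rightarrow> nat" and a b :: "'j \<Rightarrow> complex"
  assumes e: "numbering e" and J: "finite J" "card J = CARD('n) - 1"
  obtains w where "\<And>s t. fdot w (ver e s t) = (\<Prod>j\<in>J. a j * s + b j * t)"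
proof -
  obtain c where c: "\<And>s t. (\<Prod>j\<in>J. a j * s + b j * t) = (\<Sum>k\<le>card J. c k * (s ^ (card J - k) * t ^ k))"
    using binary_form_coeffs[OF J(1), of a b] by blast
  have bij: "bij_betw e UNIV {..card J}"
    using e by (simp add: numbering_def J(2) atLeast0AtMost)
  have "fdot (\<chi> i. c (e i)) (ver e s t) = (\<Prod>j\<in>J. a j * s + b j * t)" for s t
    unfolding c sum.reindex_bij_betw[OF bij, symmetric]
    by (simp add: fdot_def ver_def J(2))
  then show thesis by (rule that)
qed

text \<open>The quadrics say that the numbered coordinates form a geometric progression. If the
  first one is nonzero, the ratio is \<open>z 1 / z 0\<close>.\<close>

lemma ver_of_quadrics:
  fixes e :: "'n::finite \<Rightarrow> nat"
  assumes e: "numbering e" and n: "CARD('n) \<ge> 2" and y: "y \<noteq> 0"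
    and q: "\<And>i j k l. e i + e j = e k + e l \<Longrightarrow> y $ i * y $ j = y $ k * y $ l"
  shows "\<exists>c s t. (s, t) \<noteq> (0, 0) \<and> c \<noteq> 0 \<and> y = c *s ver e s t"
proof -
  obtain d where d: "\<And>i. d (e i) = i" "\<And>k. k < CARD('n) \<Longrightarrow> e (d k) = k" "\<And>i. e i < CARD('n)"
    using numberingE[OF e] by metis
  define z where "z k = y $ d k" for k
  have zq: "z i * z j = z k * z l"
    if "i + j = k + l" "i < CARD('n)" "j < CARD('n)" "k < CARD('n)" "l < CARD('n)" for i j k l
    using q[of "d i" "d j" "d k" "d l"] that d(2) by (simp add: z_def)
  have yz: "y $ i = z (e i)" for i by (simp add: z_def d(1))
  show ?thesis
  proof (cases "z 0 = 0")
    case False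
    define t where "t = z 1 / z 0"
    have zk: "z k = z 0 * t ^ k" if "k < CARD('n)" for k
      using that
    proof (induction k)
      case (Suc k)
      have "z (Suc k) * z 0 = z k * z 1" using Suc.prems n by (intro zq) auto
      then show ?case using Suc False by (simp add: t_def field_simps)
    qed simp
    have "y $ i = (z 0 *s ver e 1 t) $ i" for i
      using zk[OF d(3)[of i]] by (simp add: yz[of i] ver_def)
    then have "y = z 0 *s ver e 1 t" by (simp add: vec_eq_iff)
    then show ?thesis using False by (intro exI[of _ "z 0"] exI[of _ 1] exI[of _ t]) auto
  next
    case True
    have zk: "z k = 0" if "k < CARD('n) - 1" for k
      using that
    proof (induction k)
      case (Suc k)
      \<comment> \<open>Zeros propagate upwards as long as \<open>Suc (Suc k)\<close> is still an
        index, so the last coordinate alone survives.\<close>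
      have "z (Suc k) * z (Suc k) = z k * z (Suc (Suc k))" using Suc.prems by (intro zq) auto
      then show ?case using Suc by simp
    qed (use True in simp)
    have "y = z (CARD('n) - 1) *s ver e 0 1"
      unfolding vec_eq_iff
    proof
      fix i
      show "y $ i = (z (CARD('n) - 1) *s ver e 0 1) $ i"
      proof (cases "e i = CARD('n) - 1")
        case False
        then have "e i < CARD('n) - 1" using d(3)[of i] by linarith
        then have "0 < CARD('n) - 1 - e i" "z (e i) = 0" using zk by auto
        then show ?thesis by (simp add: yz ver_def del: diff_Suc_1)
      qed (simp add: yz ver_def)
    qed
    moreover have "z (CARD('n) - 1) \<noteq> 0" using calculation y by auto
    ultimately show ?thesis by (intro exI[of _ "z (CARD('n) - 1)"] exI[of _ 0] exI[of _ 1]) auto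
  qed
qed

lemma projectivity_point_of:
  assumes "invertible A" "v \<noteq> 0" shows "projectivity A (point_of v) = point_of (A *v v)" "A *v v \<noteq> 0"
proof -
  have "(*v) A ` vec.span {v} = vec.span {A *v v}"
    by (auto simp: vec.span_singleton vec.scale image_iff)
  then show "projectivity A (point_of v) = point_of (A *v v)"
    using assms(2) by (simp add: projectivity_def point_of_def[symmetric])
  show "A *v v \<noteq> 0"
    using assms by (metis invertible_left_inverse matrix_left_invertible_ker)
qed

lemma rational_normal_curve_image:
  assumes "numbering e" "invertible A"
  shows "projectivity A ` standard_rational_normal_curve e = {point_of (A *v ver e s t) | s t. (s, t) \<noteq> (0, 0)}"
  unfolding standard_rational_normal_curve_def veronese_point_ver
  using projectivity_point_of[OF assms(2)] ver_nonzero[OF assms(1)] by (auto simp: image_iff) metis+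

lemma ver_curve_holomorphic:
  "hol_curve (\<lambda>z. A *v ver e (s + z * a) (t + z * b)) S"
  unfolding hol_curve_def matrix_vector_mult_def ver_def by (auto intro!: holomorphic_intros)

lemma matrix_vector_mult_rows: "A *v (x :: complex ^ 'n) = (\<chi> i. fdot (A $ i) x)" for A :: "complex ^ 'n ^ 'm"
  by (simp add: matrix_vector_mult_def fdot_def)

section \<open>Coordinates dual to independent points of the curve\<close>

lemma dual_basis:
  fixes S :: "(complex ^ 'n::finite) set"
  assumes "vec.span S = UNIV"
  obtains E X where "\<And>i. E i \<in> S" "\<And>i j. fdot (X i) (E j) = (if i = j then 1 else 0)"
    "\<And>v. v = (\<Sum>i\<in>UNIV. fdot (X i) v *s E (i :: 'n))"
proof -
  obtain B where B: "B \<subseteq> S" "vec.independent B" "S \<subseteq> vec.span B"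
    using vec.maximal_independent_subset by blast
  have "vec.span S \<subseteq> vec.span B" using B(3) vec.span_minimal vec.subspace_span by blast
  then have sB: "vec.span B = UNIV" using assms by auto
  have "card B = CARD('n)"
    using vec.dim_eq_card_independent[OF B(2)] sB vec.dim_span[of B] vec_dim_card by metis
  then obtain E :: "'n \<Rightarrow> complex ^ 'n" where E: "bij_betw E UNIV B"
    using finite_same_card_bij[OF finite vec.finiteI_independent[OF B(2)]] by metis
  define M :: "complex ^ 'n ^ 'n" where "M = (\<chi> i j. E j $ i)"
  have "column j M = E j" for j by (simp add: column_def M_def vec_eq_iff)
  then have "columns M = B" using E by (auto simp: columns_def bij_betw_def)
  then obtain N where N: "M ** N = mat 1" using sB matrix_right_invertible_span_columns by metis
  have N': "N ** M = mat 1" using N matrix_left_right_inverse by blast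
  have Ms: "M *v x = (\<Sum>j\<in>UNIV. x $ j *s E j)" for x
    by (simp add: vec_eq_iff matrix_vector_mult_def M_def mult.commute)
  have Nf: "fdot (N $ i) v = (N *v v) $ i" for i v by (simp add: matrix_vector_mult_def fdot_def)
  show thesis
  proof (rule that[of E "\<lambda>i. N $ i"])
    show "E i \<in> S" for i using E B(1) by (auto simp: bij_betw_def)
    show "v = (\<Sum>i\<in>UNIV. fdot (N $ i) v *s E i)" for v
      unfolding Nf Ms[symmetric] by (simp add: matrix_vector_mul_assoc N)
    fix i j
    have "M *v axis j 1 = E j" unfolding Ms by (simp add: axis_def if_distrib[of "\<lambda>c. c *s _"] cong: if_cong)
    then have "N *v E j = axis j 1" by (metis N' matrix_vector_mul_assoc matrix_vector_mul_lid)
    then show "fdot (N $ i) (E j) = (if i = j then 1 else 0)" unfolding Nf by (simp add: axis_def)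
  qed
qed

text \<open>By nondegeneracy a nonzero linear form is not identically zero on an arc, and
  holomorphic functions on a disc have no zero divisors.\<close>

lemma (in smooth_curve) linear_factor_cancel:
  assumes g: "chart C g r" and f: "form d f" and a: "a \<noteq> 0"
    and z: "\<And>t. t \<in> ball 0 r \<Longrightarrow> fdot a (g t) * f (g t) = 0" and t: "t \<in> ball 0 r"
  shows "f (g t) = 0"
proof -
  note hol = chartD(2)[OF g]
  have "(\<forall>t\<in>ball 0 r. fdot a (g t) = 0) \<or> (\<forall>t\<in>ball 0 r. f (g t) = 0)"
    by (intro holomorphic_prod_zero fdot_holomorphic[OF hol] form_holomorphic[OF f hol] z) auto
  then show ?thesis using linear_vanish_chart[OF g, of a] a t by blast
qed

lemma (in smooth_curve) span_smooth_cone: "vec.span (smooth_cone C) = UNIV"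
proof (rule ccontr)
  assume "vec.span (smooth_cone C) \<noteq> UNIV"
  moreover obtain g r where g: "chart C g r" using smooth_cone_nonempty by (auto simp: smooth_cone_def)
  ultimately obtain t where "t \<in> ball 0 r" "g t \<notin> vec.span (smooth_cone C)"
    using chart_leaves_subspace[OF g vec.subspace_span] by blast
  then show False using vec.span_base[OF smooth_cone_chart[OF g]] by blast
qed

lemma ver_quadric:
  fixes e :: "'n::finite \<Rightarrow> nat"
  assumes e: "numbering e" and ijkl: "e i + e j = e k + e l"
  shows "ver e s t $ i * ver e s t $ j = ver e s t $ k * ver e s t $ l"
proof -
  let ?N = "CARD('n) - 1"
  have le: "e m \<le> ?N" for m using e by (auto simp: numbering_def bij_betw_def)
  have prod: "ver e s t $ x * ver e s t $ y = s ^ ((?N - e x) + (?N - e y)) * t ^ (e x + e y)" for x y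
    by (simp add: ver_def power_add)
  have "(?N - e i) + (?N - e j) = (?N - e k) + (?N - e l)"
    using ijkl le[of i] le[of j] le[of k] le[of l] by linarith
  then show ?thesis by (simp only: prod ijkl)
qed

locale coordinate_points = tangent_rank_curve C for C :: "'n::finite proj set" +
  fixes E X :: "'n \<Rightarrow> complex ^ 'n"
  assumes E: "E i \<in> smooth_cone C" and dual: "fdot (X i) (E j) = (if i = j then 1 else 0)"
    and expand: "v = (\<Sum>i\<in>UNIV. fdot (X i) v *s E i)"
begin

lemma X_nonzero: "X i \<noteq> 0"
  using dual[of i i] by auto

text \<open>Otherwise the velocity at \<open>E j\<close>, less its component along
  \<open>E j\<close>, would be a tangent vector in the span of the \<open>CARD('n) - 2\<close>
  points other than \<open>E i\<close> and \<open>E j\<close>. The rank hypothesis forbids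
  this.\<close>

lemma tangent_transversal:
  assumes ij: "i \<noteq> j" and d: "chart C \<delta> s" "\<delta> 0 = E j" and n: "CARD('n) \<ge> 2"
  shows "fdot (X i) (vderiv \<delta> 0) \<noteq> 0"
proof
  let ?w = "vderiv \<delta> 0"
  assume z: "fdot (X i) ?w = 0"
  note d0 = chart_zero_in[OF d(1)]
  define u where "u = ?w - fdot (X j) ?w *s E j"
  have uX: "fdot (X k) u = (if k = j then 0 else fdot (X k) ?w)" for k
    by (simp add: u_def dual)
  have uT: "u \<in> tangent_space C (point_of (E j))"
    unfolding u_def using chart_tangent(1,2)[OF d(1) d0] d(2) tangent_space_subspace
    by (intro vec.subspace_diff vec.subspace_scale) auto
  have "u = (\<Sum>k\<in>UNIV. fdot (X k) u *s E k)" by (rule expand)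
  also have "\<dots> \<in> vec.span (E ` (UNIV - {i, j}))"
  proof (rule vec.span_sum)
    fix k
    show "fdot (X k) u *s E k \<in> vec.span (E ` (UNIV - {i, j}))"
    proof (cases "k = i \<or> k = j")
      case True
      then have "fdot (X k) u = 0" using uX[of k] z by auto
      then show ?thesis by (simp add: vec.span_zero)
    next
      case False
      then show ?thesis by (intro vec.span_scale vec.span_base) auto
    qed
  qed
  finally have us: "u \<in> vec.span (E ` (UNIV - {i, j}))" .
  have "card (E ` (UNIV - {i, j})) \<le> card (UNIV - {i, j})" by (rule card_image_le) simp
  also have "\<dots> = CARD('n) - 2" using ij by (simp add: card_Diff_subset)
  finally have "card (E ` (UNIV - {i, j})) + 2 \<le> CARD('n)" using n by linarith
  then have "u \<in> vec.span {E j}"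
    using E smooth_cone_subset us uT by (intro tangent_rank[of "E j" u "E ` (UNIV - {i, j})"]) auto
  then obtain c where c: "u = c *s E j" by (auto simp: span_singleton_iff)
  then have "c = 0" using uX[of j] by (simp add: dual)
  then have "?w = fdot (X j) ?w *s E j" using c by (simp add: u_def)
  then show False using chart_tangent(3)[OF d(1) d0] d(2) by (metis span_singleton_iff)
qed

text \<open>
  Among the \<open>2 * CARD('n)\<close> quadrics below, a relation involves no squares, since those are detected at the points
  \<open>E k\<close>; it involves no \<open>X j * X i0\<close> with \<open>j\<close> different from \<open>i\<close> and \<open>i1\<close>, since those are detected by the
  derivative along the curve at \<open>E j\<close>.
\<close>
lemma cremona_relation:
  assumes ij: "i0 \<noteq> i1" "i \<noteq> i0" "i \<noteq> i1"
  shows "\<exists>b c. b \<noteq> 0 \<and> c \<noteq> 0 \<and> (\<forall>v\<in>affine_cone C.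
    fdot (X i0) v * fdot (X i1) v = fdot (X i) v * (b * fdot (X i1) v + c * fdot (X i0) v))"
proof -
  have "card {i0, i1, i} \<le> CARD('n)" by (rule card_mono) auto
  then have n: "CARD('n) \<ge> 3" using ij by auto
  define K where "K = UNIV - {i0}"
  \<comment> \<open>The \<open>CARD('n)\<close> squares, the \<open>CARD('n) - 1\<close> products
    with \<open>X i0\<close>, and the product of \<open>X i1\<close> and \<open>X i\<close>: as many
    as \<open>quadric_relation\<close> asks for.\<close>
  define J where "J = range (\<lambda>k. (k, k)) \<union> (K \<times> {i0} \<union> {(i1, i)})"
  have cJ: "card J = 2 * CARD('n)"
  proof -
    have "card (K \<times> {i0} \<union> {(i1, i)}) = CARD('n)"
      using ij n by (subst card_Un_disjoint) (auto simp: K_def card_cartesian_product card_Diff_subset)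
    moreover have "card (range (\<lambda>k :: 'n. (k, k))) = CARD('n)" by (rule card_image) (simp add: inj_on_def)
    moreover have "range (\<lambda>k. (k, k)) \<inter> (K \<times> {i0} \<union> {(i1, i)}) = {}" using ij by (auto simp: K_def)
    ultimately show ?thesis unfolding J_def by (subst card_Un_disjoint) auto
  qed
  define Q where "Q = (\<lambda>(k, l) v. fdot (X k) v * fdot (X l) v)"
  have Q: "form 2 (Q j)" for j
    using form_mult[OF form_fdot form_fdot] by (cases j) (simp add: Q_def numeral_2_eq_2)
  obtain c where c: "\<exists>j\<in>J. c j \<noteq> 0" "\<And>v. v \<in> affine_cone C \<Longrightarrow> (\<Sum>j\<in>J. c j * Q j v) = 0"
    using quadric_relation[of J Q, OF n finite eq_imp_le[OF cJ[symmetric]] Q] by blast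
  define S where "S = (\<Sum>k\<in>K. c (k, i0) *s X k)"
  have fS: "fdot S v = (\<Sum>k\<in>K. c (k, i0) * fdot (X k) v)" for v
    unfolding S_def by (induction K rule: infinite_finite_induct) auto
  have rel: "(\<Sum>k\<in>UNIV. c (k, k) * (fdot (X k) v * fdot (X k) v)) + (fdot (X i0) v * fdot S v
      + c (i1, i) * (fdot (X i1) v * fdot (X i) v)) = 0" if v: "v \<in> affine_cone C" for v
  proof -
    have "(\<Sum>j\<in>J. c j * Q j v) = (\<Sum>j\<in>range (\<lambda>k. (k, k)). c j * Q j v) + (\<Sum>j\<in>K \<times> {i0} \<union> {(i1, i)}. c j * Q j v)"
      unfolding J_def by (rule sum.union_disjoint) (use ij in \<open>auto simp: K_def\<close>)
    also have "(\<Sum>j\<in>range (\<lambda>k. (k, k)). c j * Q j v) = (\<Sum>k\<in>UNIV. c (k, k) * (fdot (X k) v * fdot (X k) v))"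
      by (subst sum.reindex) (auto simp: inj_on_def Q_def)
    also have "(\<Sum>j\<in>K \<times> {i0} \<union> {(i1, i)}. c j * Q j v) = (\<Sum>j\<in>K \<times> {i0}. c j * Q j v) + c (i1, i) * Q (i1, i) v"
      by (subst sum.union_disjoint) (use ij in auto)
    also have "(\<Sum>j\<in>K \<times> {i0}. c j * Q j v) = fdot (X i0) v * fdot S v"
    proof -
      have "(\<Sum>j\<in>K \<times> {i0}. c j * Q j v) = (\<Sum>k\<in>K. c (k, i0) * Q (k, i0) v)"
        by (rule sum.reindex_bij_witness[of _ "\<lambda>k. (k, i0)" fst]) auto
      then show ?thesis by (simp add: fS Q_def sum_distrib_left mult_ac)
    qed
    finally show ?thesis using c(2)[OF v] by (simp add: Q_def)
  qed
  have EC: "E k \<in> affine_cone C" for k using E smooth_cone_subset by blast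
  have SE: "fdot S (E k) = (if k = i0 then 0 else c (k, i0))" for k
    unfolding fS dual by (simp add: K_def if_distrib[of "\<lambda>x. _ * x"] cong: if_cong)
  have diag: "c (k, k) = 0" for k
  proof -
    have "(\<Sum>l\<in>UNIV. c (l, l) * (fdot (X l) (E k) * fdot (X l) (E k))) = c (k, k)"
      by (simp add: dual if_distrib[of "\<lambda>x. _ * x"] cong: if_cong)
    then show ?thesis using rel[OF EC[of k]] SE[of k] ij by (auto simp: dual split: if_splits)
  qed
  then have rel: "fdot (X i0) v * fdot S v + c (i1, i) * (fdot (X i1) v * fdot (X i) v) = 0"
    if "v \<in> affine_cone C" for v
    using rel[OF that] by simp
  have off: "c (j, i0) = 0" if j: "j \<noteq> i0" "j \<noteq> i1" "j \<noteq> i" for j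
  proof -
    obtain \<delta> s where d: "chart C \<delta> s" "\<delta> 0 = E j" using E[of j] by (auto simp: smooth_cone_def)
    note d0 = chart_zero_in[OF d(1)]
    note D = fdot_deriv(2)[OF chartD(2)[OF d(1)] open_ball d0]
    let ?w = "vderiv \<delta> 0"
    have "((\<lambda>t. fdot (X i0) (\<delta> t) * fdot S (\<delta> t) + c (i1, i) * (fdot (X i1) (\<delta> t) * fdot (X i) (\<delta> t)))
      has_field_derivative (fdot (X i0) ?w * fdot S (\<delta> 0) + fdot S ?w * fdot (X i0) (\<delta> 0)
        + c (i1, i) * (fdot (X i1) ?w * fdot (X i) (\<delta> 0) + fdot (X i) ?w * fdot (X i1) (\<delta> 0)))) (at 0)"
      by (intro DERIV_add DERIV_mult DERIV_cmult D)
    moreover have "((\<lambda>t. fdot (X i0) (\<delta> t) * fdot S (\<delta> t) + c (i1, i) * (fdot (X i1) (\<delta> t) * fdot (X i) (\<delta> t)))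
      has_field_derivative 0) (at 0)"
      by (rule has_field_derivative_transform_within_open[OF DERIV_const open_ball d0])
        (use rel chartD(3)[OF d(1)] in simp)
    ultimately have "fdot (X i0) ?w * fdot S (\<delta> 0) + fdot S ?w * fdot (X i0) (\<delta> 0)
        + c (i1, i) * (fdot (X i1) ?w * fdot (X i) (\<delta> 0) + fdot (X i) ?w * fdot (X i1) (\<delta> 0)) = 0"
      by (rule DERIV_unique)
    \<comment> \<open>At \<open>E j\<close> all of \<open>X i0\<close>, \<open>X i1\<close> and
      \<open>X i\<close> vanish, so the derivative keeps a single term, whose first factor is
      nonzero by transversality.\<close>
    then have "fdot (X i0) ?w * c (j, i0) = 0" using d(2) j SE[of j] by (simp add: dual)
    moreover have "fdot (X i0) ?w \<noteq> 0" by (rule tangent_transversal[OF _ d]) (use j n in auto)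
    ultimately show ?thesis by simp
  qed
  define p where "p = c (i1, i0)"
  define q where "q = c (i, i0)"
  define f where "f = c (i1, i)"
  have S: "fdot S v = p * fdot (X i1) v + q * fdot (X i) v" for v
  proof -
    have "fdot S v = (\<Sum>k\<in>{i1, i}. c (k, i0) * fdot (X k) v)"
      unfolding fS by (rule sum.mono_neutral_right) (use off ij in \<open>auto simp: K_def\<close>)
    then show ?thesis using ij by (simp add: p_def q_def)
  qed
  have nz: "p \<noteq> 0 \<or> q \<noteq> 0 \<or> f \<noteq> 0"
  proof -
    obtain k l where kl: "(k, l) \<in> J" "c (k, l) \<noteq> 0" using c(1) by auto
    then have "(k, l) = (i1, i0) \<or> (k, l) = (i, i0) \<or> (k, l) = (i1, i)"
      using diag off unfolding J_def K_def by blast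
    then show ?thesis using kl(2) by (auto simp: p_def q_def f_def)
  qed
  have rel: "fdot (X i0) v * (p * fdot (X i1) v + q * fdot (X i) v) + f * (fdot (X i1) v * fdot (X i) v) = 0"
    if "v \<in> affine_cone C" for v
    using rel[OF that] by (simp add: S f_def)
  obtain g r where g: "chart C g r" using smooth_cone_nonempty by (auto simp: smooth_cone_def)
  note gC = chartD(3)[OF g]
  \<comment> \<open>If \<open>p\<close>, \<open>q\<close> or \<open>f\<close> were zero, the two
    remaining terms would share a linear factor; cancelling it leaves a linear relation on the arc,
    which must be trivial.\<close>
  have cancel: "x = 0 \<and> y = 0" if "k \<noteq> l" "\<And>t. t \<in> ball 0 r \<Longrightarrow> fdot (X m) (g t) * fdot (x *s X k + y *s X l) (g t) = 0" for k l m x y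
  proof -
    have "fdot (x *s X k + y *s X l) (g t) = 0" if "t \<in> ball 0 r" for t
      by (rule linear_factor_cancel[OF g form_fdot X_nonzero \<open>\<And>t. t \<in> ball 0 r \<Longrightarrow> fdot (X m) (g t) * fdot (x *s X k + y *s X l) (g t) = 0\<close> that])
    then have 0: "x *s X k + y *s X l = 0" by (rule linear_vanish_chart[OF g])
    have "fdot (x *s X k + y *s X l) (E k) = x" "fdot (x *s X k + y *s X l) (E l) = y"
      using \<open>k \<noteq> l\<close> by (simp_all add: dual)
    then show ?thesis unfolding 0 by simp
  qed
  have p: "p \<noteq> 0"
  proof
    assume "p = 0"
    have "q = 0 \<and> f = 0"
    proof (rule cancel[of i0 i1 i])
      show "fdot (X i) (g t) * fdot (q *s X i0 + f *s X i1) (g t) = 0" if "t \<in> ball 0 r" for t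
        using rel[OF gC[OF that]] \<open>p = 0\<close> by (simp add: algebra_simps)
    qed (use ij in simp)
    then show False using nz \<open>p = 0\<close> by simp
  qed
  have q: "q \<noteq> 0"
  proof
    assume "q = 0"
    have "p = 0 \<and> f = 0"
    proof (rule cancel[of i0 i i1])
      show "fdot (X i1) (g t) * fdot (p *s X i0 + f *s X i) (g t) = 0" if "t \<in> ball 0 r" for t
        using rel[OF gC[OF that]] \<open>q = 0\<close> by (simp add: algebra_simps)
    qed (use ij in simp)
    then show False using p by simp
  qed
  have f: "f \<noteq> 0"
  proof
    assume "f = 0"
    have "p = 0 \<and> q = 0"
    proof (rule cancel[of i1 i i0])
      show "fdot (X i0) (g t) * fdot (p *s X i1 + q *s X i) (g t) = 0" if "t \<in> ball 0 r" for t
        using rel[OF gC[OF that]] \<open>f = 0\<close> by simp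
    qed (use ij in simp)
    then show False using p by simp
  qed
  have "fdot (X i0) v * fdot (X i1) v = fdot (X i) v * (- f / p * fdot (X i1) v + - q / p * fdot (X i0) v)"
    if "v \<in> affine_cone C" for v
    using rel[OF that] p by (simp add: field_simps) algebra
  then show ?thesis using p q f by (intro exI[of _ "- f / p"] exI[of _ "- q / p"]) auto
qed

lemma rational_normal: assumes n: "CARD('n) \<ge> 2" shows "rational_normal_curve C"
proof -
  obtain i0 i1 :: 'n where i01: "i0 \<noteq> i1"
  proof -
    obtain S :: "'n set" where "card S = 2"
      using obtain_subset_with_card_n[of 2 "UNIV :: 'n set"] n by auto
    then show thesis using that by (auto simp: card_2_iff)
  qed
  have "\<exists>b c. (b, c) \<noteq> (0, 0) \<and> (\<forall>v\<in>affine_cone C.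
    fdot (X i0) v * fdot (X i1) v = fdot (X i) v * (b * fdot (X i1) v + c * fdot (X i0) v))" for i
  proof -
    consider "i = i0" | "i = i1" | "i \<noteq> i0" "i \<noteq> i1" by blast
    then show ?thesis
    proof cases
      \<comment> \<open>For \<open>i0\<close> and \<open>i1\<close> the relation is a tautology.
        This also covers the projective line, where no other index exists.\<close>
      case 1 then show ?thesis by (intro exI[of _ 1] exI[of _ 0]) auto
    next
      case 2 then show ?thesis by (intro exI[of _ 0] exI[of _ 1]) auto
    next
      case 3 then show ?thesis using cremona_relation[OF i01 3] by blast
    qed
  qed
  then obtain b c where bc: "\<And>i v. v \<in> affine_cone C \<Longrightarrow>
    fdot (X i0) v * fdot (X i1) v = fdot (X i) v * (b i * fdot (X i1) v + c i * fdot (X i0) v)"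
    by metis
  obtain e :: "'n \<Rightarrow> nat" where e: "numbering e" using numbering_exists by blast
  have "\<exists>w. \<forall>s t. fdot w (ver e s t) = (\<Prod>j\<in>UNIV - {i}. b j * s + c j * t)" for i
  proof -
    have "card (UNIV - {i}) = CARD('n) - 1" by (simp add: card_Diff_singleton)
    then show ?thesis
    proof (rule ver_product_functional[where a = b and b = c, OF e finite])
      fix w assume "\<And>s t. fdot w (ver e s t) = (\<Prod>j\<in>UNIV - {i}. b j * s + c j * t)"
      then show ?thesis by blast
    qed
  qed
  then obtain w where w: "\<And>i s t. fdot (w i) (ver e s t) = (\<Prod>j\<in>UNIV - {i}. b j * s + c j * t)"
    by metis
  \<comment> \<open>\<open>X i\<close> should be proportional to the inverse of the linear form with
    coefficients \<open>b i\<close>, \<open>c i\<close>, hence to the product of the other such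
    forms; \<open>w i\<close> is that product.\<close>
  define A :: "complex ^ 'n ^ 'n" where "A = (\<chi> r k. \<Sum>i\<in>UNIV. E i $ r * w i $ k)"
  have A: "A *v x = (\<Sum>i\<in>UNIV. fdot (w i) x *s E i)" for x
  proof -
    have "(\<Sum>k\<in>UNIV. (\<Sum>i\<in>UNIV. E i $ r * w i $ k) * x $ k) = (\<Sum>i\<in>UNIV. (\<Sum>k\<in>UNIV. w i $ k * x $ k) * E i $ r)" for r
      unfolding sum_distrib_right by (subst sum.swap) (simp add: mult_ac)
    then show ?thesis by (simp add: vec_eq_iff matrix_vector_mult_def A_def fdot_def)
  qed
  text \<open>Inverting the coordinates turns the curve into the line with parameters \<open>1 / X i0\<close> and \<open>1 / X i1\<close>.\<close>
  have param: "\<exists>k. k \<noteq> 0 \<and> A *v ver e (fdot (X i1) v) (fdot (X i0) v) = k *s v"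
    if v: "v \<in> affine_cone C" "fdot (X i0) v \<noteq> 0" "fdot (X i1) v \<noteq> 0" for v
  proof -
    define L where "L i = b i * fdot (X i1) v + c i * fdot (X i0) v" for i
    define P where "P = fdot (X i0) v * fdot (X i1) v"
    have P: "P \<noteq> 0" "\<And>i. fdot (X i) v * L i = P" using v bc[OF v(1)] by (auto simp: P_def L_def)
    then have L: "L i \<noteq> 0" for i by (metis mult_zero_right)
    define k where "k = (\<Prod>i\<in>UNIV. L i) / P"
    have "fdot (w i) (ver e (fdot (X i1) v) (fdot (X i0) v)) = k * fdot (X i) v" for i
    proof -
      have "(\<Prod>i\<in>UNIV. L i) = L i * (\<Prod>j\<in>UNIV - {i}. L j)" by (rule prod.remove) auto
      then show ?thesis using P(1) P(2)[of i] L[of i] by (simp add: w L_def[symmetric] k_def field_simps)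
    qed
    then have "A *v ver e (fdot (X i1) v) (fdot (X i0) v) = (\<Sum>i\<in>UNIV. k *s (fdot (X i) v *s E i))"
      by (simp add: A)
    also have "\<dots> = k *s v" unfolding vec.scale_sum_right[symmetric] expand[of v, symmetric] ..
    finally show ?thesis using P L by (intro exI[of _ k]) (auto simp: k_def)
  qed
  obtain g r where g: "chart C g r" using smooth_cone_nonempty by (auto simp: smooth_cone_def)
  note gC = chartD(3)[OF g] and hol = chartD(2)[OF g]
  \<comment> \<open>The parametrization is available only off two coordinate hyperplanes.
    Multiplying by \<open>X i0\<close> and \<open>X i1\<close> removes the restriction, and both
    factors cancel.\<close>
  have generic: "f (g t) = 0"
    if f: "form d f" "\<And>v. v \<in> affine_cone C \<Longrightarrow> fdot (X i0) v \<noteq> 0 \<Longrightarrow> fdot (X i1) v \<noteq> 0 \<Longrightarrow> f v = 0"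
      and t: "t \<in> ball 0 r" for f d t
  proof -
    have 1: "form (1 + d) (\<lambda>v. fdot (X i1) v * f v)" by (rule form_mult[OF form_fdot f(1)])
    have "fdot (X i1) (g t) * f (g t) = 0" if "t \<in> ball 0 r" for t
      using linear_factor_cancel[OF g 1 X_nonzero[of i0] _ that] f(2)[OF gC] by fastforce
    then show ?thesis by (rule linear_factor_cancel[OF g f(1) X_nonzero[of i1] _ t])
  qed
  have "surj ((*v) A)"
  proof (rule ccontr)
    \<comment> \<open>A functional vanishing on the range of \<open>A\<close> would vanish on the
      parametrized points, hence on the arc, against nondegeneracy.\<close>
    assume ns: "\<not> surj ((*v) A)"
    have sub: "vec.subspace (range ((*v) A))"
      by (rule vec.linear_subspace_image[OF matrix_vector_mul_linear_gen vec.subspace_UNIV])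
    obtain y where "y \<notin> range ((*v) A)" using ns by blast
    then obtain a where a: "\<And>u. u \<in> range ((*v) A) \<Longrightarrow> fdot a u = 0" "fdot a y = 1"
      using separating_functional[OF sub] by blast
    have "fdot a v = 0" if v: "v \<in> affine_cone C" "fdot (X i0) v \<noteq> 0" "fdot (X i1) v \<noteq> 0" for v
    proof -
      obtain k where k: "k \<noteq> 0" "A *v ver e (fdot (X i1) v) (fdot (X i0) v) = k *s v" using param[OF v] by blast
      have "fdot a (k *s v) = 0" using a(1) k(2) by (metis rangeI)
      then show ?thesis using k(1) by simp
    qed
    from linear_vanish_chart[OF g generic[OF form_fdot this]] have "a = 0" .
    then show False using a(2) by simp
  qed
  then obtain A' where A': "A ** A' = mat 1" using matrix_right_invertible_surjective by blast
  then have inv: "invertible A" using invertible_right_inverse by blast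
  have A'A: "A' ** A = mat 1" using A' matrix_left_right_inverse by blast
  have img: "projectivity A ` standard_rational_normal_curve e = {point_of (A *v ver e s t) | s t. (s, t) \<noteq> (0, 0)}"
    by (rule rational_normal_curve_image[OF e inv])
  have sub1: "C \<subseteq> projectivity A ` standard_rational_normal_curve e"
  proof
    fix x assume x: "x \<in> C"
    obtain v where v: "v \<noteq> 0" "x = point_of v" using point_cases by blast
    have vC: "v \<in> affine_cone C" using v x by (simp add: affine_cone_def)
    have Ai: "(A' *v u) $ i = fdot (A' $ i) u" for u i by (simp add: matrix_vector_mult_def fdot_def)
    \<comment> \<open>In the coordinates given by \<open>A'\<close>, the parametrized points satisfy
      the Veronese quadrics. \<open>generic\<close> and \<open>dense\<close> extend these to every
      point of \<open>C\<close>, including those not reached by \<open>param\<close>.\<close>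
    have quad: "fdot (A' $ i) v * fdot (A' $ j) v = fdot (A' $ k) v * fdot (A' $ l) v" if ijkl: "e i + e j = e k + e l" for i j k l
    proof -
      let ?f = "\<lambda>v. fdot (A' $ i) v * fdot (A' $ j) v + (- 1) * (fdot (A' $ k) v * fdot (A' $ l) v)"
      have f: "form (1 + 1) ?f" by (intro form_add form_scale form_mult form_fdot)
      have "?f u = 0" if u: "u \<in> affine_cone C" "fdot (X i0) u \<noteq> 0" "fdot (X i1) u \<noteq> 0" for u
      proof -
        obtain h where h: "h \<noteq> 0" "A *v ver e (fdot (X i1) u) (fdot (X i0) u) = h *s u" using param[OF u] by blast
        let ?y = "ver e (fdot (X i1) u) (fdot (X i0) u)"
        have "h *s (A' *v u) = A' *v (h *s u)" by (simp add: vec.scale)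
        also have "\<dots> = ?y" unfolding h(2)[symmetric] by (simp add: matrix_vector_mul_assoc A'A)
        finally have y: "h * fdot (A' $ m) u = ?y $ m" for m by (metis Ai vector_smult_component)
        have "?y $ i * ?y $ j = ?y $ k * ?y $ l" by (rule ver_quadric[OF e ijkl])
        then have "h * h * ?f u = 0" unfolding y[symmetric] by (simp add: algebra_simps)
        then show ?thesis using h(1) by simp
      qed
      then have "?f v = 0" using dense[OF g f generic[OF f] vC] by blast
      then show ?thesis by simp
    qed
    have "A' *v v \<noteq> 0" using v(1) A' by (metis matrix_left_invertible_ker)
    then obtain k s t where kst: "(s, t) \<noteq> (0, 0)" "k \<noteq> 0" "A' *v v = k *s ver e s t"
      using ver_of_quadrics[OF e n, of "A' *v v"] quad Ai by metis
    have "v = A *v (A' *v v)" by (simp add: matrix_vector_mul_assoc A')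
    also have "\<dots> = k *s (A *v ver e s t)" by (simp add: kst(3) vec.scale)
    finally have "x = point_of (A *v ver e s t)"
      using v kst projectivity_point_of(2)[OF inv ver_nonzero[OF e kst(1)]] by simp
    then show "x \<in> projectivity A ` standard_rational_normal_curve e" unfolding img using kst(1) by blast
  qed
  \<comment> \<open>The ratio \<open>q\<close> of \<open>X i0\<close> and \<open>X i1\<close> along
    the arc is not constant, so its values fill an open set by the open mapping theorem. On it
    \<open>f\<close> vanishes along the Veronese curve, and the identity theorem gives all
    \<open>z\<close>.\<close>
  have vanish: "mpoly_eval f (A *v ver e 1 z) = 0" if f: "f \<in> vanishing_forms C" for f z
  proof -
    obtain d where d: "homogeneous d f" using f by (auto simp: vanishing_forms_def)
    obtain t1 where t1: "t1 \<in> ball 0 r" "fdot (X i0) (g t1) * fdot (X i1) (g t1) \<noteq> 0"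
    proof (rule ccontr)
      assume "\<not> thesis"
      then have z: "fdot (X i0) (g t) * fdot (X i1) (g t) = 0" if "t \<in> ball 0 r" for t
        using that \<open>\<And>t1. t1 \<in> ball 0 r \<Longrightarrow> fdot (X i0) (g t1) * fdot (X i1) (g t1) \<noteq> 0 \<Longrightarrow> thesis\<close> by blast
      have "X i1 = 0"
        by (rule linear_vanish_chart[OF g]) (rule linear_factor_cancel[OF g form_fdot X_nonzero[of i0] z])
      then show False using X_nonzero by blast
    qed
    let ?O = "ball 0 r \<inter> (\<lambda>t. fdot (X i0) (g t) * fdot (X i1) (g t)) -` (- {0})"
    have "open ?O"
      by (intro continuous_open_preimage continuous_intros hol_curve_continuous[OF hol]) auto
    then obtain \<epsilon> where eps: "\<epsilon> > 0" "ball t1 \<epsilon> \<subseteq> ?O" using t1 by (metis (no_types, lifting) ComplI IntI open_contains_ball singletonD vimageI)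
    define q where "q t = fdot (X i0) (g t) / fdot (X i1) (g t)" for t
    have q: "q holomorphic_on ball t1 \<epsilon>"
      unfolding q_def using eps(2) fdot_holomorphic[OF hol]
      by (intro holomorphic_on_divide) (auto intro: holomorphic_on_subset)
    have nc: "\<not> q constant_on ball t1 \<epsilon>"
    proof
      assume "q constant_on ball t1 \<epsilon>"
      then obtain k where k: "\<And>t. t \<in> ball t1 \<epsilon> \<Longrightarrow> q t = k" by (auto simp: constant_on_def)
      have "fdot (X i0 - k *s X i1) (g t) = 0" if t: "t \<in> ball 0 r" for t
      proof (rule analytic_continuation_open[of "ball t1 \<epsilon>" "ball 0 r" _ "\<lambda>_. 0" t])
        show "(\<lambda>t. fdot (X i0 - k *s X i1) (g t)) holomorphic_on ball 0 r"
          by (rule fdot_holomorphic[OF hol])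
        show "\<And>z. z \<in> ball t1 \<epsilon> \<Longrightarrow> fdot (X i0 - k *s X i1) (g z) = 0"
        proof -
          fix z assume z: "z \<in> ball t1 \<epsilon>"
          then have "fdot (X i1) (g z) \<noteq> 0" using eps(2) by auto
          then show "fdot (X i0 - k *s X i1) (g z) = 0" using k[OF z] by (simp add: q_def field_simps)
        qed
      qed (use eps t in auto)
      then have 0: "X i0 - k *s X i1 = 0" by (rule linear_vanish_chart[OF g])
      have "fdot (X i0 - k *s X i1) (E i0) = 1" using i01 by (simp add: dual)
      then show False unfolding 0 by simp
    qed
    have opn: "open (q ` ball t1 \<epsilon>)"
      by (rule open_mapping_thm[OF q open_ball connected_ball open_ball subset_refl nc])
    show ?thesis
    proof (rule analytic_continuation_open[of "q ` ball t1 \<epsilon>" UNIV "\<lambda>z. mpoly_eval f (A *v ver e 1 z)" "\<lambda>_. 0" z])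
      have "hol_curve (\<lambda>z. A *v ver e 1 z) UNIV" using ver_curve_holomorphic[of A e 1 0 0 1 UNIV] by simp
      then show "(\<lambda>z. mpoly_eval f (A *v ver e 1 z)) holomorphic_on UNIV" by (rule mpoly_holomorphic)
      fix z assume "z \<in> q ` ball t1 \<epsilon>"
      then obtain t where t: "t \<in> ball t1 \<epsilon>" "z = q t" by blast
      then have tO: "t \<in> ball 0 r" "fdot (X i0) (g t) \<noteq> 0" "fdot (X i1) (g t) \<noteq> 0" using eps(2) by auto
      obtain k where k: "A *v ver e (fdot (X i1) (g t)) (fdot (X i0) (g t)) = k *s g t"
        using param[OF gC[OF tO(1)] tO(2,3)] by blast
      have "ver e (fdot (X i1) (g t)) (fdot (X i0) (g t)) = fdot (X i1) (g t) ^ (CARD('n) - 1) *s ver e 1 z"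
        using ver_scale[OF e, of "fdot (X i1) (g t)" 1 z] tO(3) by (simp add: t(2) q_def)
      then have "fdot (X i1) (g t) ^ (CARD('n) - 1) *s (A *v ver e 1 z) = k *s g t"
        using k by (simp add: vec.scale)
      then have "mpoly_eval f (fdot (X i1) (g t) ^ (CARD('n) - 1) *s (A *v ver e 1 z)) = mpoly_eval f (k *s g t)" by simp
      moreover have "mpoly_eval f (g t) = 0" using f gC[OF tO(1)] by (auto simp: vanishing_forms_cone)
      ultimately show "mpoly_eval f (A *v ver e 1 z) = 0"
        using tO(3) by (simp add: mpoly_eval_homogeneous[OF d])
    qed (use opn eps(1) in auto)
  qed
  have vanish2: "mpoly_eval f (A *v ver e s t) = 0" if f: "f \<in> vanishing_forms C" and s: "s \<noteq> 0" for f s t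
  proof -
    obtain d where d: "homogeneous d f" using f by (auto simp: vanishing_forms_def)
    have "ver e s t = s ^ (CARD('n) - 1) *s ver e 1 (t / s)" using ver_scale[OF e, of s 1 "t / s"] s by simp
    then show ?thesis using vanish[OF f, of "t / s"] by (simp add: vec.scale mpoly_eval_homogeneous[OF d])
  qed
  \<comment> \<open>The point at infinity, \<open>s = 0\<close>, is reached by continuation in
    \<open>s\<close> with \<open>t\<close> fixed.\<close>
  have vanish3: "mpoly_eval f (A *v ver e s t) = 0" if f: "f \<in> vanishing_forms C" for f s t
  proof (rule analytic_continuation_open[of "- {0}" UNIV "\<lambda>z. mpoly_eval f (A *v ver e z t)" "\<lambda>_. 0" s])
    have "hol_curve (\<lambda>z. A *v ver e z t) UNIV" using ver_curve_holomorphic[of A e 0 1 t 0 UNIV] by simp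
    then show "(\<lambda>z. mpoly_eval f (A *v ver e z t)) holomorphic_on UNIV" by (rule mpoly_holomorphic)
    have "(1::complex) \<in> - {0}" by simp
    then show "- {0::complex} \<noteq> {}" by blast
  qed (use vanish2[OF f] in auto)
  have sub2: "projectivity A ` standard_rational_normal_curve e \<subseteq> C"
  proof
    fix x assume "x \<in> projectivity A ` standard_rational_normal_curve e"
    then obtain s t where st: "(s, t) \<noteq> (0, 0)" "x = point_of (A *v ver e s t)" unfolding img by blast
    have "A *v ver e s t \<noteq> 0" by (rule projectivity_point_of(2)[OF inv ver_nonzero[OF e st(1)]])
    then have "A *v ver e s t \<in> affine_cone C" using cone_iff_vanishing[OF closed] vanish3 by blast
    then show "x \<in> C" using st(2) by (simp add: affine_cone_def)
  qed
  show ?thesis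
    unfolding rational_normal_curve_def
    by (intro exI[of _ e] exI[of _ A] conjI) (use e inv sub1 sub2 in \<open>auto simp: numbering_def\<close>)
qed

end

lemma (in tangent_rank_curve) rational_normal_of_tangent_rank:
  assumes "CARD('n) \<ge> 2" shows "rational_normal_curve C"
proof (rule dual_basis[OF span_smooth_cone])
  fix E X :: "'n \<Rightarrow> complex ^ 'n"
  assume EX: "\<And>i. E i \<in> smooth_cone C" "\<And>i j. fdot (X i) (E j) = (if i = j then 1 else 0)"
    "\<And>v. v = (\<Sum>i\<in>UNIV. fdot (X i) v *s E i)"
  interpret coordinate_points C E X by unfold_locales (rule EX)+
  show ?thesis by (rule rational_normal[OF assms])
qed

section \<open>Tangent lines of rational normal curves\<close>

lemma sum_powers_root_of_unity:
  fixes n k :: nat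
  assumes "n \<ge> 1"
  defines "\<omega> \<equiv> exp (2 * of_real pi * \<i> * of_nat 1 / of_nat n)"
  shows "(\<Sum>j<n. (\<omega> ^ j) ^ k) = (if n dvd k then of_nat n else 0)"
proof -
  have wk: "\<omega> ^ k = exp (2 * of_real pi * \<i> * of_nat k / of_nat n)" for k
    by (simp add: \<omega>_def exp_of_nat_mult[symmetric] mult_ac)
  have sum: "(\<Sum>j<n. (\<omega> ^ j) ^ k) = (\<Sum>j<n. (\<omega> ^ k) ^ j)"
    by (simp add: power_mult[symmetric] mult.commute)
  show ?thesis
  proof (cases "n dvd k")
    case True
    then have "\<omega> ^ k = 1" using complex_root_unity_eq_1[OF assms(1)] wk by simp
    then show ?thesis using True by (simp add: sum)
  next
    case False
    then have "\<omega> ^ k \<noteq> 1" using complex_root_unity_eq_1[OF assms(1)] wk by simp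
    moreover have "(\<omega> ^ k) ^ n = 1"
      using complex_root_unity_eq_1[OF assms(1), of n] wk[of n] by (simp add: power_mult[symmetric] mult.commute[of k]) (simp add: power_mult)
    ultimately show ?thesis using False by (simp add: sum sum_gp_strict geometric_sum)
  qed
qed

text \<open>The root of unity filter picks out the coefficients of \<open>z ^ k\<close> with \<open>k \<equiv> 1\<close> modulo \<open>n\<close>.\<close>
lemma linear_coeff_filter:
  assumes n: "n \<ge> 2" and p: "degree p \<le> n"
  defines "\<omega> \<equiv> exp (2 * of_real pi * \<i> * of_nat 1 / of_nat n)"
  shows "(\<Sum>j<n. (\<omega> ^ j) ^ (n - 1) * poly p (\<omega> ^ j)) = of_nat n * coeff p 1"
proof -
  have "poly p z = (\<Sum>k\<le>n. coeff p k * z ^ k)" for z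
    unfolding poly_altdef by (rule sum.mono_neutral_left) (use p in \<open>auto simp: coeff_eq_0\<close>)
  then have "(\<Sum>j<n. (\<omega> ^ j) ^ (n - 1) * poly p (\<omega> ^ j)) = (\<Sum>j<n. \<Sum>k\<le>n. coeff p k * (\<omega> ^ j) ^ (n - 1 + k))"
    by (simp only: sum_distrib_left power_add mult_ac)
  also have "\<dots> = (\<Sum>k\<le>n. coeff p k * (\<Sum>j<n. (\<omega> ^ j) ^ (n - 1 + k)))"
    by (subst sum.swap) (simp add: sum_distrib_left)
  also have "\<dots> = (\<Sum>k\<le>n. coeff p k * (if k = 1 then of_nat n else 0))"
  proof (rule sum.cong[OF refl])
    fix k assume k: "k \<in> {..n}"
    have "n dvd n - 1 + k \<longleftrightarrow> k = 1"
    proof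
      assume "n dvd n - 1 + k"
      then obtain m where m: "n - 1 + k = n * m" by blast
      have "m \<noteq> 0" using m n by (intro notI) simp
      moreover have "m < 2"
      proof (rule ccontr)
        assume "\<not> m < 2"
        then have "n * 2 \<le> n * m" by (intro mult_le_mono2) simp
        then have "n * 2 \<le> n - 1 + k" unfolding m .
        moreover have "k \<le> n" using k by simp
        ultimately show False using n by linarith
      qed
      ultimately have "m = 1" by linarith
      then show "k = 1" using m n by simp
    qed (use n in simp)
    then show "coeff p k * (\<Sum>j<n. (\<omega> ^ j) ^ (n - 1 + k)) = coeff p k * (if k = 1 then of_nat n else 0)"
      using sum_powers_root_of_unity[of n "n - 1 + k"] n by (simp add: \<omega>_def)
  qed
  also have "\<dots> = of_nat n * coeff p 1"
    using n by (simp add: if_distrib[of "\<lambda>x. _ * x"] cong: if_cong)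
  finally show ?thesis .
qed

definition dver :: "('n::finite \<Rightarrow> nat) \<Rightarrow> complex \<Rightarrow> complex \<Rightarrow> complex \<Rightarrow> complex \<Rightarrow> complex ^ 'n" where
  "dver e s t a b = vderiv (\<lambda>z. ver e (s + z * a) (t + z * b)) 0"

lemma dver_nth:
  fixes e :: "'n::finite \<Rightarrow> nat"
  shows "dver e s t a b $ i =
    of_nat (CARD('n) - 1 - e i) * s ^ (CARD('n) - 1 - e i - 1) * a * t ^ e i
    + s ^ (CARD('n) - 1 - e i) * (of_nat (e i) * t ^ (e i - 1) * b)"
proof -
  let ?m = "CARD('n) - 1 - e i"
  have "((\<lambda>z. (s + z * a) ^ ?m * (t + z * b) ^ e i) has_field_derivative
    of_nat ?m * s ^ (?m - 1) * a * t ^ e i + s ^ ?m * (of_nat (e i) * t ^ (e i - 1) * b)) (at 0)"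
    by (auto intro!: derivative_eq_intros simp: mult_ac)
  then show ?thesis by (simp add: dver_def vderiv_def ver_def DERIV_imp_deriv)
qed

text \<open>Euler's identity: the derivative in the direction of the point itself is
  \<open>CARD('n) - 1\<close> times the point. So a multiple of the point of tangency in a tangent
  vector can be absorbed into the direction.\<close>

lemma dver_shift:
  fixes e :: "'n::finite \<Rightarrow> nat"
  assumes "numbering e"
  shows "dver e s t (a + k * s) (b + k * t) = dver e s t a b + (k * of_nat (CARD('n) - 1)) *s ver e s t"
proof -
  have pw: "of_nat m * x ^ (m - 1) * x = of_nat m * x ^ m" for m and x :: complex
    by (cases m) auto
  have "dver e s t (a + k * s) (b + k * t) $ i = dver e s t a b $ i + k * of_nat (CARD('n) - 1) * ver e s t $ i" for i
  proof -
    let ?m = "CARD('n) - 1 - e i"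
    have "e i \<le> CARD('n) - 1" using assms by (auto simp: numbering_def bij_betw_def)
    then have N: "of_nat (CARD('n) - 1) = of_nat ?m + (of_nat (e i) :: complex)"
      by (metis le_add_diff_inverse2 of_nat_add)
    have "dver e s t (a + k * s) (b + k * t) $ i = dver e s t a b $ i
      + k * ((of_nat ?m * s ^ (?m - 1) * s) * t ^ e i + s ^ ?m * (of_nat (e i) * t ^ (e i - 1) * t))"
      unfolding dver_nth by (simp add: algebra_simps)
    also have "(of_nat ?m * s ^ (?m - 1) * s) * t ^ e i + s ^ ?m * (of_nat (e i) * t ^ (e i - 1) * t)
       = of_nat (CARD('n) - 1) * (s ^ ?m * t ^ e i)"
      unfolding pw N by (simp add: algebra_simps)
    finally show ?thesis by (simp add: ver_def)
  qed
  then show ?thesis by (simp add: vec_eq_iff)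
qed

lemma line_avoids_origin:
  fixes s t a b z :: complex
  assumes "t * a \<noteq> s * b" shows "(s + z * a, t + z * b) \<noteq> (0, 0)"
proof
  assume "(s + z * a, t + z * b) = (0, 0)"
  then have "s = - z * a" "t = - z * b" by (auto simp: add_eq_0_iff)
  then show False using assms by simp
qed

text \<open>Along a line in the parameter plane the coordinates of \<open>ver\<close> are
  polynomials of degree at most \<open>n\<close>. Their linear coefficients are extracted by
  evaluating at the \<open>n\<close>-th roots of unity, hence from \<open>n\<close> points of the
  curve.\<close>

lemma dver_in_span:
  fixes e :: "'n::finite \<Rightarrow> nat"
  assumes e: "numbering e" and n: "CARD('n) = n + 1" "n \<ge> 1" and ab: "t * a \<noteq> s * b"
  shows "\<exists>F \<subseteq> {ver e x y | x y. (x, y) \<noteq> (0, 0)}. finite F \<and> card F \<le> n \<and> dver e s t a b \<in> vec.span F"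
proof (cases "n = 1")
  \<comment> \<open>Modulo 1 all exponents are congruent, so the filter separates nothing; here
    \<open>ver\<close> is linear and equals its own derivative in the direction of its
    argument.\<close>
  case True
  have "dver e s t a b $ i = ver e a b $ i" for i
  proof -
    have "e i \<le> 1" using e n True by (auto simp: numbering_def bij_betw_def)
    then have "e i = 0 \<or> e i = 1" by linarith
    then show ?thesis using n True by (auto simp: dver_nth ver_def)
  qed
  then have "dver e s t a b = ver e a b" by (simp add: vec_eq_iff)
  moreover have "(a, b) \<noteq> (0, 0)" using ab by auto
  ultimately show ?thesis using True by (intro exI[of _ "{ver e a b}"]) (auto intro: vec.span_base)
next
  case False
  then have n2: "n \<ge> 2" using n(2) by simp
  define \<omega> :: complex where "\<omega> = exp (2 * of_real pi * \<i> * of_nat 1 / of_nat n)"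
  let ?p = "\<lambda>j. ver e (s + \<omega> ^ j * a) (t + \<omega> ^ j * b)"
  have "of_nat n *s dver e s t a b = (\<Sum>j<n. (\<omega> ^ j) ^ (n - 1) *s ?p j)"
    unfolding vec_eq_iff
  proof
    fix i
    have ei: "e i \<le> n" using e n by (auto simp: numbering_def bij_betw_def)
    define p where "p = [:s, a:] ^ (n - e i) * [:t, b:] ^ e i"
    have pz: "poly p z = ver e (s + z * a) (t + z * b) $ i" for z
      by (simp add: p_def ver_def n(1))
    have "degree p \<le> degree ([:s, a:] ^ (n - e i)) + degree ([:t, b:] ^ e i)"
      unfolding p_def by (rule degree_mult_le)
    also have "\<dots> \<le> (n - e i) + e i"
    proof -
      have "degree ([:c, d:] ^ k) \<le> k" for c d :: complex and k
        using degree_power_le[of "[:c, d:]" k] by (cases "d = 0") auto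
      then show ?thesis by (intro add_mono)
    qed
    finally have deg: "degree p \<le> n" using ei by simp
    have "(poly p has_field_derivative poly (pderiv p) 0) (at 0)" by (rule poly_DERIV)
    then have "dver e s t a b $ i = poly (pderiv p) 0"
      by (simp add: dver_def vderiv_def pz[symmetric] DERIV_imp_deriv)
    also have "\<dots> = coeff p 1" by (simp add: poly_0_coeff_0 coeff_pderiv)
    finally show "(of_nat n *s dver e s t a b) $ i
      = (\<Sum>j<n. (\<omega> ^ j) ^ (n - 1) *s ver e (s + \<omega> ^ j * a) (t + \<omega> ^ j * b)) $ i"
      using linear_coeff_filter[OF n2 deg] by (simp add: pz \<omega>_def)
  qed
  then have "of_nat n *s dver e s t a b \<in> vec.span (?p ` {..<n})"
    by (auto intro!: vec.span_sum vec.span_scale intro: vec.span_base)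
  from vec.span_scale[OF this, of "1 / of_nat n"]
  have "dver e s t a b \<in> vec.span (?p ` {..<n})"
    using n(2) by simp
  moreover have "?p ` {..<n} \<subseteq> {ver e x y | x y. (x, y) \<noteq> (0, 0)}"
    using line_avoids_origin[OF ab] by blast
  moreover have "card (?p ` {..<n}) \<le> n" using card_image_le[of "{..<n}" ?p] by simp
  ultimately show ?thesis by blast
qed

text \<open>
  A product of \<open>n\<close> linear forms, one vanishing at the point of tangency and one at each of the at most
  \<open>n - 1\<close> other points, is a functional that separates the tangent direction from those points.
\<close>
lemma dver_not_in_span:
  fixes e :: "'n::finite \<Rightarrow> nat"
  assumes e: "numbering e" and n: "CARD('n) = n + 1" and st: "(s, t) \<noteq> (0, 0)" and ab: "t * a \<noteq> s * b"
    and F: "finite F" "card F < n"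
    and FV: "\<And>v. v \<in> F \<Longrightarrow> \<exists>k x y. v = k *s ver e x y \<and> t * x \<noteq> s * y"
  obtains w where "\<And>v. v \<in> F \<Longrightarrow> fdot w v = 0" "fdot w (ver e s t) = 0" "fdot w (dver e s t a b) \<noteq> 0"
proof -
  obtain k x y where kxy: "\<And>v. v \<in> F \<Longrightarrow> v = k v *s ver e (x v) (y v) \<and> t * x v \<noteq> s * y v"
    using FV by metis
  obtain h where h: "bij_betw h {..<card F} F" using ex_bij_betw_nat_finite[OF F(1)] by (auto simp: atLeast0LessThan)
  define m where "m = card F"
  have hF: "h j \<in> F" if "j < m" for j using h that by (auto simp: m_def bij_betw_def)
  \<comment> \<open>A linear form with value 1 at the point of tangency. It pads the product to
    exactly \<open>n\<close> factors when there are fewer than \<open>n - 1\<close> other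
    points.\<close>
  obtain p q where pq: "p * s + q * t = 1"
  proof (cases "s = 0")
    case True
    then show thesis using st that[of 0 "1 / t"] by auto
  next
    case False
    then show thesis using that[of "1 / s" 0] by auto
  qed
  define \<alpha> where "\<alpha> j = (if j < m then y (h j) else if j = m then t else p)" for j
  define \<beta> where "\<beta> j = (if j < m then - x (h j) else if j = m then - s else q)" for j
  obtain w where w: "\<And>x y. fdot w (ver e x y) = (\<Prod>j\<in>{..<n}. \<alpha> j * x + \<beta> j * y)"
    using ver_product_functional[OF e, of "{..<n}" \<alpha> \<beta>] n by auto
  have mn: "m \<in> {..<n}" using F(2) by (simp add: m_def)
  have split: "fdot w (ver e u v) = (t * u - s * v) * (\<Prod>j\<in>{..<n} - {m}. \<alpha> j * u + \<beta> j * v)" for u v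
    unfolding w prod.remove[OF finite_lessThan mn] by (simp add: \<alpha>_def \<beta>_def)
  show thesis
  proof (rule that[of w])
    show "fdot w (ver e s t) = 0" by (simp add: split)
    show "fdot w v = 0" if v: "v \<in> F" for v
    proof -
      have "v \<in> h ` {..<m}" using h v by (simp add: m_def bij_betw_def)
      then obtain j where j: "j < m" "h j = v" by auto
      have "fdot w (ver e (x v) (y v)) = 0"
        unfolding w using j mn by (intro prod_zero bexI[of _ j]) (auto simp: \<alpha>_def \<beta>_def)
      then show ?thesis using kxy[OF v] by (metis fdot_simps(4) mult_zero_right)
    qed
    \<comment> \<open>The factor for the point of tangency contributes
      \<open>z * (t * a - s * b)\<close> along the line, so the derivative at 0 is
      \<open>t * a - s * b\<close> times the product \<open>R 0\<close> of the other factors, all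
      nonzero there.\<close>
    define R where "R z = (\<Prod>j\<in>{..<n} - {m}. \<alpha> j * (s + z * a) + \<beta> j * (t + z * b))" for z
    have hol: "hol_curve (\<lambda>z. ver e (s + z * a) (t + z * b)) UNIV"
      unfolding hol_curve_def ver_def by (auto intro!: holomorphic_intros)
    have "((\<lambda>z. fdot w (ver e (s + z * a) (t + z * b))) has_field_derivative fdot w (dver e s t a b)) (at 0)"
      unfolding dver_def by (rule fdot_deriv(2)[OF hol open_UNIV UNIV_I])
    moreover have "fdot w (ver e (s + z * a) (t + z * b)) = z * ((t * a - s * b) * R z)" for z
      by (simp add: split R_def algebra_simps)
    moreover have "((\<lambda>z. z * ((t * a - s * b) * R z)) has_field_derivative (t * a - s * b) * R 0) (at 0)"
    proof -
      have "R holomorphic_on UNIV" unfolding R_def by (intro holomorphic_intros)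
      then have "R field_differentiable (at 0)" by (rule holomorphic_on_imp_differentiable_at) auto
      then obtain R' where "(R has_field_derivative R') (at 0)" by (auto simp: field_differentiable_def)
      then show ?thesis by (auto intro!: derivative_eq_intros)
    qed
    ultimately have "fdot w (dver e s t a b) = (t * a - s * b) * R 0" using DERIV_unique by force
    moreover have "\<alpha> j * s + \<beta> j * t \<noteq> 0" if "j \<noteq> m" for j
    proof (cases "j < m")
      case True
      then show ?thesis using kxy[OF hF[OF True]] by (auto simp: \<alpha>_def \<beta>_def algebra_simps)
    next
      case False
      then show ?thesis using that pq by (simp add: \<alpha>_def \<beta>_def)
    qed
    then have "R 0 \<noteq> 0" by (auto simp: R_def)
    ultimately show "fdot w (dver e s t a b) \<noteq> 0" using ab by simp
  qed
qed

section \<open>Rank and spans of vectors\<close>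

lemma point_of_in_linear_span:
  assumes "w \<noteq> 0" "S \<subseteq> affine_cone C"
  shows "w \<in> vec.span S \<Longrightarrow> point_of w \<in> linear_span (point_of ` S)"
proof -
  assume w: "w \<in> vec.span S"
  have "v \<in> (\<Union>p\<in>point_of ` S. line_of p)" if "v \<in> S" for v
  proof -
    have "v \<noteq> 0" using that assms(2) by (auto simp: affine_cone_def)
    then have "v \<in> line_of (point_of v)" by (simp add: vec.span_base)
    then show ?thesis using that by blast
  qed
  then have "vec.span S \<subseteq> vec.span (\<Union>p\<in>point_of ` S. line_of p)" by (intro vec.span_mono) blast
  then have "w \<in> vec.span (\<Union>p\<in>point_of ` S. line_of p)" using w by blast
  then show "point_of w \<in> linear_span (point_of ` S)"
    using assms(1) by (simp add: linear_span_def vec.span_minimal)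
qed

lemma linear_span_vectors:
  assumes "S \<subseteq> C" "finite S" "point_of w \<in> linear_span S" "w \<noteq> 0"
  obtains V where "V \<subseteq> affine_cone C" "finite V" "card V \<le> card S" "w \<in> vec.span V"
proof -
  have "\<exists>v. v \<noteq> 0 \<and> p = point_of v" for p :: "'a proj" using point_cases by metis
  then obtain \<rho> where \<rho>: "\<And>p :: 'a proj. \<rho> p \<noteq> 0 \<and> p = point_of (\<rho> p)" by metis
  have line: "line_of p = vec.span {\<rho> p}" for p using \<rho>[of p] line_of_point_of by metis
  have "line_of p \<subseteq> vec.span (\<rho> ` S)" if "p \<in> S" for p
    unfolding line by (rule vec.span_mono) (use that in auto)
  then have "vec.span (\<Union>p\<in>S. line_of p) \<subseteq> vec.span (\<rho> ` S)" by (intro vec.span_minimal) auto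
  moreover have "w \<in> vec.span (\<Union>p\<in>S. line_of p)"
    using assms(3,4) vec.span_base[of w "{w}"] by (auto simp: linear_span_def)
  ultimately have "w \<in> vec.span (\<rho> ` S)" by blast
  moreover have "\<rho> ` S \<subseteq> affine_cone C" using \<rho> assms(1) by (auto simp: affine_cone_def)
  ultimately show thesis using that[of "\<rho> ` S"] assms(2) card_image_le by blast
qed

lemma curve_rank_le:
  assumes "S \<subseteq> affine_cone C" "finite S" "w \<noteq> 0" "w \<in> vec.span S"
  shows "curve_rank C (point_of w) \<le> card S"
proof -
  have "curve_rank C (point_of w) \<le> card (point_of ` S)"
    unfolding curve_rank_def
    by (rule Least_le, rule exI[of _ "point_of ` S"])
      (use assms point_of_in_linear_span[OF assms(3,1,4)] in \<open>auto simp: affine_cone_def\<close>)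
  also have "\<dots> \<le> card S" by (rule card_image_le[OF assms(2)])
  finally show ?thesis .
qed

lemma curve_rank_eqI:
  assumes S: "S \<subseteq> affine_cone C" "finite S" "card S \<le> n" "w \<in> vec.span S" and w: "w \<noteq> 0"
    and lower: "\<And>V. V \<subseteq> affine_cone C \<Longrightarrow> finite V \<Longrightarrow> w \<in> vec.span V \<Longrightarrow> n \<le> card V"
  shows "curve_rank C (point_of w) = n"
proof (rule antisym)
  show "curve_rank C (point_of w) \<le> n" using curve_rank_le[OF S(1,2) w S(4)] S(3) by simp
  let ?P = "\<lambda>r. \<exists>S\<subseteq>C. finite S \<and> card S = r \<and> point_of w \<in> linear_span S"
  have "?P (card (point_of ` S))"
    using S point_of_in_linear_span[OF w S(1,4)] by (intro exI[of _ "point_of ` S"]) (auto simp: affine_cone_def)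
  then have "?P (LEAST r. ?P r)" by (rule LeastI)
  then obtain T where T: "T \<subseteq> C" "finite T" "card T = curve_rank C (point_of w)" "point_of w \<in> linear_span T"
    by (auto simp: curve_rank_def)
  obtain V where "V \<subseteq> affine_cone C" "finite V" "card V \<le> card T" "w \<in> vec.span V"
    using linear_span_vectors[OF T(1,2,4) w] by blast
  then show "n \<le> curve_rank C (point_of w)" using lower[of V] T(3) by simp
qed

text \<open>Up to a scalar, every point of the tangent line other than the point of tangency is the
  image of some \<open>dver\<close> for a suitable direction. \<open>dver_in_span\<close> then
  bounds the rank above and \<open>dver_not_in_span\<close> below.\<close>

lemma (in smooth_curve) tangent_rank_of_rational_normal:
  assumes n: "n \<ge> 1" "CARD('n) = n + 1" and rnc: "rational_normal_curve C"
    and p: "p \<in> C" and x: "x \<in> embedded_tangent_space C p" "x \<noteq> p"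
  shows "curve_rank C x = n"
proof -
  obtain e A where e: "numbering e" and A: "invertible A"
    and img: "C = projectivity A ` standard_rational_normal_curve e"
    using rnc unfolding rational_normal_curve_def numbering_def[symmetric] by blast
  note C = img[unfolded rational_normal_curve_image[OF e A]]
  obtain A' where A': "A' ** A = mat 1" using A invertible_left_inverse by blast
  have A'A: "A' *v (A *v v) = v" for v by (simp add: matrix_vector_mul_assoc A')
  have coneI: "A *v ver e s t \<in> affine_cone C" if "(s, t) \<noteq> (0, 0)" for s t
  proof -
    have "point_of (A *v ver e s t) \<in> C" unfolding C using that by blast
    then show ?thesis using projectivity_point_of(2)[OF A ver_nonzero[OF e that]] by (simp add: affine_cone_def)
  qed
  have coneE: "\<exists>k s t. (s, t) \<noteq> (0, 0) \<and> v = k *s (A *v ver e s t)" if "v \<in> affine_cone C" for v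
  proof -
    have v: "v \<noteq> 0" "point_of v \<in> C" using that by (auto simp: affine_cone_def)
    obtain s t where st: "(s, t) \<noteq> (0, 0)" "point_of v = point_of (A *v ver e s t)"
      using v(2) unfolding C by blast
    then have "v \<in> vec.span {A *v ver e s t}"
      using point_of_eq_iff[OF projectivity_point_of(2)[OF A ver_nonzero[OF e st(1)]] v(1)] by simp
    then show ?thesis using st(1) by (auto simp: span_singleton_iff)
  qed
  obtain s t where st: "(s, t) \<noteq> (0, 0)" "p = point_of (A *v ver e s t)" using p unfolding C by blast
  define v0 where "v0 = A *v ver e s t"
  have v0: "v0 \<in> affine_cone C" "v0 \<noteq> 0"
    using coneI[OF st(1)] by (auto simp: v0_def affine_cone_def)
  let ?T = "tangent_space C (point_of v0)"
  have v0T: "v0 \<in> ?T" unfolding tangent_space_eq[OF v0(2)] using euler[OF _ v0(1)] by blast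
  obtain u where u: "u \<noteq> 0" "x = point_of u" using point_cases by blast
  have uT: "u \<in> ?T"
    using x(1) u st(2) vec.span_base[of u "{u}"] by (auto simp: embedded_tangent_space_def v0_def)
  have uv0: "u \<notin> vec.span {v0}" using x(2) u st(2) point_of_eq_iff[OF v0(2) u(1)] by (simp add: v0_def)
  have dT: "A *v dver e s t a b \<in> ?T" if ab: "t * a \<noteq> s * b" for a b
  proof -
    let ?g = "\<lambda>z. A *v ver e (s + z * a) (t + z * b)"
    have hol: "hol_curve ?g UNIV" by (rule ver_curve_holomorphic)
    have hol': "hol_curve (\<lambda>z. ver e (s + z * a) (t + z * b)) UNIV"
      unfolding hol_curve_def ver_def by (auto intro!: holomorphic_intros)
    have "deriv (\<lambda>z. ?g z $ i) 0 = fdot (A $ i) (dver e s t a b)" for i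
      unfolding matrix_vector_mult_rows dver_def
      using fdot_deriv(1)[OF hol' open_UNIV UNIV_I, of "A $ i" 0] by simp
    then have vd: "vderiv ?g 0 = A *v dver e s t a b"
      by (simp add: vderiv_def matrix_vector_mult_rows)
    have "fdot (grad f v0) (A *v dver e s t a b) = 0" if f: "f \<in> vanishing_forms C" for f
    proof -
      have "((\<lambda>z. mpoly_eval f (?g z)) has_field_derivative fdot (grad f (?g 0)) (vderiv ?g 0)) (at 0)"
        by (rule mpoly_curve_deriv[OF hol open_UNIV UNIV_I])
      moreover have "mpoly_eval f (?g z) = 0" for z
        using f coneI[OF line_avoids_origin[OF ab]] by (auto simp: vanishing_forms_cone)
      ultimately have "((\<lambda>z. 0) has_field_derivative fdot (grad f v0) (A *v dver e s t a b)) (at 0)"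
        by (simp add: vd v0_def)
      then show ?thesis using DERIV_unique DERIV_const by blast
    qed
    then show ?thesis unfolding tangent_space_eq[OF v0(2)] by blast
  qed
  obtain a b where ab: "t * a \<noteq> s * b"
    using st(1) that[of 0 1] that[of 1 0] by (cases "s = 0") auto
  let ?w = "A *v dver e s t a b"
  have wv0: "?w \<notin> vec.span {v0}"
  proof
    assume "?w \<in> vec.span {v0}"
    then obtain k where "?w = k *s v0" by (auto simp: span_singleton_iff)
    then have "dver e s t a b = k *s ver e s t" by (metis A'A v0_def vec.scale)
    moreover obtain w where "fdot w (ver e s t) = 0" "fdot w (dver e s t a b) \<noteq> 0"
      by (rule dver_not_in_span[OF e n(2) st(1) ab, of "{}"]) (use n in auto)
    ultimately show False by simp
  qed
  have "?T = vec.span {v0, ?w}"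
    by (rule dim_plane_unique[OF tangent_space_subspace dim_tangent[OF v0(1)] v0T dT[OF ab] v0(2) wv0])
  then obtain c d where cd: "u = c *s v0 + d *s ?w" using uT span_pair by blast
  have d: "d \<noteq> 0" using cd uv0 by (auto simp: span_singleton_iff)
  \<comment> \<open>By \<open>dver_shift\<close> this is the shift of direction that produces the
    term \<open>c *s v0\<close> of \<open>u\<close>.\<close>
  define k where "k = c / (d * of_nat n)"
  define a' where "a' = a + k * s"
  define b' where "b' = b + k * t"
  have ab': "t * a' \<noteq> s * b'" using ab by (simp add: a'_def b'_def algebra_simps)
  have "d *s dver e s t a' b' = d *s dver e s t a b + c *s ver e s t"
    unfolding a'_def b'_def dver_shift[OF e] using d n by (simp add: k_def vec.scale_right_distrib)
  then have u': "u = A *v (d *s dver e s t a' b')"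
    by (simp add: cd v0_def vec.add vec.scale add.commute)
  obtain F where F: "F \<subseteq> {ver e x y | x y. (x, y) \<noteq> (0, 0)}" "finite F" "card F \<le> n" "dver e s t a' b' \<in> vec.span F"
    using dver_in_span[OF e n(2,1) ab'] by blast
  show ?thesis
    unfolding u(2)
  proof (rule curve_rank_eqI[OF _ _ _ _ u(1)])
    show "(*v) A ` F \<subseteq> affine_cone C" using F(1) coneI by blast
    show "finite ((*v) A ` F)" using F(2) by simp
    show "card ((*v) A ` F) \<le> n" using card_image_le[OF F(2)] F(3) order_trans by blast
    show "u \<in> vec.span ((*v) A ` F)"
      unfolding u' vec.linear_span_image[OF matrix_vector_mul_linear_gen] by (intro imageI vec.span_scale F(4))
    fix V assume V: "V \<subseteq> affine_cone C" "finite V" "u \<in> vec.span V"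
    show "n \<le> card V"
    proof (rule ccontr)
      assume "\<not> n \<le> card V"
      \<comment> \<open>Vectors proportional to \<open>v0\<close> are set aside: the separating
        functional vanishes at the point of tangency anyway, and only the other vectors use up
        linear factors.\<close>
      let ?V = "{v \<in> V. v \<notin> vec.span {v0}}"
      let ?F = "(*v) A' ` ?V"
      have "card ?F \<le> card ?V" by (rule card_image_le) (use V in simp)
      also have "\<dots> \<le> card V" by (rule card_mono) (use V in auto)
      finally have cF: "card ?F < n" using \<open>\<not> n \<le> card V\<close> by simp
      have FV: "\<exists>k x y. v = k *s ver e x y \<and> t * x \<noteq> s * y" if "v \<in> ?F" for v
      proof -
        obtain v' where v': "v' \<in> V" "v' \<notin> vec.span {v0}" "v = A' *v v'" using \<open>v \<in> ?F\<close> by blast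
        obtain k x y where kxy: "(x, y) \<noteq> (0, 0)" "v' = k *s (A *v ver e x y)" using coneE V(1) v'(1) by blast
        have "t * x \<noteq> s * y"
        proof
          assume eq: "t * x = s * y"
          obtain h where h: "x = h * s" "y = h * t"
          proof (cases "s = 0")
            case True
            then show thesis using eq st(1) that[of "y / t"] by auto
          next
            case False
            then show thesis using eq that[of "x / s"] by (auto simp: field_simps)
          qed
          have "v' = (k * h ^ (CARD('n) - 1)) *s v0"
            unfolding kxy(2) h ver_scale[OF e] v0_def by (simp add: vec.scale)
          then show False using v'(2) by (auto simp: span_singleton_iff)
        qed
        moreover have "v = k *s ver e x y" by (simp add: v'(3) kxy(2) vec.scale A'A)
        ultimately show ?thesis by blast
      qed
      have finF: "finite ?F" using V(2) by simp
      show False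
      proof (rule dver_not_in_span[OF e n(2) st(1) ab' finF cF FV])
        fix w assume w: "\<And>v. v \<in> ?F \<Longrightarrow> fdot w v = 0" "fdot w (ver e s t) = 0" "fdot w (dver e s t a' b') \<noteq> 0"
        have "fdot (w v* A') v = 0" if v: "v \<in> V" for v
        proof (cases "v \<in> vec.span {v0}")
          case True
          then obtain k where "v = k *s v0" by (auto simp: span_singleton_iff)
          then show ?thesis using w(2) by (simp add: fdot_matrix[symmetric] v0_def vec.scale A'A)
        next
          case False
          then show ?thesis using w(1)[of "A' *v v"] v by (auto simp: fdot_matrix[symmetric])
        qed
        then have "fdot (w v* A') u = 0" using V(3) by (rule fdot_zero_span)
        then have "d * fdot w (dver e s t a' b') = 0"
          unfolding fdot_matrix[symmetric] u' A'A by simp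
        then show False using d w(3) by simp
      qed
    qed
  qed
qed

theorem theorem2:
  fixes n :: nat and C :: "'n::finite proj set"
  assumes "n \<ge> 1" and "CARD('n) = n + 1"
    and "curve C" and "nondegenerate C" and "nonsingular C"
  shows "(\<forall>p\<in>C. \<forall>x\<in>embedded_tangent_space C p. x \<noteq> p \<longrightarrow> curve_rank C x = n)
         \<longleftrightarrow> rational_normal_curve C"
proof
  interpret smooth_curve C by unfold_locales (rule assms)+
  show "\<forall>p\<in>C. \<forall>x\<in>embedded_tangent_space C p. x \<noteq> p \<longrightarrow> curve_rank C x = n"
    if "rational_normal_curve C"
    by (intro ballI impI) (rule tangent_rank_of_rational_normal[OF assms(1,2) that])
  assume rank: "\<forall>p\<in>C. \<forall>x\<in>embedded_tangent_space C p. x \<noteq> p \<longrightarrow> curve_rank C x = n"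
  \<comment> \<open>A tangent point in the span of at most \<open>n - 1\<close> points would have
    rank below \<open>n\<close>, unless it is the point of tangency.\<close>
  interpret tangent_rank_curve C
  proof unfold_locales
    fix v w S
    assume v: "v \<in> affine_cone C" and w: "w \<in> tangent_space C (point_of v)"
      and S: "finite S" "S \<subseteq> affine_cone C" "card S + 2 \<le> CARD('n)" "w \<in> vec.span S"
    show "w \<in> vec.span {v}"
    proof (rule ccontr)
      assume wv: "w \<notin> vec.span {v}"
      then have w0: "w \<noteq> 0" using vec.span_zero by blast
      have "point_of w \<in> embedded_tangent_space C (point_of v)"
        using w w0 vec.span_minimal[OF _ tangent_space_subspace, of "{w}"] by (simp add: embedded_tangent_space_def)
      moreover have "point_of w \<noteq> point_of v" using point_of_eq_iff[OF _ w0] wv v by (auto simp: affine_cone_def)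
      ultimately have "curve_rank C (point_of w) = n" using rank v by (auto simp: affine_cone_def)
      moreover have "curve_rank C (point_of w) \<le> card S" by (rule curve_rank_le[OF S(2,1) w0 S(4)])
      ultimately show False using S(3) assms(2) by simp
    qed
  qed
  show "rational_normal_curve C" by (rule rational_normal_of_tangent_rank) (use assms in simp)
qed

end
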